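(* Let $K$ be a field and let $\mathcal{C}$ be a $d$-uniform clutter on the vertex set $X=\{x_1,\ldots,x_n\}$. Let $$Y=\{y_{ij}\mid 1\leq i\leq n;\ 1\leq j\leq d-1\}$$ be a set of new variables, and let $\mathcal{C}'$ be the clutter with vertex set $V(\mathcal{C}')=X\cup Y$ and edge set $$E(\mathcal{C}')=E(\mathcal{C})\cup\{\{x_1,y_{11},\ldots,y_{1(d-1)}\},\ldots,\{x_n,y_{n1},\ldots,y_{n(d-1)}\}\}.$$ Then the edge ideal $I(\mathcal{C}')$ is Cohen-Macaulay, i.e. $K[X\cup Y]/I(\mathcal{C}')$ is a Cohen-Macaulay ring. Moreover, if $\mathcal{C}$ satisfies the packing property, then $\mathcal{C}'$ satisfies the packing property; and if $\mathcal{C}$ satisfies the max-flow min-cut property, then $\mathcal{C}'$ satisfies the max-flow min-cut property.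
   Context: A clutter $\mathcal{C}$ with finite vertex set $V(\mathcal{C})=X=\{x_1,\ldots,x_n\}$ is a family $E(\mathcal{C})$ of subsets of $X$ (edges), none of which is included in another; it is $d$-uniform if every edge has exactly $d$ vertices. Standing assumption on $\mathcal{C}$: $n\geq 1$ and each vertex lies in at least one edge (so all edges are nonempty and $d\ge 1$). The vertices are identified with indeterminates. The edge ideal $I(\mathcal{C})$ is the ideal of $K[V(\mathcal{C})]$ generated by the square-free monomials $\prod_{x_i\in e}x_i$, $e\in E(\mathcal{C})$ (the zero ideal if there are no edges). This gives a bijection between clutters and square-free monomial ideals. Minors: let $X'=\{x_{i_1},\ldots,x_{i_r},x_{j_1},\ldots,x_{j_s}\}$ be a subset of $X$ (distinct elements; $X'$ may be empty). A minor of $I=I(\mathcal{C})$ is a proper ideal $I'$ of $K[X\setminus X']$ obtained from $I$ by making $x_{i_k}=0$ and $x_{j_\ell}=1$ for all $k,\ell$ (in the generators of $I$). A minor of $\mathcal{C}$ is a clutter (on the vertex set $X\setminus X'$) whose edge ideal is a minor $I'$ of $I$; its edges are the supports of the minimal monomial generators of $I'$. In particular $\mathcal{C}$ is a minor of itself. König and packing properties: a vertex cover of $\mathcal{C}$ is a set of vertices meeting every edge; $\alpha_0(\mathcal{C})$ is the minimum cardinality of a vertex cover; $\beta_1(\mathcal{C})$ is the maximum number of pairwise disjoint edges. $\mathcal{C}$ has the König property if $\alpha_0(\mathcal{C})=\beta_1(\mathcal{C})$. $\mathcal{C}$ satisfies the packing property if every minor of $\mathcal{C}$ has the König property. Max-flow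 min-cut property: let $A$ be the incidence matrix of $\mathcal{C}$, i.e. the $n\times q$ matrix whose columns are the characteristic vectors of the edges of $\mathcal{C}$, and let $\mathbf{1}$ be the all-ones vector. $\mathcal{C}$ satisfies the max-flow min-cut property if both sides of the LP-duality equation $$\min\{\langle w,x\rangle \mid x\geq 0;\ xA\geq\mathbf{1}\}=\max\{\langle y,\mathbf{1}\rangle \mid y\geq 0;\ Ay\leq w\}$$ have integral optimum solutions $x$ and $y$ for each non-negative integral vector $w$. *)

theory Defs
  imports
    Complex_Main
    "HOL-Library.Poly_Mapping"
    "HOL-Library.Extended_Nat"
    "HOL-Library.Disjoint_Sets"
    "HOL-Algebra.Algebra"
    "HOL-Algebra.Algebraic_Closure_Type"
begin

section \<open>Cohen-Macaulay rings\<close>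

definition krull_dim :: "('a, 'm) ring_scheme \<Rightarrow> enat" where
  "krull_dim R = (SUP n \<in> {n :: nat. \<exists>P :: nat \<Rightarrow> 'a set.
      (\<forall>i\<le>n. primeideal (P i) R) \<and> (\<forall>i<n. P i \<subset> P (Suc i))}. enat n)"

text \<open>
  \<open>fs ! i\<close> is a nonzerodivisor modulo the ideal generated by its predecessors,
  and the whole sequence generates a proper ideal.
\<close>

definition regular_sequence :: "('a, 'm) ring_scheme \<Rightarrow> 'a list \<Rightarrow> bool" where
  "regular_sequence R fs \<longleftrightarrow>
     set fs \<subseteq> carrier R \<and>
     (\<forall>i<length fs. \<forall>a\<in>carrier R.
        fs ! i \<otimes>\<^bsub>R\<^esub> a \<in> Idl\<^bsub>R\<^esub> (set (take i fs)) \<longrightarrow> a \<in> Idl\<^bsub>R\<^esub> (set (take i fs))) \<and>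
     Idl\<^bsub>R\<^esub> (set fs) \<noteq> carrier R"

definition depth :: "('a, 'm) ring_scheme \<Rightarrow> 'a set \<Rightarrow> enat" where
  "depth R I = (SUP fs \<in> {fs. regular_sequence R fs \<and> set fs \<subseteq> I}. enat (length fs))"

text \<open>
  The ring of fractions of a commutative ring at a multiplicatively closed subset \<open>S\<close>:
  \<open>a / s = b / t\<close> iff \<open>u (a t - b s) = 0\<close> for some \<open>u \<in> S\<close>. The operations are
  defined on classes by taking the union over all representatives, all of which give the same class.
\<close>

definition frac_rel :: "('a, 'm) ring_scheme \<Rightarrow> 'a set \<Rightarrow> (('a \<times> 'a) \<times> ('a \<times> 'a)) set" where
  "frac_rel R S = {((a, s), (b, t)). a \<in> carrier R \<and> s \<in> S \<and> b \<in> carrier R \<and> t \<in> S \<and>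
     (\<exists>u\<in>S. u \<otimes>\<^bsub>R\<^esub> ((a \<otimes>\<^bsub>R\<^esub> t) \<ominus>\<^bsub>R\<^esub> (b \<otimes>\<^bsub>R\<^esub> s)) = \<zero>\<^bsub>R\<^esub>)}"

definition fraction :: "('a, 'm) ring_scheme \<Rightarrow> 'a set \<Rightarrow> 'a \<Rightarrow> 'a \<Rightarrow> ('a \<times> 'a) set" where
  "fraction R S a s = frac_rel R S `` {(a, s)}"

definition localization :: "('a, 'm) ring_scheme \<Rightarrow> 'a set \<Rightarrow> ('a \<times> 'a) set ring" where
  "localization R S = \<lparr>
     carrier = (carrier R \<times> S) // frac_rel R S,
     monoid.mult = (\<lambda>A B. \<Union>(a, s)\<in>A. \<Union>(b, t)\<in>B. fraction R S (a \<otimes>\<^bsub>R\<^esub> b) (s \<otimes>\<^bsub>R\<^esub> t)),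
     one = fraction R S \<one>\<^bsub>R\<^esub> \<one>\<^bsub>R\<^esub>,
     ring.zero = fraction R S \<zero>\<^bsub>R\<^esub> \<one>\<^bsub>R\<^esub>,
     add = (\<lambda>A B. \<Union>(a, s)\<in>A. \<Union>(b, t)\<in>B.
              fraction R S ((a \<otimes>\<^bsub>R\<^esub> t) \<oplus>\<^bsub>R\<^esub> (b \<otimes>\<^bsub>R\<^esub> s)) (s \<otimes>\<^bsub>R\<^esub> t)) \<rparr>"

definition cohen_macaulay_local :: "('a, 'm) ring_scheme \<Rightarrow> bool" where
  "cohen_macaulay_local R \<longleftrightarrow> cring R \<and> noetherian_ring R \<and>
     (\<exists>M. {M'. maximalideal M' R} = {M} \<and> depth R M = krull_dim R)"

definition cohen_macaulay :: "('a, 'm) ring_scheme \<Rightarrow> bool" where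
  "cohen_macaulay R \<longleftrightarrow> cring R \<and> noetherian_ring R \<and>
     (\<forall>M. maximalideal M R \<longrightarrow> cohen_macaulay_local (localization R (carrier R - M)))"


section \<open>Polynomial rings\<close>

text \<open>
  A polynomial is a finitely supported map from exponent vectors to coefficients.
  The field of coefficients is the type \<open>'k\<close>, passed as a type argument \<open>K\<close>.
\<close>

type_synonym ('v, 'k) mpoly = "('v \<Rightarrow>\<^sub>0 nat) \<Rightarrow>\<^sub>0 'k"

definition Var :: "'v \<Rightarrow> ('v, 'k::comm_ring_1) mpoly" where
  "Var v = Poly_Mapping.single (Poly_Mapping.single v 1) 1"

definition polynomial_ring :: "'k::comm_ring_1 itself \<Rightarrow> 'v set \<Rightarrow> ('v, 'k) mpoly ring" where
  "polynomial_ring K V = ring_of_type_algebra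
     \<lparr>carrier := {p. \<forall>m \<in> Poly_Mapping.keys p. Poly_Mapping.keys m \<subseteq> V}\<rparr>"

definition poly_subst :: "('v \<Rightarrow> ('v, 'k) mpoly) \<Rightarrow> ('v, 'k::comm_ring_1) mpoly \<Rightarrow> ('v, 'k) mpoly" where
  "poly_subst f p = (\<Sum>m\<in>Poly_Mapping.keys p. Poly_Mapping.single 0 (Poly_Mapping.lookup p m) *
                  (\<Prod>v\<in>Poly_Mapping.keys m. f v ^ Poly_Mapping.lookup m v))"


section \<open>Clutters\<close>

definition clutter :: "'v set \<Rightarrow> 'v set set \<Rightarrow> bool" where
  "clutter V E \<longleftrightarrow> finite V \<and> (\<forall>e\<in>E. e \<subseteq> V) \<and> (\<forall>e\<in>E. \<forall>f\<in>E. e \<subseteq> f \<longrightarrow> e = f)"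

definition uniform :: "nat \<Rightarrow> 'v set set \<Rightarrow> bool" where
  "uniform d E \<longleftrightarrow> (\<forall>e\<in>E. card e = d)"

definition edge_monomial :: "'v set \<Rightarrow> ('v, 'k::comm_ring_1) mpoly" where
  "edge_monomial e = (\<Prod>v\<in>e. Var v)"

definition edge_ideal :: "'k::field itself \<Rightarrow> 'v set \<Rightarrow> 'v set set \<Rightarrow> ('v, 'k) mpoly set" where
  "edge_ideal K V E = Idl\<^bsub>polynomial_ring K V\<^esub> (edge_monomial ` E)"


subsection \<open>Minors, the Koenig property and the packing property\<close>

text \<open>The variables in \<open>X0\<close> are made 0 and those in \<open>X1\<close> are made 1.\<close>

definition minor_ideal ::
  "'k::field itself \<Rightarrow> 'v set \<Rightarrow> 'v set set \<Rightarrow> 'v set \<Rightarrow> 'v set \<Rightarrow> ('v, 'k) mpoly set" where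
  "minor_ideal K V E X0 X1 =
     Idl\<^bsub>polynomial_ring K (V - (X0 \<union> X1))\<^esub>
       (poly_subst (\<lambda>v. if v \<in> X0 then 0 else if v \<in> X1 then 1 else Var v) ` edge_monomial ` E)"

definition is_minor ::
  "'k::field itself \<Rightarrow> 'v set \<Rightarrow> 'v set set \<Rightarrow> 'v set \<Rightarrow> 'v set set \<Rightarrow> bool" where
  "is_minor K V E V' E' \<longleftrightarrow> clutter V' E' \<and>
     (\<exists>X0 X1. X0 \<subseteq> V \<and> X1 \<subseteq> V \<and> X0 \<inter> X1 = {} \<and> V' = V - (X0 \<union> X1) \<and>
        minor_ideal K V E X0 X1 \<noteq> carrier (polynomial_ring K V') \<and>
        edge_ideal K V' E' = minor_ideal K V E X0 X1)"

definition vertex_cover :: "'v set \<Rightarrow> 'v set set \<Rightarrow> 'v set \<Rightarrow> bool" where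
  "vertex_cover V E T \<longleftrightarrow> T \<subseteq> V \<and> (\<forall>e\<in>E. T \<inter> e \<noteq> {})"

definition covering_number :: "'v set \<Rightarrow> 'v set set \<Rightarrow> nat" where
  "covering_number V E = Min (card ` {T. vertex_cover V E T})"

definition matching_number :: "'v set set \<Rightarrow> nat" where
  "matching_number E = Max (card ` {M. M \<subseteq> E \<and> disjoint M})"

definition koenig_property :: "'v set \<Rightarrow> 'v set set \<Rightarrow> bool" where
  "koenig_property V E \<longleftrightarrow> covering_number V E = matching_number E"

definition packing_property :: "'k::field itself \<Rightarrow> 'v set \<Rightarrow> 'v set set \<Rightarrow> bool" where
  "packing_property K V E \<longleftrightarrow> (\<forall>V' E'. is_minor K V E V' E' \<longrightarrow> koenig_property V' E')"


subsection \<open>The max-flow min-cut property\<close>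

text \<open>The incidence matrix has rows indexed by the vertices and columns indexed by the edges.\<close>

definition incidence :: "'v \<Rightarrow> 'v set \<Rightarrow> real" where
  "incidence v e = (if v \<in> e then 1 else 0)"

definition primal_feasible :: "'v set \<Rightarrow> 'v set set \<Rightarrow> ('v \<Rightarrow> real) \<Rightarrow> bool" where
  "primal_feasible V E x \<longleftrightarrow>
     (\<forall>v\<in>V. x v \<ge> 0) \<and> (\<forall>e\<in>E. (\<Sum>v\<in>V. x v * incidence v e) \<ge> 1)"

definition dual_feasible :: "'v set \<Rightarrow> 'v set set \<Rightarrow> ('v \<Rightarrow> real) \<Rightarrow> ('v set \<Rightarrow> real) \<Rightarrow> bool" where
  "dual_feasible V E w y \<longleftrightarrow>
     (\<forall>e\<in>E. y e \<ge> 0) \<and> (\<forall>v\<in>V. (\<Sum>e\<in>E. incidence v e * y e) \<le> w v)"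

definition primal_optimal :: "'v set \<Rightarrow> 'v set set \<Rightarrow> ('v \<Rightarrow> real) \<Rightarrow> ('v \<Rightarrow> real) \<Rightarrow> bool" where
  "primal_optimal V E w x \<longleftrightarrow> primal_feasible V E x \<and>
     (\<forall>x'. primal_feasible V E x' \<longrightarrow> (\<Sum>v\<in>V. w v * x v) \<le> (\<Sum>v\<in>V. w v * x' v))"

definition dual_optimal :: "'v set \<Rightarrow> 'v set set \<Rightarrow> ('v \<Rightarrow> real) \<Rightarrow> ('v set \<Rightarrow> real) \<Rightarrow> bool" where
  "dual_optimal V E w y \<longleftrightarrow> dual_feasible V E w y \<and>
     (\<forall>y'. dual_feasible V E w y' \<longrightarrow> (\<Sum>e\<in>E. y' e) \<le> (\<Sum>e\<in>E. y e))"

definition max_flow_min_cut :: "'v set \<Rightarrow> 'v set set \<Rightarrow> bool" where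
  "max_flow_min_cut V E \<longleftrightarrow>
     (\<forall>w :: 'v \<Rightarrow> nat.
        (\<exists>x. primal_optimal V E (\<lambda>v. real (w v)) x \<and> (\<forall>v\<in>V. x v \<in> \<int>)) \<and>
        (\<exists>y. dual_optimal V E (\<lambda>v. real (w v)) y \<and> (\<forall>e\<in>E. y e \<in> \<int>)))"

end

theory Submission
  imports Defs
begin

text \<open>
  Cohen-Macaulayness. Put \<open>N = n (d - 1)\<close>, the number of the variables \<open>y\<^sub>i\<^sub>j\<close>. A face of \<open>C'\<close> misses a
  vertex of each whisker, so monomial counting makes any \<open>N + 1\<close> elements of \<open>S = K[X \<union> Y] / I(C')\<close>
  algebraically dependent, and \<open>dim S \<le> N\<close>. In a maximal ideal, Zariski's lemma provides for every
  \<open>z\<^sub>i\<^sub>j = y\<^sub>i\<^sub>j - x\<^sub>i\<close> a monic \<open>g\<^sub>i\<^sub>j \<in> K[T]\<close> such that \<open>g\<^sub>i\<^sub>j(z\<^sub>i\<^sub>j)\<close> lies in the ideal. In the coordinates \<open>x\<^sub>i, z\<^sub>i\<^sub>j\<close>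
  the whisker at \<open>x\<^sub>i\<close> becomes the polynomial \<open>x\<^sub>i \<Prod>\<^sub>j (x\<^sub>i + z\<^sub>i\<^sub>j)\<close>, monic in \<open>x\<^sub>i\<close>, and \<open>S\<close> is free over
  \<open>K[z\<^sub>i\<^sub>j]\<close>. So multiplication by \<open>g\<^sub>i\<^sub>j(z\<^sub>i\<^sub>j)\<close> has a left inverse \<open>Q\<close> that commutes with the other
  \<open>z\<close>'s; applying \<open>Q\<close> to a relation \<open>g f = \<Sum> g\<^sub>k h\<^sub>k\<close> shows that the \<open>g\<^sub>i\<^sub>j(z\<^sub>i\<^sub>j)\<close> form a regular sequence.
  It has length \<open>N\<close>, survives localization, and depth never exceeds dimension.

  Packing and max-flow min-cut. Whiskers are pairwise disjoint, so one may cover each of them at its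
  vertex in \<open>X\<close>, respectively subtract from the weight of that vertex the minimal weight of the whisker;
  what remains is a minor, respectively a weighting, of \<open>C\<close>.
\<close>

section \<open>Prime ideals and depth\<close>

text \<open>The definition tests every maximal ideal \<open>M\<close>, not only the one generated by
  the variables, and \<open>K\<close> is arbitrary. Neither the differences z = y - x nor any z - c
  with c in \<open>K\<close> need lie in \<open>M\<close>, which is why polynomials g(z) take the
  place of the z's. Their number is the same for every \<open>M\<close>, so N <= depth <= dimension
  of the local ring <= dimension of the quotient <= N closes up. The edges of the original clutter
  might spoil the division by a shifted whisker. They do not, because the whisker at x and an edge
  through x share the factor x: the remainder of x f is again a multiple of x, and multiples of an
  edge stay multiples of that edge. Elements of type \<open>mpoly\<close> may involve every variable
  of the type. Ideals are therefore computed in that larger ring and brought back to K[V] by the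
  retraction that kills the variables outside V. For d = 1 a whisker is a single vertex and may
  already be an edge, so sums over the new clutter separate the whiskers from the remaining
  edges.\<close>

lemma (in cring) ideal_of_closed:
  assumes "J \<subseteq> carrier R" "\<zero> \<in> J" "\<And>a b. a \<in> J \<Longrightarrow> b \<in> J \<Longrightarrow> a \<oplus> b \<in> J"
    "\<And>a b. a \<in> J \<Longrightarrow> b \<in> carrier R \<Longrightarrow> b \<otimes> a \<in> J"
  shows "ideal J R"
proof (rule idealI)
  show "subgroup J (add_monoid R)"
  proof (rule add.subgroupI)
    fix a assume a: "a \<in> J"
    then have "\<ominus> a = (\<ominus> \<one>) \<otimes> a" using assms(1) by (auto simp: l_minus)
    then show "\<ominus> a \<in> J" using a assms(4)[of a "\<ominus> \<one>"] by simp
  qed (use assms in auto)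
  fix a b assume "a \<in> J" "b \<in> carrier R"
  then show "b \<otimes> a \<in> J" "a \<otimes> b \<in> J"
    using assms(1) assms(4)[of a b] by (auto simp: m_comm)
qed (rule ring_axioms)

lemma (in cring) ideal_closedD:
  assumes "ideal J R"
  shows "J \<subseteq> carrier R" "\<zero> \<in> J" "\<And>a b. a \<in> J \<Longrightarrow> b \<in> J \<Longrightarrow> a \<oplus> b \<in> J"
    "\<And>a b. a \<in> J \<Longrightarrow> b \<in> carrier R \<Longrightarrow> b \<otimes> a \<in> J"
    "\<And>a b. a \<in> J \<Longrightarrow> b \<in> carrier R \<Longrightarrow> a \<otimes> b \<in> J"
proof -
  interpret J: ideal J R by (rule assms)
  show "J \<subseteq> carrier R" by (rule J.a_subset)
  show "\<zero> \<in> J" by (rule additive_subgroup.zero_closed[OF J.additive_subgroup_axioms])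
  show "\<And>a b. a \<in> J \<Longrightarrow> b \<in> J \<Longrightarrow> a \<oplus> b \<in> J"
    by (rule additive_subgroup.a_closed[OF J.additive_subgroup_axioms])
  show "\<And>a b. a \<in> J \<Longrightarrow> b \<in> carrier R \<Longrightarrow> b \<otimes> a \<in> J" by (rule J.I_l_closed)
  show "\<And>a b. a \<in> J \<Longrightarrow> b \<in> carrier R \<Longrightarrow> a \<otimes> b \<in> J" by (rule J.I_r_closed)
qed

lemma (in cring) ideal_add_principal:
  assumes Q: "ideal Q R" and a: "a \<in> carrier R"
  shows "ideal {q \<oplus> r \<otimes> a | q r. q \<in> Q \<and> r \<in> carrier R} R" (is "ideal ?J R")
    and "Q \<subseteq> {q \<oplus> r \<otimes> a | q r. q \<in> Q \<and> r \<in> carrier R}"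
    and "a \<in> {q \<oplus> r \<otimes> a | q r. q \<in> Q \<and> r \<in> carrier R}"
proof -
  note Q' = ideal_closedD[OF Q]
  have Qc: "q \<in> carrier R" if "q \<in> Q" for q using Q'(1) that by blast
  show "ideal ?J R"
  proof (rule ideal_of_closed)
    show "?J \<subseteq> carrier R" using Qc a by auto
    have "\<zero> = \<zero> \<oplus> \<zero> \<otimes> a" using a by simp
    then show "\<zero> \<in> ?J" using Q'(2) zero_closed by blast
  next
    fix x y assume "x \<in> ?J" "y \<in> ?J"
    then obtain q r q' r' where x: "x = q \<oplus> r \<otimes> a" "q \<in> Q" "r \<in> carrier R"
      and y: "y = q' \<oplus> r' \<otimes> a" "q' \<in> Q" "r' \<in> carrier R" by blast
    have "x \<oplus> y = (q \<oplus> q') \<oplus> (r \<oplus> r') \<otimes> a"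
      using x y a Qc by (simp add: l_distr a_ac)
    then show "x \<oplus> y \<in> ?J" using Q'(3)[OF x(2) y(2)] x(3) y(3) a_closed by blast
  next
    fix x b assume "x \<in> ?J" and b: "b \<in> carrier R"
    then obtain q r where x: "x = q \<oplus> r \<otimes> a" "q \<in> Q" "r \<in> carrier R" by blast
    have "b \<otimes> x = (b \<otimes> q) \<oplus> (b \<otimes> r) \<otimes> a"
      using x a b Qc by (simp add: r_distr m_assoc)
    then show "b \<otimes> x \<in> ?J" using Q'(4)[OF x(2) b] x(3) b m_closed by blast
  qed
  show "Q \<subseteq> ?J"
  proof
    fix q assume q: "q \<in> Q"
    then have "q = q \<oplus> \<zero> \<otimes> a" using a Qc by simp
    then show "q \<in> ?J" using q zero_closed by blast
  qed
  have "a = \<zero> \<oplus> \<one> \<otimes> a" using a by simp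
  then show "a \<in> ?J" using Q'(2) one_closed by blast
qed

text \<open>Krull's argument: an ideal that is maximal among those containing \<open>I\<close> and
  disjoint from \<open>T\<close> is prime. If it contained a product but neither factor, adding
  either factor would create an element of \<open>T\<close>, and the product of these two elements
  would lie in the ideal.\<close>

lemma (in cring) exists_prime_avoiding:
  assumes I: "ideal I R" and T: "T \<subseteq> carrier R" "\<one> \<in> T" "\<And>s t. s \<in> T \<Longrightarrow> t \<in> T \<Longrightarrow> s \<otimes> t \<in> T"
    and disj: "I \<inter> T = {}"
  shows "\<exists>Q. primeideal Q R \<and> I \<subseteq> Q \<and> Q \<inter> T = {}"
proof -
  let ?A = "{J. ideal J R \<and> I \<subseteq> J \<and> J \<inter> T = {}}"
  have "\<exists>M\<in>?A. \<forall>J\<in>?A. M \<subseteq> J \<longrightarrow> J = M"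
  proof (rule subset_Zorn_nonempty)
    show "?A \<noteq> {}" using I disj by blast
    fix C assume ne: "C \<noteq> {}" and "subset.chain ?A C"
    then have C: "\<And>J. J \<in> C \<Longrightarrow> ideal J R \<and> I \<subseteq> J \<and> J \<inter> T = {}"
      and tot: "\<And>J J'. J \<in> C \<Longrightarrow> J' \<in> C \<Longrightarrow> J \<subseteq> J' \<or> J' \<subseteq> J"
      by (auto simp: subset_chain_def)
    have "ideal (\<Union> C) R"
    proof (rule ideal_of_closed)
      show "\<Union> C \<subseteq> carrier R" using C ideal_closedD(1) by blast
      show "\<zero> \<in> \<Union> C" using ne C ideal_closedD(2) by blast
    next
      fix a b assume "a \<in> \<Union> C" "b \<in> \<Union> C"
      then obtain J J' where J: "J \<in> C" "J' \<in> C" "a \<in> J" "b \<in> J'" by blast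
      then consider "a \<in> J'" | "b \<in> J" using tot by blast
      then show "a \<oplus> b \<in> \<Union> C"
      proof cases
        case 1
        then have "a \<oplus> b \<in> J'" using J C ideal_closedD(3) by blast
        then show ?thesis using J by blast
      next
        case 2
        then have "a \<oplus> b \<in> J" using J C ideal_closedD(3) by blast
        then show ?thesis using J by blast
      qed
    next
      fix a b assume "a \<in> \<Union> C" and b: "b \<in> carrier R"
      then obtain J where J: "J \<in> C" "a \<in> J" by blast
      then have "b \<otimes> a \<in> J" using C b ideal_closedD(4) by blast
      then show "b \<otimes> a \<in> \<Union> C" using J by blast
    qed
    then show "\<Union> C \<in> ?A" using ne C by blast
  qed
  then obtain Q where QA: "Q \<in> ?A" and maxA: "\<forall>J\<in>?A. Q \<subseteq> J \<longrightarrow> J = Q" by (rule bexE)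
  have Q: "ideal Q R" "I \<subseteq> Q" "Q \<inter> T = {}" using QA by simp_all
  have max: "J = Q" if "ideal J R" "I \<subseteq> J" "J \<inter> T = {}" "Q \<subseteq> J" for J
    using maxA that by simp
  note Q' = ideal_closedD[OF Q(1)]
  have "primeideal Q R"
  proof (rule primeidealI[OF Q(1) is_cring])
    show "carrier R \<noteq> Q" using Q(3) T(2) by auto
    fix a b assume ab: "a \<in> carrier R" "b \<in> carrier R" "a \<otimes> b \<in> Q"
    have meets: "\<exists>q r. q \<in> Q \<and> r \<in> carrier R \<and> q \<oplus> r \<otimes> c \<in> T" if c: "c \<in> carrier R" "c \<notin> Q" for c
    proof (rule ccontr)
      assume "\<not> ?thesis"
      then have "{q \<oplus> r \<otimes> c | q r. q \<in> Q \<and> r \<in> carrier R} \<inter> T = {}" by blast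
      then have "{q \<oplus> r \<otimes> c | q r. q \<in> Q \<and> r \<in> carrier R} = Q"
        using max ideal_add_principal[OF Q(1) c(1)] Q(2) by (meson order_trans)
      then show False using ideal_add_principal(3)[OF Q(1) c(1)] c(2) by simp
    qed
    show "a \<in> Q \<or> b \<in> Q"
    proof (rule ccontr)
      assume "\<not> (a \<in> Q \<or> b \<in> Q)"
      then have nQ: "a \<notin> Q" "b \<notin> Q" by auto
      obtain q r q' r' where t: "q \<in> Q" "r \<in> carrier R" "q \<oplus> r \<otimes> a \<in> T"
        "q' \<in> Q" "r' \<in> carrier R" "q' \<oplus> r' \<otimes> b \<in> T"
        using meets[OF ab(1) nQ(1)] meets[OF ab(2) nQ(2)] by (elim exE conjE) (rule that)
      have c: "q \<in> carrier R" "q' \<in> carrier R" using t Q'(1) by auto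
      have "(q \<oplus> r \<otimes> a) \<otimes> (q' \<oplus> r' \<otimes> b) =
        (q' \<oplus> r' \<otimes> b) \<otimes> q \<oplus> ((r \<otimes> a) \<otimes> q' \<oplus> (r \<otimes> r') \<otimes> (a \<otimes> b))"
        using c t ab by (simp add: l_distr r_distr m_ac a_ac)
      also have "\<dots> \<in> Q"
        using c t ab by (intro Q'(3) Q'(4)[of q] Q'(4)[of q'] Q'(4)[of "a \<otimes> b"]) auto
      finally show False using T(3) t Q(3) by blast
    qed
  qed
  then show ?thesis using Q by blast
qed

text \<open>The set to avoid is \<open>?T\<close>, the products of an element outside
  \<open>P\<close> with a power of f. Regularity of f modulo \<open>I\<close> strips the powers, so
  \<open>?T\<close> misses \<open>I\<close>; avoiding the elements outside \<open>P\<close> keeps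
  the new prime inside \<open>P\<close>, and avoiding f makes it smaller.\<close>

lemma (in cring) exists_smaller_prime:
  assumes P: "primeideal P R" and I: "ideal I R" "I \<subseteq> P" and f: "f \<in> P"
    and reg: "\<And>a. a \<in> carrier R \<Longrightarrow> f \<otimes> a \<in> I \<Longrightarrow> a \<in> I"
  shows "\<exists>Q. primeideal Q R \<and> I \<subseteq> Q \<and> Q \<subset> P"
proof -
  interpret P: primeideal P R by (rule P)
  have fc: "f \<in> carrier R" using f P.a_subset by blast
  let ?T = "{s \<otimes> f [^] (n::nat) | s n. s \<in> carrier R - P}"
  have oneP: "\<one> \<notin> P" using P.I_notcarr P.one_imp_carrier by blast
  have "s \<in> I" if "s \<in> carrier R" "s \<otimes> f [^] (n::nat) \<in> I" for s n
    using that
  proof (induction n)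
    case (Suc n)
    have "f \<otimes> (s \<otimes> f [^] n) = s \<otimes> f [^] Suc n" using fc Suc.prems by (simp add: m_ac)
    then have "s \<otimes> f [^] n \<in> I" using reg[of "s \<otimes> f [^] n"] fc Suc.prems by simp
    then show ?case using Suc by blast
  qed simp
  then have disj: "I \<inter> ?T = {}" using I(2) by blast
  have "\<exists>Q. primeideal Q R \<and> I \<subseteq> Q \<and> Q \<inter> ?T = {}"
  proof (rule exists_prime_avoiding[OF I(1) _ _ _ disj])
    show "?T \<subseteq> carrier R" using fc by auto
    have "\<one> = \<one> \<otimes> f [^] (0::nat)" by simp
    then show "\<one> \<in> ?T" using oneP by blast
    fix x y assume "x \<in> ?T" "y \<in> ?T"
    then obtain s n s' n' where x: "x = s \<otimes> f [^] (n::nat)" "s \<in> carrier R - P"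
      and y: "y = s' \<otimes> f [^] (n'::nat)" "s' \<in> carrier R - P" by blast
    have "x \<otimes> y = (s \<otimes> s') \<otimes> f [^] (n + n')"
      using x y fc by (simp add: nat_pow_mult[symmetric] m_ac)
    moreover have "s \<otimes> s' \<in> carrier R - P" using x y P.I_prime by auto
    ultimately show "x \<otimes> y \<in> ?T" by blast
  qed
  then obtain Q where Q: "primeideal Q R" "I \<subseteq> Q" "Q \<inter> ?T = {}" by blast
  have Qc: "Q \<subseteq> carrier R" using ideal_closedD(1) Q(1) primeideal.axioms(1) by blast
  have "Q \<subseteq> P"
  proof
    fix s assume s: "s \<in> Q"
    have "s \<in> ?T" if "s \<notin> P"
    proof -
      have "s = s \<otimes> f [^] (0::nat)" using s Qc by auto
      then show ?thesis using s Qc that by blast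
    qed
    then show "s \<in> P" using Q(3) s by blast
  qed
  moreover have "f \<notin> Q"
  proof -
    have "f = \<one> \<otimes> f [^] (1::nat)" using fc by simp
    then have "f \<in> ?T" using oneP one_closed by blast
    then show ?thesis using Q(3) by blast
  qed
  ultimately show ?thesis using Q f by blast
qed

text \<open>The last element is regular modulo its predecessors, which therefore lie in a prime
  strictly below \<open>P\<close>. The induction hypothesis applies to that prime, so the chain is
  built downwards from \<open>P\<close>.\<close>

lemma (in cring) regular_sequence_prime_chain:
  assumes "primeideal P R" "set fs \<subseteq> P"
    and "\<And>i a. i < length fs \<Longrightarrow> a \<in> carrier R \<Longrightarrow> fs ! i \<otimes> a \<in> Idl (set (take i fs)) \<Longrightarrow> a \<in> Idl (set (take i fs))"
  shows "\<exists>C. (\<forall>i\<le>length fs. primeideal (C i) R) \<and> (\<forall>i<length fs. C i \<subset> C (Suc i)) \<and> C (length fs) = P"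
  using assms
proof (induction fs arbitrary: P rule: rev_induct)
  case Nil
  then show ?case by (intro exI[of _ "\<lambda>_. P"]) simp
next
  case (snoc f fs)
  interpret P: primeideal P R by (rule snoc.prems)
  have fs: "set fs \<subseteq> carrier R" "set fs \<subseteq> P" using snoc.prems(2) P.a_subset by auto
  have "\<exists>Q. primeideal Q R \<and> Idl (set fs) \<subseteq> Q \<and> Q \<subset> P"
  proof (rule exists_smaller_prime[OF snoc.prems(1) genideal_ideal[OF fs(1)] genideal_minimal[OF P.is_ideal fs(2)]])
    show "f \<in> P" using snoc.prems by simp
    show "\<And>a. a \<in> carrier R \<Longrightarrow> f \<otimes> a \<in> Idl (set fs) \<Longrightarrow> a \<in> Idl (set fs)"
      using snoc.prems(3)[of "length fs"] by simp
  qed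
  then obtain Q where Q: "primeideal Q R" "Idl (set fs) \<subseteq> Q" "Q \<subset> P" by blast
  have "set fs \<subseteq> Q" using genideal_self[OF fs(1)] Q(2) by blast
  moreover have "a \<in> Idl (set (take i fs))"
    if "i < length fs" "a \<in> carrier R" "fs ! i \<otimes> a \<in> Idl (set (take i fs))" for i a
    using snoc.prems(3)[of i a] that by (simp add: nth_append)
  ultimately obtain C where C: "\<forall>i\<le>length fs. primeideal (C i) R" "\<forall>i<length fs. C i \<subset> C (Suc i)"
    "C (length fs) = Q" using snoc.IH[OF Q(1)] by blast
  define D where "D i = (if i \<le> length fs then C i else P)" for i
  have "\<forall>i\<le>length (fs @ [f]). primeideal (D i) R" using C snoc.prems(1) by (simp add: D_def)
  moreover have "\<forall>i<length (fs @ [f]). D i \<subset> D (Suc i)"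
    using C Q(3) by (auto simp: D_def less_Suc_eq le_Suc_eq)
  moreover have "D (length (fs @ [f])) = P" by (simp add: D_def)
  ultimately show ?case by blast
qed

lemma (in cring) depth_le_krull_dim:
  assumes "primeideal P R"
  shows "depth R P \<le> krull_dim R"
  unfolding depth_def
proof (rule SUP_least, clarify)
  fix fs assume reg: "regular_sequence R fs" and "set fs \<subseteq> P"
  then have "\<exists>C. (\<forall>i\<le>length fs. primeideal (C i) R) \<and> (\<forall>i<length fs. C i \<subset> C (Suc i)) \<and> C (length fs) = P"
    using assms by (intro regular_sequence_prime_chain) (auto simp: regular_sequence_def)
  then show "enat (length fs) \<le> krull_dim R"
    unfolding krull_dim_def by (intro SUP_upper) blast
qed

section \<open>Localization\<close>

locale mult_closed_subset = cring R for R (structure) +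
  fixes S
  assumes S_subset: "S \<subseteq> carrier R" and one_S: "\<one> \<in> S"
    and mult_S: "\<And>s t. s \<in> S \<Longrightarrow> t \<in> S \<Longrightarrow> s \<otimes> t \<in> S"
begin

abbreviation "L \<equiv> localization R S"
abbreviation "quo \<equiv> fraction R S"

lemma S_carrier [simp, intro]: "s \<in> S \<Longrightarrow> s \<in> carrier R"
  using S_subset by blast

lemma frac_rel_iff:
  "((a, s), (b, t)) \<in> frac_rel R S \<longleftrightarrow> a \<in> carrier R \<and> s \<in> S \<and> b \<in> carrier R \<and> t \<in> S \<and>
     (\<exists>u\<in>S. u \<otimes> (a \<otimes> t) = u \<otimes> (b \<otimes> s))"
proof -
  have "u \<otimes> ((a \<otimes> t) \<ominus> (b \<otimes> s)) = \<zero> \<longleftrightarrow> u \<otimes> (a \<otimes> t) = u \<otimes> (b \<otimes> s)"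
    if "a \<in> carrier R" "b \<in> carrier R" "s \<in> S" "t \<in> S" "u \<in> S" for u
  proof -
    have "u \<otimes> ((a \<otimes> t) \<ominus> (b \<otimes> s)) = u \<otimes> (a \<otimes> t) \<ominus> u \<otimes> (b \<otimes> s)"
      using that by (simp add: a_minus_def r_distr r_minus)
    then show ?thesis using that by (simp add: r_right_minus_eq)
  qed
  then show ?thesis by (auto simp: frac_rel_def)
qed

lemma equiv_frac_rel: "equiv (carrier R \<times> S) (frac_rel R S)"
proof (rule equivI)
  show "frac_rel R S \<subseteq> (carrier R \<times> S) \<times> (carrier R \<times> S)" by (auto simp: frac_rel_def)
  show "refl_on (carrier R \<times> S) (frac_rel R S)"
    using one_S by (auto intro!: refl_onI simp: frac_rel_iff)
  show "sym (frac_rel R S)"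
    by (rule symI) (auto simp: frac_rel_iff, metis)
  show "trans (frac_rel R S)"
  proof (rule transI)
    fix x y z assume "(x, y) \<in> frac_rel R S" "(y, z) \<in> frac_rel R S"
    moreover obtain a s b t c r where xyz: "x = (a, s)" "y = (b, t)" "z = (c, r)" by (metis surj_pair)
    ultimately obtain u v where *: "a \<in> carrier R" "s \<in> S" "b \<in> carrier R" "t \<in> S" "c \<in> carrier R" "r \<in> S"
      "u \<in> S" "v \<in> S" "u \<otimes> (a \<otimes> t) = u \<otimes> (b \<otimes> s)" "v \<otimes> (b \<otimes> r) = v \<otimes> (c \<otimes> t)"
      by (auto simp: frac_rel_iff)
    \<comment> \<open>The middle denominator t joins the witness: elements of \<open>S\<close> may
      be zero divisors, so t cannot simply be cancelled.\<close>
    have "(u \<otimes> v \<otimes> t) \<otimes> (a \<otimes> r) = (v \<otimes> r) \<otimes> (u \<otimes> (a \<otimes> t))" using *(1-8) by (simp add: m_ac)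
    also have "\<dots> = (u \<otimes> s) \<otimes> (v \<otimes> (b \<otimes> r))" unfolding *(9) using *(1-8) by (simp add: m_ac)
    also have "\<dots> = (u \<otimes> v \<otimes> t) \<otimes> (c \<otimes> s)" unfolding *(10) using *(1-8) by (simp add: m_ac)
    finally have "(u \<otimes> v \<otimes> t) \<otimes> (a \<otimes> r) = (u \<otimes> v \<otimes> t) \<otimes> (c \<otimes> s)" .
    moreover have "u \<otimes> v \<otimes> t \<in> S" using * mult_S by blast
    ultimately show "(x, z) \<in> frac_rel R S" using *(1-8) unfolding xyz frac_rel_iff by blast
  qed
qed

lemma frac_eq_iff:
  assumes "a \<in> carrier R" "s \<in> S" "b \<in> carrier R" "t \<in> S"
  shows "quo a s = quo b t \<longleftrightarrow> (\<exists>u\<in>S. u \<otimes> (a \<otimes> t) = u \<otimes> (b \<otimes> s))"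
  unfolding fraction_def using assms
  by (subst eq_equiv_class_iff[OF equiv_frac_rel]) (auto simp: frac_rel_iff)

lemma frac_eqI:
  assumes "a \<in> carrier R" "s \<in> S" "b \<in> carrier R" "t \<in> S" "a \<otimes> t = b \<otimes> s"
  shows "quo a s = quo b t"
  using assms one_S by (subst frac_eq_iff) auto

lemma mem_frac_iff:
  assumes "a \<in> carrier R" "s \<in> S"
  shows "(b, t) \<in> quo a s \<longleftrightarrow> b \<in> carrier R \<and> t \<in> S \<and> quo b t = quo a s"
  using assms equiv_class_eq_iff[OF equiv_frac_rel, of "(a, s)" "(b, t)"]
  by (auto simp: fraction_def frac_rel_iff)

lemma carrier_L: "carrier L = {quo a s | a s. a \<in> carrier R \<and> s \<in> S}"
  by (auto simp: localization_def fraction_def quotient_def)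

lemma frac_closed [simp, intro]: "a \<in> carrier R \<Longrightarrow> s \<in> S \<Longrightarrow> quo a s \<in> carrier L"
  by (auto simp: carrier_L)

lemma L_cases [consumes 1, case_names quo]:
  assumes "x \<in> carrier L"
  obtains a s where "a \<in> carrier R" "s \<in> S" "x = quo a s"
  using assms by (auto simp: carrier_L)

text \<open>Well-definedness in one place: the operations of \<open>localization\<close> are unions
  over all representatives, and a union of equal sets over nonempty classes is that set. What
  remains to check is that \<open>F\<close> respects the relation.\<close>

lemma UN_frac_const:
  assumes "a \<in> carrier R" "s \<in> S" "b \<in> carrier R" "t \<in> S"
    and "\<And>a' s' b' t'. a' \<in> carrier R \<Longrightarrow> s' \<in> S \<Longrightarrow> b' \<in> carrier R \<Longrightarrow> t' \<in> S \<Longrightarrow>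
      quo a' s' = quo a s \<Longrightarrow> quo b' t' = quo b t \<Longrightarrow> F a' s' b' t' = F a s b t"
  shows "(\<Union>(a', s')\<in>quo a s. \<Union>(b', t')\<in>quo b t. F a' s' b' t') = F a s b t"
proof -
  have mem: "a' \<in> carrier R" "s' \<in> S" "quo a' s' = quo c r"
    if "(a', s') \<in> quo c r" "c \<in> carrier R" "r \<in> S" for a' s' c r
    using that mem_frac_iff[of c r a' s'] by auto
  have ne: "quo c r \<noteq> {}" if "c \<in> carrier R" "r \<in> S" for c r
    using mem_frac_iff[OF that, of c r] that by auto
  have inner: "(\<Union>(b', t')\<in>quo b t. F a' s' b' t') = F a s b t" if as: "(a', s') \<in> quo a s" for a' s'
  proof (rule SUP_eq_const[OF ne[OF assms(3,4)]], clarify)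
    fix b' t' assume "(b', t') \<in> quo b t"
    then show "F a' s' b' t' = F a s b t"
      using assms(5) mem[OF as assms(1,2)] mem[OF _ assms(3,4)] by simp
  qed
  show ?thesis
    by (rule SUP_eq_const[OF ne[OF assms(1,2)]]) (use inner in auto)
qed

lemma frac_mult:
  assumes "a \<in> carrier R" "s \<in> S" "b \<in> carrier R" "t \<in> S"
  shows "quo a s \<otimes>\<^bsub>L\<^esub> quo b t = quo (a \<otimes> b) (s \<otimes> t)"
proof -
  have "quo a s \<otimes>\<^bsub>L\<^esub> quo b t =
    (\<Union>(a', s')\<in>quo a s. \<Union>(b', t')\<in>quo b t. quo (a' \<otimes> b') (s' \<otimes> t'))"
    by (simp add: localization_def)
  also have "\<dots> = quo (a \<otimes> b) (s \<otimes> t)"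
  proof (rule UN_frac_const[OF assms])
    fix a' s' b' t' assume c: "a' \<in> carrier R" "s' \<in> S" "b' \<in> carrier R" "t' \<in> S"
      and eq: "quo a' s' = quo a s" "quo b' t' = quo b t"
    obtain u v where *: "u \<in> S" "u \<otimes> (a' \<otimes> s) = u \<otimes> (a \<otimes> s')" "v \<in> S" "v \<otimes> (b' \<otimes> t) = v \<otimes> (b \<otimes> t')"
      using eq frac_eq_iff c assms by auto
    have "(u \<otimes> v) \<otimes> ((a' \<otimes> b') \<otimes> (s \<otimes> t)) = (u \<otimes> (a' \<otimes> s)) \<otimes> (v \<otimes> (b' \<otimes> t))"
      using c assms *(1,3) by (simp add: m_ac)
    also have "\<dots> = (u \<otimes> v) \<otimes> ((a \<otimes> b) \<otimes> (s' \<otimes> t'))"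
      unfolding *(2,4) using c assms *(1,3) by (simp add: m_ac)
    finally show "quo (a' \<otimes> b') (s' \<otimes> t') = quo (a \<otimes> b) (s \<otimes> t)"
      using c assms * mult_S by (subst frac_eq_iff) auto
  qed
  finally show ?thesis .
qed

lemma frac_add:
  assumes "a \<in> carrier R" "s \<in> S" "b \<in> carrier R" "t \<in> S"
  shows "quo a s \<oplus>\<^bsub>L\<^esub> quo b t = quo ((a \<otimes> t) \<oplus> (b \<otimes> s)) (s \<otimes> t)"
proof -
  have "quo a s \<oplus>\<^bsub>L\<^esub> quo b t =
    (\<Union>(a', s')\<in>quo a s. \<Union>(b', t')\<in>quo b t. quo ((a' \<otimes> t') \<oplus> (b' \<otimes> s')) (s' \<otimes> t'))"
    by (simp add: localization_def)
  also have "\<dots> = quo ((a \<otimes> t) \<oplus> (b \<otimes> s)) (s \<otimes> t)"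
  proof (rule UN_frac_const[OF assms])
    fix a' s' b' t' assume c: "a' \<in> carrier R" "s' \<in> S" "b' \<in> carrier R" "t' \<in> S"
      and eq: "quo a' s' = quo a s" "quo b' t' = quo b t"
    obtain u v where *: "u \<in> S" "u \<otimes> (a' \<otimes> s) = u \<otimes> (a \<otimes> s')" "v \<in> S" "v \<otimes> (b' \<otimes> t) = v \<otimes> (b \<otimes> t')"
      using eq frac_eq_iff c assms by auto
    have "(u \<otimes> v) \<otimes> (((a' \<otimes> t') \<oplus> (b' \<otimes> s')) \<otimes> (s \<otimes> t)) =
        (v \<otimes> t' \<otimes> t) \<otimes> (u \<otimes> (a' \<otimes> s)) \<oplus> (u \<otimes> s' \<otimes> s) \<otimes> (v \<otimes> (b' \<otimes> t))"
      using c assms *(1,3) by (simp add: m_ac l_distr r_distr)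
    also have "\<dots> = (u \<otimes> v) \<otimes> (((a \<otimes> t) \<oplus> (b \<otimes> s)) \<otimes> (s' \<otimes> t'))"
      unfolding *(2,4) using c assms *(1,3) by (simp add: m_ac l_distr r_distr)
    finally show "quo ((a' \<otimes> t') \<oplus> (b' \<otimes> s')) (s' \<otimes> t') = quo ((a \<otimes> t) \<oplus> (b \<otimes> s)) (s \<otimes> t)"
      using c assms * mult_S by (subst frac_eq_iff) auto
  qed
  finally show ?thesis .
qed

lemma L_one: "\<one>\<^bsub>L\<^esub> = quo \<one> \<one>" and L_zero: "\<zero>\<^bsub>L\<^esub> = quo \<zero> \<one>"
  by (simp_all add: localization_def)

lemma cring_L: "cring L"
proof (rule cringI)
  show "abelian_group L"
  proof (rule abelian_groupI)
    fix x y assume x: "x \<in> carrier L" and y: "y \<in> carrier L"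
    show "x \<oplus>\<^bsub>L\<^esub> y \<in> carrier L"
      using x y by (elim L_cases) (auto simp: frac_add mult_S)
    show "x \<oplus>\<^bsub>L\<^esub> y = y \<oplus>\<^bsub>L\<^esub> x"
      using x y by (elim L_cases) (auto simp: frac_add mult_S m_ac a_ac)
    fix z assume z: "z \<in> carrier L"
    show "x \<oplus>\<^bsub>L\<^esub> y \<oplus>\<^bsub>L\<^esub> z = x \<oplus>\<^bsub>L\<^esub> (y \<oplus>\<^bsub>L\<^esub> z)"
      using x y z
      by (elim L_cases) (auto simp: frac_add mult_S l_distr r_distr m_ac a_ac)
  next
    show "\<zero>\<^bsub>L\<^esub> \<in> carrier L" using one_S by (simp add: L_zero)
    fix x assume "x \<in> carrier L"
    then show "\<zero>\<^bsub>L\<^esub> \<oplus>\<^bsub>L\<^esub> x = x" by (elim L_cases) (auto simp: L_zero frac_add one_S)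
    show "\<exists>y\<in>carrier L. y \<oplus>\<^bsub>L\<^esub> x = \<zero>\<^bsub>L\<^esub>"
      using \<open>x \<in> carrier L\<close>
    proof (cases rule: L_cases)
      case (quo a s)
      have "quo (\<ominus> a) s \<oplus>\<^bsub>L\<^esub> x = quo (\<ominus> a \<otimes> s \<oplus> a \<otimes> s) (s \<otimes> s)"
        using quo by (simp add: frac_add)
      also have "\<ominus> a \<otimes> s \<oplus> a \<otimes> s = \<zero>" using quo by (simp add: l_minus l_neg)
      also have "quo \<zero> (s \<otimes> s) = quo \<zero> \<one>" using quo one_S mult_S by (intro frac_eqI) auto
      finally show ?thesis using quo by (auto simp: L_zero intro!: bexI[of _ "quo (\<ominus> a) s"])
    qed
  qed
  show "comm_monoid L"
  proof (rule comm_monoidI)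
    show "\<one>\<^bsub>L\<^esub> \<in> carrier L" using one_S by (simp add: L_one)
    fix x y assume x: "x \<in> carrier L" and y: "y \<in> carrier L"
    show "x \<otimes>\<^bsub>L\<^esub> y \<in> carrier L"
      using x y by (elim L_cases) (auto simp: frac_mult mult_S)
    show "x \<otimes>\<^bsub>L\<^esub> y = y \<otimes>\<^bsub>L\<^esub> x"
      using x y by (elim L_cases) (auto simp: frac_mult m_comm)
    show "\<one>\<^bsub>L\<^esub> \<otimes>\<^bsub>L\<^esub> x = x"
      using x by (elim L_cases) (auto simp: L_one frac_mult one_S)
    fix z assume z: "z \<in> carrier L"
    show "x \<otimes>\<^bsub>L\<^esub> y \<otimes>\<^bsub>L\<^esub> z = x \<otimes>\<^bsub>L\<^esub> (y \<otimes>\<^bsub>L\<^esub> z)"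
      using x y z by (elim L_cases) (auto simp: frac_mult mult_S m_assoc)
  qed
  fix x y z assume "x \<in> carrier L" "y \<in> carrier L" "z \<in> carrier L"
  then show "(x \<oplus>\<^bsub>L\<^esub> y) \<otimes>\<^bsub>L\<^esub> z = x \<otimes>\<^bsub>L\<^esub> z \<oplus>\<^bsub>L\<^esub> y \<otimes>\<^bsub>L\<^esub> z"
  proof (elim L_cases)
    fix a s b t c r assume *: "a \<in> carrier R" "s \<in> S" "b \<in> carrier R" "t \<in> S" "c \<in> carrier R" "r \<in> S"
      "x = quo a s" "y = quo b t" "z = quo c r"
    have "quo ((a \<otimes> t \<oplus> b \<otimes> s) \<otimes> c) ((s \<otimes> t) \<otimes> r) =
      quo ((a \<otimes> c) \<otimes> (t \<otimes> r) \<oplus> (b \<otimes> c) \<otimes> (s \<otimes> r)) ((s \<otimes> r) \<otimes> (t \<otimes> r))"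
      using * by (intro frac_eqI) (auto intro!: mult_S simp: l_distr r_distr m_ac)
    then show ?thesis using * by (simp add: frac_add frac_mult mult_S)
  qed
qed

sublocale L: cring L by (rule cring_L)

text \<open>The fraction s / 1 is a unit, so denominators do not affect membership in an
  ideal.\<close>

lemma frac_mem_ideal_iff:
  assumes J: "ideal J L" and a: "a \<in> carrier R" and s: "s \<in> S"
  shows "quo a s \<in> J \<longleftrightarrow> quo a \<one> \<in> J"
proof
  assume "quo a s \<in> J"
  then have "quo s \<one> \<otimes>\<^bsub>L\<^esub> quo a s \<in> J"
    using s one_S by (intro L.ideal_closedD(4)[OF J]) auto
  moreover have "quo s \<one> \<otimes>\<^bsub>L\<^esub> quo a s = quo (s \<otimes> a) (\<one> \<otimes> s)"
    using a s one_S by (simp add: frac_mult)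
  moreover have "\<dots> = quo a \<one>"
    using a s one_S by (intro frac_eqI) (simp_all add: m_comm)
  ultimately show "quo a \<one> \<in> J" by simp
next
  assume "quo a \<one> \<in> J"
  then have "quo \<one> s \<otimes>\<^bsub>L\<^esub> quo a \<one> \<in> J"
    using s one_S by (intro L.ideal_closedD(4)[OF J]) auto
  then show "quo a s \<in> J" using a s one_S by (simp add: frac_mult)
qed

definition contraction where "contraction J = {a \<in> carrier R. quo a \<one> \<in> J}"

definition extension where "extension I = {quo a s | a s. a \<in> I \<and> s \<in> S}"

lemma extensionI: "a \<in> I \<Longrightarrow> s \<in> S \<Longrightarrow> quo a s \<in> extension I"
  by (auto simp: extension_def)

lemma frac_mem_contraction:
  "ideal J L \<Longrightarrow> a \<in> carrier R \<Longrightarrow> s \<in> S \<Longrightarrow> quo a s \<in> J \<longleftrightarrow> a \<in> contraction J"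
  using frac_mem_ideal_iff by (simp add: contraction_def)

lemma ideal_contraction:
  assumes J: "ideal J L"
  shows "ideal (contraction J) R"
proof (rule ideal_of_closed)
  show "contraction J \<subseteq> carrier R" by (auto simp: contraction_def)
  show "\<zero> \<in> contraction J" using L.ideal_closedD(2)[OF J] by (simp add: contraction_def L_zero)
  fix a b assume a: "a \<in> contraction J"
  show "a \<oplus> b \<in> contraction J" if "b \<in> contraction J"
    using L.ideal_closedD(3)[OF J, of "quo a \<one>" "quo b \<one>"] a that one_S
    by (simp add: contraction_def frac_add)
  show "b \<otimes> a \<in> contraction J" if "b \<in> carrier R"
    using L.ideal_closedD(4)[OF J, of "quo a \<one>" "quo b \<one>"] a that one_S
    by (simp add: contraction_def frac_mult)
qed

text \<open>Since denominators do not matter, an ideal of the localization is recovered from its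
  contraction. Strict inclusions in a chain of primes therefore survive contraction.\<close>

lemma contraction_subset_iff:
  assumes J: "ideal J L" and J': "ideal J' L"
  shows "contraction J \<subseteq> contraction J' \<longleftrightarrow> J \<subseteq> J'"
proof
  assume *: "contraction J \<subseteq> contraction J'"
  show "J \<subseteq> J'"
  proof
    fix x assume x: "x \<in> J"
    then have "x \<in> carrier L" using L.ideal_closedD(1)[OF J] by blast
    then show "x \<in> J'"
    proof (cases rule: L_cases)
      case (quo a s)
      then show ?thesis using x * frac_mem_contraction[OF J quo(1,2)] frac_mem_contraction[OF J' quo(1,2)] by blast
    qed
  qed
qed (auto simp: contraction_def)

lemma ideal_extension:
  assumes I: "ideal I R"
  shows "ideal (extension I) L"
proof (rule L.ideal_of_closed)
  note I' = ideal_closedD[OF I]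
  have Ic: "a \<in> carrier R" if "a \<in> I" for a using I'(1) that by blast
  show "extension I \<subseteq> carrier L" using Ic by (auto simp: extension_def)
  show "\<zero>\<^bsub>L\<^esub> \<in> extension I" using I'(2) one_S by (auto simp: extension_def L_zero)
  fix x y assume "x \<in> extension I"
  then obtain a s where x: "a \<in> I" "s \<in> S" "x = quo a s" by (auto simp: extension_def)
  show "x \<oplus>\<^bsub>L\<^esub> y \<in> extension I" if "y \<in> extension I"
  proof -
    obtain b t where y: "b \<in> I" "t \<in> S" "y = quo b t" using \<open>y \<in> extension I\<close> by (auto simp: extension_def)
    have "x \<oplus>\<^bsub>L\<^esub> y = quo (a \<otimes> t \<oplus> b \<otimes> s) (s \<otimes> t)" using x y Ic by (simp add: frac_add)
    moreover have "a \<otimes> t \<oplus> b \<otimes> s \<in> I" using x y by (intro I'(3) I'(5)) auto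
    ultimately show ?thesis using x y mult_S by (simp add: extensionI)
  qed
  show "y \<otimes>\<^bsub>L\<^esub> x \<in> extension I" if "y \<in> carrier L"
    using that
  proof (cases rule: L_cases)
    case (quo b t)
    then have "y \<otimes>\<^bsub>L\<^esub> x = quo (b \<otimes> a) (t \<otimes> s)" using x Ic by (simp add: frac_mult)
    moreover have "b \<otimes> a \<in> I" using x quo by (intro I'(4)) auto
    ultimately show ?thesis using x quo mult_S by (simp add: extensionI)
  qed
qed

text \<open>The contraction of an extended ideal is its saturation with respect to
  \<open>S\<close>.\<close>

lemma frac_mem_extension_iff:
  assumes I: "ideal I R" and a: "a \<in> carrier R" and s: "s \<in> S"
  shows "quo a s \<in> extension I \<longleftrightarrow> (\<exists>u\<in>S. u \<otimes> a \<in> I)"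
proof
  note I' = ideal_closedD[OF I]
  assume "quo a s \<in> extension I"
  then obtain b t where b: "b \<in> I" "t \<in> S" "quo a s = quo b t" by (auto simp: extension_def)
  have bc: "b \<in> carrier R" using b I' by blast
  then obtain u where u: "u \<in> S" "u \<otimes> (a \<otimes> t) = u \<otimes> (b \<otimes> s)" using b a s frac_eq_iff by auto
  have "(u \<otimes> t) \<otimes> a = (u \<otimes> s) \<otimes> b" using u a s b bc by (simp add: m_ac)
  also have "\<dots> \<in> I" using u s b by (intro I'(4)) auto
  finally show "\<exists>u\<in>S. u \<otimes> a \<in> I" using u b mult_S by blast
next
  assume "\<exists>u\<in>S. u \<otimes> a \<in> I"
  then obtain u where u: "u \<in> S" "u \<otimes> a \<in> I" by blast
  have "quo a s = quo (u \<otimes> a) (u \<otimes> s)" using u a s mult_S by (intro frac_eqI) (auto simp: m_ac)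
  then show "quo a s \<in> extension I" using u s mult_S by (simp add: extensionI)
qed

lemma Idl_frac:
  assumes A: "A \<subseteq> carrier R"
  shows "Idl\<^bsub>L\<^esub> ((\<lambda>a. quo a \<one>) ` A) = extension (Idl A)"
proof
  have AL: "(\<lambda>a. quo a \<one>) ` A \<subseteq> carrier L" using A one_S by auto
  show "Idl\<^bsub>L\<^esub> ((\<lambda>a. quo a \<one>) ` A) \<subseteq> extension (Idl A)"
    using genideal_self[OF A] one_S
    by (intro L.genideal_minimal ideal_extension genideal_ideal A) (auto intro: extensionI)
  have J: "ideal (Idl\<^bsub>L\<^esub> ((\<lambda>a. quo a \<one>) ` A)) L" by (rule L.genideal_ideal[OF AL])
  have "Idl A \<subseteq> contraction (Idl\<^bsub>L\<^esub> ((\<lambda>a. quo a \<one>) ` A))"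
    using A L.genideal_self[OF AL] by (intro genideal_minimal ideal_contraction J) (auto simp: contraction_def)
  then have "quo a s \<in> Idl\<^bsub>L\<^esub> ((\<lambda>a. quo a \<one>) ` A)" if "a \<in> Idl A" "s \<in> S" for a s
    using frac_mem_contraction[OF J _ that(2)] ideal_closedD(1)[OF genideal_ideal[OF A]] that(1) by blast
  then show "extension (Idl A) \<subseteq> Idl\<^bsub>L\<^esub> ((\<lambda>a. quo a \<one>) ` A)"
    unfolding extension_def by blast
qed

text \<open>Every ideal of the localization is the extension of its contraction, so generators of
  the contraction suffice.\<close>

lemma noetherian_L:
  assumes "noetherian_ring R"
  shows "noetherian_ring L"
proof (rule L.noetherian_ringI)
  fix J assume J: "ideal J L"
  obtain A where A: "A \<subseteq> carrier R" "finite A" "contraction J = Idl A"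
    using noetherian_ring.finetely_gen[OF assms ideal_contraction[OF J]] by blast
  have "x \<in> J \<longleftrightarrow> x \<in> extension (Idl A)" for x
  proof
    assume x: "x \<in> J"
    then have "x \<in> carrier L" using L.ideal_closedD(1)[OF J] by blast
    then show "x \<in> extension (Idl A)"
    proof (cases rule: L_cases)
      case (quo a s)
      then have "a \<in> Idl A" using x A(3) frac_mem_contraction[OF J quo(1,2)] by simp
      then show ?thesis using quo extensionI by simp
    qed
  next
    assume "x \<in> extension (Idl A)"
    then obtain a s where as: "a \<in> contraction J" "s \<in> S" "x = quo a s"
      using A(3) by (auto simp: extension_def)
    then have "a \<in> carrier R" by (simp add: contraction_def)
    then show "x \<in> J" using as frac_mem_contraction[OF J] by simp
  qed
  then have "J = Idl\<^bsub>L\<^esub> ((\<lambda>a. quo a \<one>) ` A)" using Idl_frac[OF A(1)] by auto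
  moreover have "(\<lambda>a. quo a \<one>) ` A \<subseteq> carrier L" "finite ((\<lambda>a. quo a \<one>) ` A)" using A one_S by auto
  ultimately show "\<exists>A\<subseteq>carrier L. finite A \<and> J = Idl\<^bsub>L\<^esub> A" by blast
qed

lemma primeideal_contraction:
  assumes "primeideal P L"
  shows "primeideal (contraction P) R"
proof (rule primeidealI)
  interpret P: primeideal P L by (rule assms)
  show "ideal (contraction P) R" by (rule ideal_contraction[OF P.is_ideal])
  show "cring R" by (rule is_cring)
  have "\<one> \<notin> contraction P"
    using P.I_notcarr P.one_imp_carrier by (auto simp: contraction_def L_one)
  then show "carrier R \<noteq> contraction P" by auto
  fix a b assume "a \<in> carrier R" "b \<in> carrier R" "a \<otimes> b \<in> contraction P"
  then show "a \<in> contraction P \<or> b \<in> contraction P"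
    using P.I_prime[of "quo a \<one>" "quo b \<one>"] one_S by (auto simp: contraction_def frac_mult)
qed

lemma krull_dim_L: "krull_dim L \<le> krull_dim R"
  unfolding krull_dim_def
proof (rule SUP_subset_mono)
  show "{n. \<exists>P. (\<forall>i\<le>n. primeideal (P i) L) \<and> (\<forall>i<n. P i \<subset> P (Suc i))} \<subseteq>
    {n. \<exists>P. (\<forall>i\<le>n. primeideal (P i) R) \<and> (\<forall>i<n. P i \<subset> P (Suc i))}"
  proof clarify
    fix n P assume P: "\<forall>i\<le>n. primeideal (P i) L" "\<forall>i<n. P i \<subset> P (Suc i)"
    have "contraction (P i) \<subset> contraction (P (Suc i))" if i: "i < n" for i
    proof -
      have "ideal (P i) L" "ideal (P (Suc i)) L" using P(1) i by (simp_all add: primeideal.axioms(1))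
      then show ?thesis using contraction_subset_iff P(2) i by (simp add: less_le_not_le)
    qed
    then show "\<exists>P. (\<forall>i\<le>n. primeideal (P i) R) \<and> (\<forall>i<n. P i \<subset> P (Suc i))"
      using P(1) primeideal_contraction by (intro exI[of _ "\<lambda>i. contraction (P i)"]) auto
  qed
qed simp

text \<open>A relation in the localization holds in \<open>R\<close> after multiplication by some u
  in \<open>S\<close>; regularity then puts u a, and with it the fraction a / s, into the ideal.
  Properness has to be assumed, since localization may turn a proper ideal into the whole
  ring.\<close>

lemma regular_sequence_L:
  assumes reg: "regular_sequence R fs" and proper: "extension (Idl (set fs)) \<noteq> carrier L"
  shows "regular_sequence L (map (\<lambda>a. quo a \<one>) fs)"
  unfolding regular_sequence_def
proof (intro conjI allI impI ballI)
  have fs: "set fs \<subseteq> carrier R" using reg by (simp add: regular_sequence_def)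
  show "set (map (\<lambda>a. quo a \<one>) fs) \<subseteq> carrier L" using fs one_S by auto
  show "Idl\<^bsub>L\<^esub> (set (map (\<lambda>a. quo a \<one>) fs)) \<noteq> carrier L"
    using proper Idl_frac[OF fs] by simp
  fix i x assume i: "i < length (map (\<lambda>a. quo a \<one>) fs)" and x: "x \<in> carrier L"
    and mem: "map (\<lambda>a. quo a \<one>) fs ! i \<otimes>\<^bsub>L\<^esub> x \<in> Idl\<^bsub>L\<^esub> (set (take i (map (\<lambda>a. quo a \<one>) fs)))"
  let ?I = "Idl (set (take i fs))"
  have take: "set (take i fs) \<subseteq> carrier R" using fs set_take_subset by fast
  have I: "ideal ?I R" by (rule genideal_ideal[OF take])
  have Idl: "Idl\<^bsub>L\<^esub> (set (take i (map (\<lambda>a. quo a \<one>) fs))) = extension ?I"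
    using Idl_frac[OF take] by (simp add: take_map)
  have fi: "fs ! i \<in> carrier R" using fs i by auto
  from x show "x \<in> Idl\<^bsub>L\<^esub> (set (take i (map (\<lambda>a. quo a \<one>) fs)))"
    unfolding Idl
  proof (cases rule: L_cases)
    case (quo a s)
    have "quo (fs ! i \<otimes> a) s \<in> extension ?I"
      using mem i quo fi one_S unfolding Idl by (simp add: frac_mult)
    then obtain u where u: "u \<in> S" "u \<otimes> (fs ! i \<otimes> a) \<in> ?I"
      using frac_mem_extension_iff[OF I] fi quo by auto
    have "fs ! i \<otimes> (u \<otimes> a) = u \<otimes> (fs ! i \<otimes> a)" using u fi quo by (simp add: m_ac)
    then have "u \<otimes> a \<in> ?I" using reg u i quo by (simp add: regular_sequence_def)
    then show "x \<in> extension ?I" using frac_mem_extension_iff[OF I] u quo by blast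
  qed
qed

end

text \<open>
  The dimension can only drop under localization and bounds the depth, so a regular sequence of
  length \<open>krull_dim R\<close> in every maximal ideal makes all these numbers equal.
\<close>
theorem (in cring) cohen_macaulayI:
  assumes noeth: "noetherian_ring R" and dim: "krull_dim R \<le> enat N"
    and reg: "\<And>M. maximalideal M R \<Longrightarrow> \<exists>fs. regular_sequence R fs \<and> set fs \<subseteq> M \<and> length fs = N"
  shows "cohen_macaulay R"
  unfolding cohen_macaulay_def
proof (intro conjI allI impI is_cring noeth)
  fix M assume M: "maximalideal M R"
  interpret M: maximalideal M R by (rule M)
  have "primeideal M R" by (rule maximalideal_prime[OF M])
  then interpret MP: primeideal M R .
  have oneM: "\<one> \<notin> M" using M.I_notcarr M.one_imp_carrier by blast
  interpret mult_closed_subset R "carrier R - M"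
    using oneM MP.I_prime by unfold_locales auto
  let ?E = "extension M"
  have E: "ideal ?E L" by (rule ideal_extension[OF M.is_ideal])
  have memE: "quo a s \<in> ?E \<longleftrightarrow> a \<in> M" if "a \<in> carrier R" "s \<in> carrier R - M" for a s
  proof -
    have "quo a s \<in> ?E \<longleftrightarrow> (\<exists>u\<in>carrier R - M. u \<otimes> a \<in> M)"
      using that by (rule frac_mem_extension_iff[OF M.is_ideal])
    also have "\<dots> \<longleftrightarrow> a \<in> M" using that MP.I_prime oneM M.I_l_closed by blast
    finally show ?thesis .
  qed
  have properE: "?E \<noteq> carrier L"
    using memE[of \<one> \<one>] oneM one_S L.one_closed by (auto simp: L_one)
  \<comment> \<open>A fraction a / s with a outside \<open>M\<close> has the inverse s / a, so
    \<open>?E\<close> contains every proper ideal and is the only maximal one.\<close>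
  have sub: "J \<subseteq> ?E" if J: "ideal J L" and proper: "J \<noteq> carrier L" for J
  proof
    fix x assume x: "x \<in> J"
    then have "x \<in> carrier L" using L.ideal_closedD(1)[OF J] by blast
    then show "x \<in> ?E"
    proof (cases rule: L_cases)
      case (quo a s)
      have "a \<in> M"
      proof (rule ccontr)
        assume a: "a \<notin> M"
        have "quo s a \<otimes>\<^bsub>L\<^esub> x \<in> J" using quo a x by (intro L.ideal_closedD(4)[OF J]) auto
        moreover have "quo s a \<otimes>\<^bsub>L\<^esub> x = quo (s \<otimes> a) (a \<otimes> s)" using quo a by (simp add: frac_mult)
        moreover have "\<dots> = quo \<one> \<one>"
          using quo a one_S mult_S[of a s] by (intro frac_eqI) (simp_all add: m_comm)
        ultimately show False using proper ideal.one_imp_carrier[OF J] by (simp add: L_one)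
      qed
      then show ?thesis using memE quo by simp
    qed
  qed
  have maxE: "maximalideal ?E L"
    using sub properE by (intro maximalidealI E) auto
  have "{M'. maximalideal M' L} = {?E}"
  proof (intro equalityI subsetI)
    fix M' assume "M' \<in> {M'. maximalideal M' L}"
    then interpret M': maximalideal M' L by simp
    have "M' \<subseteq> ?E" using M'.I_notcarr by (intro sub M'.is_ideal) auto
    then show "M' \<in> {?E}" using M'.I_maximal[OF E] properE L.ideal_closedD(1)[OF E] by blast
  qed (use maxE in simp)
  moreover have "depth L ?E = krull_dim L"
  proof (rule antisym)
    show "depth L ?E \<le> krull_dim L"
      by (rule L.depth_le_krull_dim[OF L.maximalideal_prime[OF maxE]])
    obtain fs where fs: "regular_sequence R fs" "set fs \<subseteq> M" "length fs = N" using reg M by blast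
    have fsc: "set fs \<subseteq> carrier R" using fs(1) by (simp add: regular_sequence_def)
    have "extension (Idl (set fs)) \<subseteq> ?E"
      using genideal_minimal[OF M.is_ideal fs(2)] unfolding extension_def by blast
    then have "regular_sequence L (map (\<lambda>a. quo a \<one>) fs)"
      using properE L.ideal_closedD(1)[OF E] by (intro regular_sequence_L fs(1)) blast
    moreover have "set (map (\<lambda>a. quo a \<one>) fs) \<subseteq> ?E"
      using fs(2) one_S by (auto intro: extensionI)
    ultimately have "enat (length (map (\<lambda>a. quo a \<one>) fs)) \<le> depth L ?E"
      unfolding depth_def by (intro SUP_upper) blast
    then have "enat N \<le> depth L ?E" using fs(3) by simp
    then show "krull_dim L \<le> depth L ?E" using krull_dim_L dim by (meson order_trans)
  qed
  ultimately show "cohen_macaulay_local L"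
    unfolding cohen_macaulay_local_def using cring_L noetherian_L[OF noeth] by blast
qed

section \<open>Polynomials as finitely supported maps\<close>

abbreviation coeff_poly :: "'k::comm_ring_1 \<Rightarrow> ('v, 'k) mpoly" where
  "coeff_poly c \<equiv> Poly_Mapping.single 0 c"

abbreviation mon :: "('v \<Rightarrow>\<^sub>0 nat) \<Rightarrow> ('v, 'k::comm_ring_1) mpoly" where
  "mon m \<equiv> Poly_Mapping.single m 1"

lemma poly_eq_sum_singles:
  "p = (\<Sum>m\<in>Poly_Mapping.keys p. Poly_Mapping.single m (Poly_Mapping.lookup p m))"
proof (rule poly_mapping_eqI)
  fix k
  have "(\<Sum>m\<in>Poly_Mapping.keys p. Poly_Mapping.lookup (Poly_Mapping.single m (Poly_Mapping.lookup p m)) k) =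
     (\<Sum>m\<in>Poly_Mapping.keys p. if m = k then Poly_Mapping.lookup p m else 0)"
    by (intro sum.cong) (auto simp: lookup_single when_def)
  then show "Poly_Mapping.lookup p k =
      Poly_Mapping.lookup (\<Sum>m\<in>Poly_Mapping.keys p. Poly_Mapping.single m (Poly_Mapping.lookup p m)) k"
    by (simp add: lookup_sum in_keys_iff)
qed

lemma poly_induct [case_names zero single add]:
  fixes p :: "'a \<Rightarrow>\<^sub>0 'b::comm_monoid_add"
  assumes "P 0" "\<And>m c. P (Poly_Mapping.single m c)" "\<And>p q. P p \<Longrightarrow> P q \<Longrightarrow> P (p + q)"
  shows "P p"
proof -
  have "P (\<Sum>m\<in>A. Poly_Mapping.single m (Poly_Mapping.lookup p m))" if "finite A" for A
    using that assms by (induction A rule: finite_induct) auto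
  then have "P (\<Sum>m\<in>Poly_Mapping.keys p. Poly_Mapping.single m (Poly_Mapping.lookup p m))" by simp
  then show ?thesis by (simp flip: poly_eq_sum_singles)
qed

text \<open>The linear extension of a map given on monomials. Substitution, the projection that
  deletes the monomials of an ideal, and division by a monic polynomial are all of this
  form.\<close>

definition lin :: "(('v \<Rightarrow>\<^sub>0 nat) \<Rightarrow> ('v, 'k::comm_ring_1) mpoly) \<Rightarrow> ('v, 'k) mpoly \<Rightarrow> ('v, 'k) mpoly" where
  "lin T p = (\<Sum>m\<in>Poly_Mapping.keys p. coeff_poly (Poly_Mapping.lookup p m) * T m)"

lemma lin_superset:
  assumes "finite A" "Poly_Mapping.keys p \<subseteq> A"
  shows "lin T p = (\<Sum>m\<in>A. coeff_poly (Poly_Mapping.lookup p m) * T m)"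
  unfolding lin_def using assms by (intro sum.mono_neutral_left) (auto simp: in_keys_iff)

lemma lin_0 [simp]: "lin T 0 = 0"
  by (simp add: lin_def)

lemma lin_single: "lin T (Poly_Mapping.single m c) = coeff_poly c * T m"
  by (subst lin_superset[of "{m}"]) (auto simp: lookup_single)

lemma lin_add: "lin T (p + q) = lin T p + lin T q"
proof -
  let ?A = "Poly_Mapping.keys p \<union> Poly_Mapping.keys q"
  have "lin T (p + q) = (\<Sum>m\<in>?A. coeff_poly (Poly_Mapping.lookup (p + q) m) * T m)"
    by (rule lin_superset) (auto simp: keys_add)
  also have "\<dots> = lin T p + lin T q"
    by (simp add: lin_superset[of ?A] lookup_add single_add distrib_right sum.distrib)
  finally show ?thesis .
qed

lemma additive_0:
  fixes f :: "'a::comm_monoid_add \<Rightarrow> 'b :: cancel_comm_monoid_add"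
  assumes "\<And>p q. f (p + q) = f p + f q"
  shows "f 0 = 0"
  using assms[of 0 0] by simp

lemma additive_sum:
  fixes f :: "'a::comm_monoid_add \<Rightarrow> 'b :: cancel_comm_monoid_add"
  assumes "\<And>p q. f (p + q) = f p + f q"
  shows "f (sum g I) = (\<Sum>i\<in>I. f (g i))"
  using additive_0[of f, OF assms] by (induction I rule: infinite_finite_induct) (auto simp: assms)

lemma additive_diff:
  fixes f :: "'a::ab_group_add \<Rightarrow> 'b :: ab_group_add"
  assumes "\<And>p q. f (p + q) = f p + f q"
  shows "f (p - q) = f p - f q"
  using assms[of "p - q" q] by (simp add: algebra_simps)

lemma lookup_single_mult:
  fixes p :: "('v, 'k::comm_ring_1) mpoly"
  shows "Poly_Mapping.lookup (Poly_Mapping.single a c * p) (a + b) = c * Poly_Mapping.lookup p b"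
proof (induction p rule: poly_induct)
  case (single m d)
  then show ?case by (simp add: mult_single lookup_single when_def)
qed (simp_all add: distrib_left lookup_add)

lemma keys_single_mult:
  "Poly_Mapping.keys (Poly_Mapping.single a c * p :: ('v, 'k::comm_ring_1) mpoly) \<subseteq> (+) a ` Poly_Mapping.keys p"
  using keys_mult[of "Poly_Mapping.single a c" p] by (auto split: if_splits)

lemma lookup_eq_0_outside: "Poly_Mapping.keys m \<subseteq> V \<Longrightarrow> v \<notin> V \<Longrightarrow> Poly_Mapping.lookup m v = 0"
  by (meson in_keys_iff subsetD)

subsection \<open>Substitution\<close>

definition mon_subst :: "('v \<Rightarrow> ('v, 'k::comm_ring_1) mpoly) \<Rightarrow> ('v \<Rightarrow>\<^sub>0 nat) \<Rightarrow> ('v, 'k) mpoly" where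
  "mon_subst f m = (\<Prod>v\<in>Poly_Mapping.keys m. f v ^ Poly_Mapping.lookup m v)"

lemma poly_subst_lin: "poly_subst f = lin (mon_subst f)"
  by (rule ext) (simp add: poly_subst_def lin_def mon_subst_def)

lemma mon_subst_superset:
  assumes "finite A" "Poly_Mapping.keys m \<subseteq> A"
  shows "mon_subst f m = (\<Prod>v\<in>A. f v ^ Poly_Mapping.lookup m v)"
  unfolding mon_subst_def using assms by (intro prod.mono_neutral_left) (auto simp: in_keys_iff)

lemma mon_subst_add: "mon_subst f (m + m') = mon_subst f m * mon_subst f m'"
proof -
  let ?A = "Poly_Mapping.keys m \<union> Poly_Mapping.keys m'"
  have "mon_subst f (m + m') = (\<Prod>v\<in>?A. f v ^ Poly_Mapping.lookup (m + m') v)"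
    by (rule mon_subst_superset) (auto simp: keys_add)
  also have "\<dots> = mon_subst f m * mon_subst f m'"
    by (simp add: mon_subst_superset[of ?A] lookup_add power_add prod.distrib)
  finally show ?thesis .
qed

lemma subst_single: "poly_subst f (Poly_Mapping.single m c) = coeff_poly c * mon_subst f m"
  by (simp add: poly_subst_lin lin_single)

lemma subst_add: "poly_subst f (p + q) = poly_subst f p + poly_subst f q"
  by (simp add: poly_subst_lin lin_add)

lemma subst_0 [simp]: "poly_subst f 0 = 0"
  by (simp add: poly_subst_lin)

lemma subst_coeff [simp]: "poly_subst f (coeff_poly c) = coeff_poly c"
  by (simp add: subst_single mon_subst_def)

lemma subst_1 [simp]: "poly_subst f 1 = 1"
  using subst_coeff[of f 1] by simp

lemma subst_Var [simp]: "poly_subst f (Var v) = f v"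
  by (simp add: Var_def subst_single mon_subst_def)

lemma subst_mult:
  fixes p q :: "('v, 'k::comm_ring_1) mpoly"
  shows "poly_subst f (p * q) = poly_subst f p * poly_subst f q"
proof (induction p rule: poly_induct)
  case (single m c)
  show ?case
  proof (induction q rule: poly_induct)
    case (single m' c')
    have c: "coeff_poly (c * c') = (coeff_poly c * coeff_poly c' :: ('v, 'k) mpoly)" by (simp add: mult_single)
    have "poly_subst f (Poly_Mapping.single m c * Poly_Mapping.single m' c') =
      coeff_poly (c * c') * (mon_subst f m * mon_subst f m')"
      by (simp add: mult_single subst_single mon_subst_add)
    also have "\<dots> = poly_subst f (Poly_Mapping.single m c) * poly_subst f (Poly_Mapping.single m' c')"
      unfolding c subst_single by (simp only: ac_simps)
    finally show ?case .
  qed (simp_all add: subst_add algebra_simps)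
qed (simp_all add: subst_add algebra_simps)

lemma subst_diff: "poly_subst f (p - q) = poly_subst f p - poly_subst f q"
  by (rule additive_diff) (rule subst_add)

lemma subst_uminus: "poly_subst f (- p) = - poly_subst f p"
  using subst_diff[of f 0 p] by simp

lemma subst_sum: "poly_subst f (sum g I) = (\<Sum>i\<in>I. poly_subst f (g i))"
  by (rule additive_sum) (rule subst_add)

lemma subst_prod: "poly_subst f (prod g I) = (\<Prod>i\<in>I. poly_subst f (g i))"
  by (induction I rule: infinite_finite_induct) (auto simp: subst_mult)

lemma subst_power: "poly_subst f (p ^ n) = poly_subst f p ^ n"
  by (induction n) (auto simp: subst_mult)

lemmas subst_simps = subst_add subst_mult subst_diff subst_uminus subst_sum subst_prod subst_power

lemma subst_subst: "poly_subst g (poly_subst f p) = poly_subst (\<lambda>v. poly_subst g (f v)) p"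
proof (induction p rule: poly_induct)
  case (single m c)
  then show ?case by (simp add: subst_single subst_mult mon_subst_def subst_prod subst_power)
qed (auto simp: subst_add)

lemma Var_power: "Var v ^ n = mon (Poly_Mapping.single v n)"
proof (induction n)
  case (Suc n)
  then show ?case by (simp add: Var_def mult_single flip: single_add)
qed simp

lemma prod_mon: "(\<Prod>i\<in>I. mon (f i)) = mon (\<Sum>i\<in>I. f i)"
  by (induction I rule: infinite_finite_induct) (auto simp: mult_single)

lemma mon_eq_prod: "mon m = (\<Prod>v\<in>Poly_Mapping.keys m. Var v ^ Poly_Mapping.lookup m v)"
  by (simp add: Var_power prod_mon flip: poly_eq_sum_singles)

lemma subst_Var_id [simp]: "poly_subst Var p = p"
proof (induction p rule: poly_induct)
  case (single m c)
  then show ?case by (simp add: subst_single mon_subst_def flip: mon_eq_prod) (simp add: mult_single)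
qed (auto simp: subst_add)

subsection \<open>Polynomials in a given set of variables\<close>

definition polys :: "'v set \<Rightarrow> ('v, 'k::comm_ring_1) mpoly set" where
  "polys V = {p. \<forall>m \<in> Poly_Mapping.keys p. Poly_Mapping.keys m \<subseteq> V}"

lemma polys_0 [simp]: "0 \<in> polys V" and polys_1 [simp]: "1 \<in> polys V"
  and polys_coeff [simp]: "coeff_poly c \<in> polys V"
  by (auto simp: polys_def)

lemma polys_single: "Poly_Mapping.keys m \<subseteq> V \<Longrightarrow> Poly_Mapping.single m c \<in> polys V"
  by (simp add: polys_def)

lemma polys_Var [simp]: "v \<in> V \<Longrightarrow> Var v \<in> polys V"
  by (auto simp: polys_def Var_def)

lemma polys_add [simp]: "p \<in> polys V \<Longrightarrow> q \<in> polys V \<Longrightarrow> p + q \<in> polys V"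
  using keys_add[of p q] by (auto simp: polys_def)

lemma polys_mult [simp]: "p \<in> polys V \<Longrightarrow> q \<in> polys V \<Longrightarrow> p * q \<in> polys V"
proof -
  assume pq: "p \<in> polys V" "q \<in> polys V"
  have "Poly_Mapping.keys m \<subseteq> V" if m: "m \<in> Poly_Mapping.keys (p * q)" for m
  proof -
    obtain a b where ab: "m = a + b" "a \<in> Poly_Mapping.keys p" "b \<in> Poly_Mapping.keys q"
      using m keys_mult[of p q] by blast
    then have "Poly_Mapping.keys a \<subseteq> V" "Poly_Mapping.keys b \<subseteq> V" using pq by (auto simp: polys_def)
    then show ?thesis using keys_add[of a b] ab(1) by blast
  qed
  then show ?thesis by (simp add: polys_def)
qed

lemma polys_uminus [simp]: "p \<in> polys V \<Longrightarrow> - p \<in> polys V"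
  by (auto simp: polys_def in_keys_iff)

lemma polys_diff [simp]: "p \<in> polys V \<Longrightarrow> q \<in> polys V \<Longrightarrow> p - q \<in> polys V"
  using polys_add[of p V "- q"] by simp

lemma polys_sum: "(\<And>i. i \<in> I \<Longrightarrow> f i \<in> polys V) \<Longrightarrow> sum f I \<in> polys V"
  by (induction I rule: infinite_finite_induct) auto

lemma polys_prod: "(\<And>i. i \<in> I \<Longrightarrow> f i \<in> polys V) \<Longrightarrow> prod f I \<in> polys V"
  by (induction I rule: infinite_finite_induct) auto

lemma polys_power [simp]: "p \<in> polys V \<Longrightarrow> p ^ n \<in> polys V"
  by (induction n) auto

lemma polys_subst:
  assumes "p \<in> polys V" "\<And>v. v \<in> V \<Longrightarrow> f v \<in> polys V'"
  shows "poly_subst f p \<in> polys V'"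
proof -
  have "Poly_Mapping.keys m \<subseteq> V" if "m \<in> Poly_Mapping.keys p" for m
    using assms(1) that by (simp add: polys_def)
  then show ?thesis
    unfolding poly_subst_def using assms(2) by (intro polys_sum polys_mult polys_prod polys_power) auto
qed

lemma subst_cong:
  assumes "p \<in> polys V" "\<And>v. v \<in> V \<Longrightarrow> f v = g v"
  shows "poly_subst f p = poly_subst g p"
  unfolding poly_subst_def using assms
  by (intro sum.cong prod.cong refl arg_cong2[where f = "(*)"] arg_cong2[where f = "(^)"]) (auto simp: polys_def)

text \<open>Retraction of the ring in all variables of the type onto K[V]. Being a ring homomorphism
  that fixes K[V], it pulls prime and maximal ideals of K[V] back to the larger ring.\<close>

definition restrict_vars :: "'v set \<Rightarrow> ('v, 'k::comm_ring_1) mpoly \<Rightarrow> ('v, 'k) mpoly" where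
  "restrict_vars V = poly_subst (\<lambda>v. if v \<in> V then Var v else 0)"

lemma restrict_vars_id: "p \<in> polys V \<Longrightarrow> restrict_vars V p = p"
  using subst_cong[of p V "\<lambda>v. if v \<in> V then Var v else 0" Var] by (simp add: restrict_vars_def)

lemma restrict_vars_polys [simp]: "restrict_vars V p \<in> polys V"
proof -
  have "p \<in> polys UNIV" by (simp add: polys_def)
  then show ?thesis unfolding restrict_vars_def by (rule polys_subst) auto
qed

lemmas restrict_simps = subst_simps[of "\<lambda>v. if v \<in> V then Var v else 0" for V, folded restrict_vars_def]

lemma restrict_vars_coeff [simp]: "restrict_vars V (coeff_poly c) = coeff_poly c"
  and restrict_vars_0 [simp]: "restrict_vars V 0 = 0"
  and restrict_vars_1 [simp]: "restrict_vars V 1 = 1"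
  by (simp_all add: restrict_vars_def)

subsection \<open>The polynomial ring as an algebraic structure\<close>

lemma polynomial_ring_simps [simp]:
  "carrier (polynomial_ring K V) = polys V"
  "p \<otimes>\<^bsub>polynomial_ring K V\<^esub> q = p * q"
  "p \<oplus>\<^bsub>polynomial_ring K V\<^esub> q = p + q"
  "\<one>\<^bsub>polynomial_ring K V\<^esub> = 1"
  "\<zero>\<^bsub>polynomial_ring K V\<^esub> = 0"
  by (simp_all add: polynomial_ring_def ring_of_type_algebra_def polys_def)

lemma cring_polynomial_ring: "cring (polynomial_ring K V)"
proof (rule cringI)
  show "abelian_group (polynomial_ring K V)"
  proof (rule abelian_groupI)
    fix p assume "p \<in> carrier (polynomial_ring K V)"
    then show "\<exists>q\<in>carrier (polynomial_ring K V). q \<oplus>\<^bsub>polynomial_ring K V\<^esub> p = \<zero>\<^bsub>polynomial_ring K V\<^esub>"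
      by (intro bexI[of _ "- p"]) auto
  qed (auto simp: ac_simps)
  show "comm_monoid (polynomial_ring K V)"
    by (rule comm_monoidI) (auto simp: ac_simps)
qed (auto simp: algebra_simps)

lemma ideal_polynomial_ringI:
  assumes "J \<subseteq> polys V" "0 \<in> J" "\<And>a b. a \<in> J \<Longrightarrow> b \<in> J \<Longrightarrow> a + b \<in> J"
    "\<And>a b. a \<in> J \<Longrightarrow> b \<in> polys V \<Longrightarrow> b * a \<in> J"
  shows "ideal J (polynomial_ring K V)"
  by (rule cring.ideal_of_closed[OF cring_polynomial_ring]) (use assms in auto)

lemma ideal_polynomial_ringD:
  assumes "ideal J (polynomial_ring K V)"
  shows "J \<subseteq> polys V" "0 \<in> J" "\<And>a b. a \<in> J \<Longrightarrow> b \<in> J \<Longrightarrow> a + b \<in> J"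
    "\<And>a b. a \<in> J \<Longrightarrow> b \<in> polys V \<Longrightarrow> b * a \<in> J"
  using cring.ideal_closedD[OF cring_polynomial_ring assms] by simp_all

subsection \<open>Ideals of a ring given by a type\<close>

abbreviation ideal_span :: "'a::comm_ring_1 set \<Rightarrow> 'a set" where
  "ideal_span \<equiv> Modules.module.span (*)"

lemma module_times: "Modules.module ((*) :: 'a::comm_ring_1 \<Rightarrow> 'a \<Rightarrow> 'a)"
  by unfold_locales (auto simp: algebra_simps)

lemmas ideal_span_base = Modules.module.span_base[OF module_times]
  and ideal_span_0 = Modules.module.span_zero[OF module_times]
  and ideal_span_add = Modules.module.span_add[OF module_times]
  and ideal_span_diff = Modules.module.span_diff[OF module_times]
  and ideal_span_mult = Modules.module.span_scale[OF module_times]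
  and ideal_span_sum = Modules.module.span_sum[OF module_times]
  and ideal_span_mono = Modules.module.span_mono[OF module_times]
  and ideal_span_induct = Modules.module.span_induct_alt[OF module_times, consumes 1, case_names base step]

text \<open>A representation in the larger ring may use coefficients with foreign variables.
  Applying \<open>restrict_vars\<close> fixes the generators and turns the coefficients into
  elements of K[V].\<close>

lemma Idl_polynomial_ring:
  assumes "A \<subseteq> polys V"
  shows "Idl\<^bsub>polynomial_ring K V\<^esub> A = ideal_span A \<inter> polys V"
proof -
  interpret cring "polynomial_ring K V" by (rule cring_polynomial_ring)
  have A: "A \<subseteq> carrier (polynomial_ring K V)" using assms by simp
  have "ideal (ideal_span A \<inter> polys V) (polynomial_ring K V)"
    by (rule ideal_polynomial_ringI) (auto intro: ideal_span_0 ideal_span_add ideal_span_mult)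
  then have "Idl\<^bsub>polynomial_ring K V\<^esub> A \<subseteq> ideal_span A \<inter> polys V"
    using assms by (intro genideal_minimal) (auto intro: ideal_span_base)
  moreover have "restrict_vars V p \<in> Idl\<^bsub>polynomial_ring K V\<^esub> A" if "p \<in> ideal_span A" for p
    using that
  proof (induction rule: ideal_span_induct)
    case base
    then show ?case using ideal_polynomial_ringD(2)[OF genideal_ideal[OF A]] by simp
  next
    case (step c a p)
    note I = ideal_polynomial_ringD[OF genideal_ideal[OF A]]
    have "restrict_vars V a = a" using step.hyps assms by (intro restrict_vars_id) auto
    moreover have "a \<in> Idl\<^bsub>polynomial_ring K V\<^esub> A" using genideal_self[OF A] step.hyps by blast
    ultimately have "restrict_vars V (c * a) \<in> Idl\<^bsub>polynomial_ring K V\<^esub> A"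
      using I(4)[of a "restrict_vars V c"] by (simp add: restrict_simps)
    then show ?case using I(3) step.IH by (simp add: restrict_simps)
  qed
  ultimately show ?thesis using restrict_vars_id by fastforce
qed

subsection \<open>Square-free monomial ideals\<close>

definition charexp :: "'v set \<Rightarrow> 'v \<Rightarrow>\<^sub>0 nat" where
  "charexp e = (\<Sum>v\<in>e. Poly_Mapping.single v 1)"

lemma edge_monomial_mon: "edge_monomial e = mon (charexp e)"
  by (simp add: edge_monomial_def charexp_def Var_def prod_mon)

lemma lookup_charexp: "finite e \<Longrightarrow> Poly_Mapping.lookup (charexp e) v = (if v \<in> e then 1 else 0)"
  by (auto simp: charexp_def lookup_sum lookup_single when_def)

lemma keys_charexp: "finite e \<Longrightarrow> Poly_Mapping.keys (charexp e) = e"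
  by (rule Set.set_eqI) (simp add: lookup_charexp flip: lookup_not_eq_zero_eq_in_keys)

lemma keys_add_nat: "Poly_Mapping.keys (m + m' :: 'v \<Rightarrow>\<^sub>0 nat) = Poly_Mapping.keys m \<union> Poly_Mapping.keys m'"
  by (rule Set.set_eqI) (simp add: lookup_add flip: lookup_not_eq_zero_eq_in_keys)

lemma add_diff_exp:
  assumes "\<And>v. Poly_Mapping.lookup m' v \<le> Poly_Mapping.lookup m v"
  shows "m' + (m - m') = (m :: 'v \<Rightarrow>\<^sub>0 nat)"
  by (rule poly_mapping_eqI) (use assms in \<open>simp add: lookup_add lookup_minus\<close>)

lemma charexp_dvd:
  assumes "finite e" "e \<subseteq> Poly_Mapping.keys m"
  shows "charexp e + (m - charexp e) = m"
proof (rule add_diff_exp)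
  fix v show "Poly_Mapping.lookup (charexp e) v \<le> Poly_Mapping.lookup m v"
    using assms by (auto simp: lookup_charexp Suc_le_eq subset_iff simp flip: lookup_not_eq_zero_eq_in_keys)
qed

lemma polys_edge_monomial: "e \<subseteq> V \<Longrightarrow> edge_monomial e \<in> polys V"
  unfolding edge_monomial_def by (intro polys_prod) auto

text \<open>Divisibility by a square-free monomial depends only on the support, and an ideal
  generated by monomials contains a polynomial exactly when it contains each of its terms.\<close>

lemma mem_monomial_ideal_iff:
  assumes "\<And>e. e \<in> E \<Longrightarrow> finite e"
  shows "p \<in> ideal_span (edge_monomial ` E) \<longleftrightarrow>
    (\<forall>m\<in>Poly_Mapping.keys p. \<exists>e\<in>E. e \<subseteq> Poly_Mapping.keys m)"
proof
  assume "p \<in> ideal_span (edge_monomial ` E)"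
  then show "\<forall>m\<in>Poly_Mapping.keys p. \<exists>e\<in>E. e \<subseteq> Poly_Mapping.keys m"
  proof (induction rule: ideal_span_induct)
    case base
    show ?case by simp
  next
    case (step c a p)
    from step.hyps obtain e where e: "e \<in> E" "a = edge_monomial e" by blast
    have *: "e \<subseteq> Poly_Mapping.keys m" if m: "m \<in> Poly_Mapping.keys (c * a)" for m
    proof -
      obtain x y where "m = x + y" "y \<in> Poly_Mapping.keys a" using m keys_mult[of c a] by blast
      moreover have "Poly_Mapping.keys a \<subseteq> {charexp e}" by (simp add: e(2) edge_monomial_mon)
      ultimately show ?thesis using keys_charexp[OF assms[OF e(1)]] by (auto simp: keys_add_nat)
    qed
    show ?case
    proof
      fix m assume "m \<in> Poly_Mapping.keys (c * a + p)"
      then consider "m \<in> Poly_Mapping.keys (c * a)" | "m \<in> Poly_Mapping.keys p"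
        using keys_add[of "c * a" p] by blast
      then show "\<exists>e\<in>E. e \<subseteq> Poly_Mapping.keys m" using * e(1) step.IH by blast
    qed
  qed
next
  assume *: "\<forall>m\<in>Poly_Mapping.keys p. \<exists>e\<in>E. e \<subseteq> Poly_Mapping.keys m"
  have "Poly_Mapping.single m (Poly_Mapping.lookup p m) \<in> ideal_span (edge_monomial ` E)"
    if m: "m \<in> Poly_Mapping.keys p" for m
  proof -
    obtain e where e: "e \<in> E" "e \<subseteq> Poly_Mapping.keys m" using * m by blast
    have "(m - charexp e) + charexp e = m"
      using charexp_dvd[OF assms[OF e(1)] e(2)] by (simp only: add.commute)
    then have eq: "Poly_Mapping.single (m - charexp e) (Poly_Mapping.lookup p m) * edge_monomial e =
      Poly_Mapping.single m (Poly_Mapping.lookup p m)"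
      by (simp add: edge_monomial_mon mult_single)
    have "edge_monomial e \<in> ideal_span (edge_monomial ` E)"
      using e(1) by (intro ideal_span_base imageI)
    then show ?thesis using ideal_span_mult[of "edge_monomial e" _ "Poly_Mapping.single (m - charexp e) (Poly_Mapping.lookup p m)"]
      unfolding eq by blast
  qed
  then have "(\<Sum>m\<in>Poly_Mapping.keys p. Poly_Mapping.single m (Poly_Mapping.lookup p m)) \<in> ideal_span (edge_monomial ` E)"
    by (rule ideal_span_sum)
  then show "p \<in> ideal_span (edge_monomial ` E)" by (simp only: poly_eq_sum_singles[symmetric])
qed

section \<open>Quotient rings\<close>

lemma (in cring) coset_hom:
  assumes "ideal I R"
  shows "ring_hom_cring R (R Quot I) ((+>) I)"
  using ideal.rcos_ring_hom_cring[OF assms is_cring] .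

lemma coset_carrier: "carrier (R Quot I) = ((+>\<^bsub>R\<^esub>) I) ` carrier R"
  by (auto simp: FactRing_def A_RCOSETS_def RCOSETS_def a_r_coset_def)

lemma (in cring) coset_eq_iff:
  assumes "ideal I R" "a \<in> carrier R" "b \<in> carrier R"
  shows "I +> a = I +> b \<longleftrightarrow> a \<ominus> b \<in> I"
  using quotient_eq_iff_same_a_r_cos[OF assms] by simp

lemma (in cring) ideal_coset_preimage:
  assumes I: "ideal I R" and J: "ideal J (R Quot I)"
  shows "ideal {r \<in> carrier R. I +> r \<in> J} R"
  by (rule ring_hom_ring.ideal_vimage[OF ideal.rcos_ring_hom_ring[OF I] J])

lemma (in cring) coset_of_mem:
  assumes I: "ideal I R" and r: "r \<in> I"
  shows "I +> r = I +> \<zero>"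
proof -
  have "r \<in> carrier R" using r ideal_closedD(1)[OF I] by blast
  then show ?thesis using r by (subst coset_eq_iff[OF I]) (simp_all add: minus_eq)
qed

lemma (in cring) ideal_subset_coset_preimage:
  assumes I: "ideal I R" and J: "ideal J (R Quot I)"
  shows "I \<subseteq> {r \<in> carrier R. I +> r \<in> J}"
proof
  interpret h: ring_hom_cring R "R Quot I" "(+>) I" by (rule coset_hom[OF I])
  fix r assume r: "r \<in> I"
  have "I +> r \<in> J"
    unfolding coset_of_mem[OF I r] h.hom_zero by (rule h.S.ideal_closedD(2)[OF J])
  then show "r \<in> {r \<in> carrier R. I +> r \<in> J}" using r ideal_closedD(1)[OF I] by blast
qed

text \<open>Lets ideals of the quotient ring be computed in \<open>R\<close>, with \<open>I\<close>
  added to the generators; regular sequences of the quotient are handled in this form.\<close>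

lemma (in cring) Idl_coset_iff:
  assumes I: "ideal I R" and A: "A \<subseteq> carrier R" and a: "a \<in> carrier R"
  shows "I +> a \<in> Idl\<^bsub>R Quot I\<^esub> ((+>) I ` A) \<longleftrightarrow> a \<in> Idl (I \<union> A)"
proof -
  interpret h: ring_hom_cring R "R Quot I" "(+>) I" by (rule coset_hom[OF I])
  let ?Q = "R Quot I"
  have IA: "I \<union> A \<subseteq> carrier R" using A ideal_closedD(1)[OF I] by blast
  have AQ: "(+>) I ` A \<subseteq> carrier ?Q" using A by (auto simp: coset_carrier)
  note J = h.S.genideal_ideal[OF AQ]
  show ?thesis
  proof
    assume "a \<in> Idl (I \<union> A)"
    moreover have "Idl (I \<union> A) \<subseteq> {r \<in> carrier R. I +> r \<in> Idl\<^bsub>?Q\<^esub> ((+>) I ` A)}"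
    proof (rule genideal_minimal[OF ideal_coset_preimage[OF I J]])
      have "I +> r \<in> Idl\<^bsub>?Q\<^esub> ((+>) I ` A)" if r: "r \<in> I" for r
      proof -
        show ?thesis using coset_of_mem[OF I r] h.S.ideal_closedD(2)[OF J] by simp
      qed
      then show "I \<union> A \<subseteq> {r \<in> carrier R. I +> r \<in> Idl\<^bsub>?Q\<^esub> ((+>) I ` A)}"
        using IA h.S.genideal_self[OF AQ] by blast
    qed
    ultimately show "I +> a \<in> Idl\<^bsub>?Q\<^esub> ((+>) I ` A)" by blast
  next
    assume a': "I +> a \<in> Idl\<^bsub>?Q\<^esub> ((+>) I ` A)"
    note L = ideal_closedD[OF genideal_ideal[OF IA]]
    have "ideal ((+>) I ` (Idl (I \<union> A))) ?Q"
      by (rule ring_ideal_imp_quot_ideal[OF I genideal_ideal[OF IA]])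
    then have "Idl\<^bsub>?Q\<^esub> ((+>) I ` A) \<subseteq> (+>) I ` (Idl (I \<union> A))"
      using genideal_self[OF IA] by (intro h.S.genideal_minimal) auto
    then obtain r where r: "r \<in> Idl (I \<union> A)" "I +> a = I +> r" using a' by blast
    have rc: "r \<in> carrier R" using r L(1) by blast
    have "a \<ominus> r \<in> Idl (I \<union> A)"
      using r(2) coset_eq_iff[OF I a rc] genideal_self[OF IA] by blast
    then have "(a \<ominus> r) \<oplus> r \<in> Idl (I \<union> A)" using r L(3) by blast
    moreover have "(a \<ominus> r) \<oplus> r = a" using a rc by (simp add: minus_eq a_assoc l_neg)
    ultimately show "a \<in> Idl (I \<union> A)" by simp
  qed
qed

lemma (in cring) noetherian_quotient:
  assumes I: "ideal I R" and noeth: "noetherian_ring R"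
  shows "noetherian_ring (R Quot I)"
proof -
  interpret h: ring_hom_cring R "R Quot I" "(+>) I" by (rule coset_hom[OF I])
  show ?thesis
  proof (rule h.S.noetherian_ringI)
    fix J assume J: "ideal J (R Quot I)"
    obtain A where A: "A \<subseteq> carrier R" "finite A" "{r \<in> carrier R. I +> r \<in> J} = Idl A"
      using noetherian_ring.finetely_gen[OF noeth ideal_coset_preimage[OF I J]] by blast
    have AQ: "(+>) I ` A \<subseteq> carrier (R Quot I)" using A by (auto simp: coset_carrier)
    have "(+>) I ` A \<subseteq> J" using genideal_self[OF A(1)] A(3) by blast
    then have "Idl\<^bsub>R Quot I\<^esub> ((+>) I ` A) \<subseteq> J" by (rule h.S.genideal_minimal[OF J])
    moreover have "x \<in> Idl\<^bsub>R Quot I\<^esub> ((+>) I ` A)" if x: "x \<in> J" for x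
    proof -
      have "x \<in> carrier (R Quot I)" using x h.S.ideal_closedD(1)[OF J] by blast
      then obtain r where r: "r \<in> carrier R" "x = I +> r" by (auto simp: coset_carrier)
      then have "r \<in> Idl A" using x A(3) by blast
      also have "Idl A \<subseteq> Idl (I \<union> A)"
        using A ideal_closedD(1)[OF I] by (intro subset_Idl_subset) auto
      finally show ?thesis using Idl_coset_iff[OF I A(1) r(1)] r by simp
    qed
    ultimately have "J = Idl\<^bsub>R Quot I\<^esub> ((+>) I ` A)" by blast
    then show "\<exists>A\<subseteq>carrier (R Quot I). finite A \<and> J = Idl\<^bsub>R Quot I\<^esub> A" using AQ A(2) by blast
  qed
qed

lemma (in cring) regular_sequence_quotient:
  assumes I: "ideal I R" and fs: "set fs \<subseteq> carrier R"
    and reg: "\<And>i a. i < length fs \<Longrightarrow> a \<in> carrier R \<Longrightarrow> fs ! i \<otimes> a \<in> Idl (I \<union> set (take i fs)) \<Longrightarrow>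
      a \<in> Idl (I \<union> set (take i fs))"
    and proper: "\<one> \<notin> Idl (I \<union> set fs)"
  shows "regular_sequence (R Quot I) (map ((+>) I) fs)"
proof -
  interpret h: ring_hom_cring R "R Quot I" "(+>) I" by (rule coset_hom[OF I])
  show ?thesis
    unfolding regular_sequence_def
  proof (intro conjI allI impI ballI)
    show "set (map ((+>) I) fs) \<subseteq> carrier (R Quot I)" using fs by (auto simp: coset_carrier)
    show "Idl\<^bsub>R Quot I\<^esub> (set (map ((+>) I) fs)) \<noteq> carrier (R Quot I)"
    proof
      assume eq: "Idl\<^bsub>R Quot I\<^esub> (set (map ((+>) I) fs)) = carrier (R Quot I)"
      have "I +> \<one> \<in> carrier (R Quot I)" unfolding coset_carrier by (intro imageI one_closed)
      then have "I +> \<one> \<in> Idl\<^bsub>R Quot I\<^esub> ((+>) I ` set fs)" using eq by (simp only: set_map)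
      then show False using Idl_coset_iff[OF I fs one_closed] proper by blast
    qed
    fix i x assume i: "i < length (map ((+>) I) fs)" and x: "x \<in> carrier (R Quot I)"
      and mem: "map ((+>) I) fs ! i \<otimes>\<^bsub>R Quot I\<^esub> x \<in> Idl\<^bsub>R Quot I\<^esub> (set (take i (map ((+>) I) fs)))"
    obtain a where a: "a \<in> carrier R" "x = I +> a" using x by (auto simp: coset_carrier)
    have take: "set (take i fs) \<subseteq> carrier R" using fs set_take_subset by fast
    have fi: "fs ! i \<in> carrier R" using fs i by auto
    have "I +> (fs ! i \<otimes> a) \<in> Idl\<^bsub>R Quot I\<^esub> ((+>) I ` set (take i fs))"
      using mem i a fi by (simp add: take_map)
    then have "fs ! i \<otimes> a \<in> Idl (I \<union> set (take i fs))"
      using Idl_coset_iff[OF I take m_closed[OF fi a(1)]] by blast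
    then have "a \<in> Idl (I \<union> set (take i fs))" using reg[of i a] i a(1) by simp
    then show "x \<in> Idl\<^bsub>R Quot I\<^esub> (set (take i (map ((+>) I) fs)))"
      using Idl_coset_iff[OF I take a(1)] a by (simp add: take_map)
  qed
qed

lemma (in cring) primeideal_coset_preimage:
  assumes I: "ideal I R" and P: "primeideal P (R Quot I)"
  shows "primeideal {r \<in> carrier R. I +> r \<in> P} R"
proof -
  interpret h: ring_hom_cring R "R Quot I" "(+>) I" by (rule coset_hom[OF I])
  interpret P: primeideal P "R Quot I" by (rule P)
  show ?thesis
  proof (rule primeidealI[OF ideal_coset_preimage[OF I P.is_ideal] is_cring])
    have "I +> \<one> \<notin> P" using P.I_notcarr P.one_imp_carrier h.hom_one by auto
    then show "carrier R \<noteq> {r \<in> carrier R. I +> r \<in> P}" by blast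
    fix a b assume "a \<in> carrier R" "b \<in> carrier R" "a \<otimes> b \<in> {r \<in> carrier R. I +> r \<in> P}"
    then show "a \<in> {r \<in> carrier R. I +> r \<in> P} \<or> b \<in> {r \<in> carrier R. I +> r \<in> P}"
      using P.I_prime[of "I +> a" "I +> b"] by simp
  qed
qed

section \<open>Polynomial rings in finitely many variables are noetherian\<close>

lemma mono_subseq_nat:
  fixes h :: "nat \<Rightarrow> nat"
  shows "\<exists>r. strict_mono r \<and> (\<forall>i j :: nat. i \<le> j \<longrightarrow> h (r i) \<le> h (r j))"
proof -
  obtain f where f: "strict_mono f" "monoseq (\<lambda>n. h (f n))" using seq_monosub[of h] by auto
  from f(2) show ?thesis
    unfolding monoseq_def
  proof
    assume "\<forall>m. \<forall>n\<ge>m. h (f m) \<le> h (f n)"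
    then show ?thesis using f(1) by (intro exI[of _ f]) simp
  next
    assume dec: "\<forall>m. \<forall>n\<ge>m. h (f n) \<le> h (f m)"
    \<comment> \<open>A decreasing sequence of natural numbers is constant from the place of its
      minimum on.\<close>
    obtain N where N: "\<And>n. h (f N) \<le> h (f n)"
      using ex_has_least_nat[of "\<lambda>_. True" undefined "\<lambda>n. h (f n)"] by auto
    have "h (f (N + i)) = h (f N)" for i using dec N by (simp add: antisym)
    moreover have "strict_mono (\<lambda>i. f (N + i))" using f(1) by (simp add: strict_mono_def)
    ultimately show ?thesis by (intro exI[of _ "\<lambda>i. f (N + i)"]) simp
  qed
qed

text \<open>The sequence is thinned out once for each variable; a further subsequence keeps the
  monotonicity already gained.\<close>

lemma dickson_subseq:
  fixes g :: "nat \<Rightarrow> 'v \<Rightarrow> nat"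
  assumes "finite V"
  shows "\<exists>r. strict_mono r \<and> (\<forall>v\<in>V. \<forall>i j :: nat. i \<le> j \<longrightarrow> g (r i) v \<le> g (r j) v)"
  using assms
proof (induction V rule: finite_induct)
  case empty
  show ?case by (intro exI[of _ id]) (simp add: strict_mono_def)
next
  case (insert v V)
  then obtain r where r: "strict_mono r" "\<forall>v\<in>V. \<forall>i j :: nat. i \<le> j \<longrightarrow> g (r i) v \<le> g (r j) v" by (elim exE conjE) (rule that)
  obtain s where s: "strict_mono s" "\<forall>i j :: nat. i \<le> j \<longrightarrow> g (r (s i)) v \<le> g (r (s j)) v"
    using mono_subseq_nat[of "\<lambda>i. g (r i) v"] by (elim exE conjE) (rule that)
  have "strict_mono (\<lambda>i. r (s i))" using r(1) s(1) by (simp add: strict_mono_def)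
  moreover have "g (r (s i)) u \<le> g (r (s j)) u" if "u \<in> insert v V" "i \<le> j" for u i j
    using that r(2) s strict_mono_less_eq[OF s(1)] by auto
  ultimately show ?case by (intro exI[of _ "\<lambda>i. r (s i)"]) simp
qed

text \<open>If no finite subset worked, choosing again and again an element that dominates none of
  the earlier ones would give a sequence without the increasing pair that
  \<open>dickson_subseq\<close> provides.\<close>

lemma dickson_basis:
  fixes D :: "('v \<Rightarrow> nat) set"
  assumes V: "finite V"
  shows "\<exists>B\<subseteq>D. finite B \<and> (\<forall>m\<in>D. \<exists>b\<in>B. \<forall>v\<in>V. b v \<le> m v)"
proof (rule ccontr)
  assume contra: "\<not> (\<exists>B\<subseteq>D. finite B \<and> (\<forall>m\<in>D. \<exists>b\<in>B. \<forall>v\<in>V. b v \<le> m v))"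
  have "\<exists>m. m \<in> D \<and> (\<forall>b\<in>B. \<not> (\<forall>v\<in>V. b v \<le> m v))" if B: "B \<subseteq> D" "finite B" for B
  proof (rule ccontr)
    assume neg: "\<not> (\<exists>m. m \<in> D \<and> (\<forall>b\<in>B. \<not> (\<forall>v\<in>V. b v \<le> m v)))"
    have "\<forall>m\<in>D. \<exists>b\<in>B. \<forall>v\<in>V. b v \<le> m v"
    proof (rule ballI, rule ccontr)
      fix m assume "m \<in> D" "\<not> (\<exists>b\<in>B. \<forall>v\<in>V. b v \<le> m v)"
      then show False using neg by (simp only: bex_simps) blast
    qed
    then have "B \<subseteq> D \<and> finite B \<and> (\<forall>m\<in>D. \<exists>b\<in>B. \<forall>v\<in>V. b v \<le> m v)" using B by simp
    then show False using contra by (rule_tac notE[OF contra]) (rule exI)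
  qed
  then have "\<forall>B. \<exists>m. B \<subseteq> D \<longrightarrow> finite B \<longrightarrow> m \<in> D \<and> (\<forall>b\<in>B. \<not> (\<forall>v\<in>V. b v \<le> m v))" by simp
  then obtain c where c': "\<forall>B. B \<subseteq> D \<longrightarrow> finite B \<longrightarrow> c B \<in> D \<and> (\<forall>b\<in>B. \<not> (\<forall>v\<in>V. b v \<le> c B v))"
    by (drule_tac choice) (elim exE, rule that)
  have c: "c B \<in> D" "b \<in> B \<Longrightarrow> \<not> (\<forall>v\<in>V. b v \<le> c B v)" if "B \<subseteq> D" "finite B" for B b
    using c' that by auto
  define B where "B n = rec_nat {} (\<lambda>_ A. insert (c A) A) n" for n :: nat
  have B_simps: "B 0 = {}" "B (Suc n) = insert (c (B n)) (B n)" for n by (simp_all add: B_def)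
  have B: "B n \<subseteq> D \<and> finite (B n)" for n
    by (induction n) (use c in \<open>auto simp: B_simps\<close>)
  have mem: "c (B i) \<in> B j" if "i < j" for i j
    using that by (induction j) (auto simp: B_simps less_Suc_eq)
  obtain r where r: "strict_mono r" "\<forall>v\<in>V. \<forall>i j :: nat. i \<le> j \<longrightarrow> c (B (r i)) v \<le> c (B (r j)) v"
    using dickson_subseq[OF V, of "\<lambda>i. c (B i)"] by (elim exE conjE) (rule that)
  have "c (B (r 0)) \<in> B (r 1)" using r(1) by (intro mem) (simp add: strict_mono_def)
  then have "\<not> (\<forall>v\<in>V. c (B (r 0)) v \<le> c (B (r 1)) v)" using B by (intro c(2)) auto
  moreover have "\<forall>v\<in>V. c (B (r 0)) v \<le> c (B (r 1)) v" using r(2) by simp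
  ultimately show False by blast
qed

section \<open>Lexicographic order and leading monomials\<close>

fun lex_less :: "'v list \<Rightarrow> ('v \<Rightarrow> nat) \<Rightarrow> ('v \<Rightarrow> nat) \<Rightarrow> bool" where
  "lex_less [] m m' \<longleftrightarrow> False"
| "lex_less (v # vs) m m' \<longleftrightarrow> m v < m' v \<or> m v = m' v \<and> lex_less vs m m'"

lemma lex_less_trans: "lex_less vs a b \<Longrightarrow> lex_less vs b c \<Longrightarrow> lex_less vs a c"
  by (induction vs) auto

lemma lex_less_total: "lex_less vs a b \<or> lex_less vs b a \<or> (\<forall>v\<in>set vs. a v = b v)"
  by (induction vs) auto

lemma lex_less_add: "lex_less vs a b \<Longrightarrow> lex_less vs (\<lambda>v. c v + a v) (\<lambda>v. c v + b v)"
  by (induction vs) auto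

lemma lex_less_not_ge: "lex_less vs a b \<Longrightarrow> \<exists>v\<in>set vs. a v < b v"
  by (induction vs) auto

text \<open>An infinite descent would contain a subsequence that weakly increases in every variable
  of \<open>vs\<close>, while a lexicographic descent lowers at least one of them.\<close>

lemma wf_lex_less: "wf {(a, b). lex_less vs a b}"
proof (rule ccontr)
  assume "\<not> wf {(a, b). lex_less vs a b}"
  then obtain f where f: "\<And>i. lex_less vs (f (Suc i)) (f i)"
    unfolding wf_iff_no_infinite_down_chain by auto
  have desc: "lex_less vs (f j) (f i)" if "i < j" for i j
    using that
  proof (induction j)
    case (Suc j)
    then show ?case using f[of j] lex_less_trans less_Suc_eq by metis
  qed simp
  obtain r where r: "strict_mono r" "\<forall>v\<in>set vs. \<forall>i j :: nat. i \<le> j \<longrightarrow> f (r i) v \<le> f (r j) v"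
    using dickson_subseq[OF finite_set, of vs f] by (elim exE conjE) (rule that)
  have "lex_less vs (f (r 1)) (f (r 0))" using r(1) by (intro desc) (simp add: strict_mono_def)
  then obtain v where "v \<in> set vs" "f (r 1) v < f (r 0) v" using lex_less_not_ge by blast
  moreover from this have "f (r 0) v \<le> f (r 1) v" using r(2) by simp
  ultimately show False by simp
qed

definition lead :: "'v list \<Rightarrow> ('v, 'k::comm_ring_1) mpoly \<Rightarrow> ('v \<Rightarrow>\<^sub>0 nat) \<Rightarrow> bool" where
  "lead vs p m \<longleftrightarrow> m \<in> Poly_Mapping.keys p \<and>
    (\<forall>k\<in>Poly_Mapping.keys p. k \<noteq> m \<longrightarrow> lex_less vs (Poly_Mapping.lookup k) (Poly_Mapping.lookup m))"

lemma ex_lead: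
  assumes p: "p \<in> polys (set vs)" "p \<noteq> 0"
  shows "\<exists>m. lead vs p m"
proof -
  have main: "finite K \<Longrightarrow> K \<noteq> {} \<Longrightarrow> K \<subseteq> Poly_Mapping.keys p \<Longrightarrow>
    \<exists>m\<in>K. \<forall>k\<in>K. k \<noteq> m \<longrightarrow> lex_less vs (Poly_Mapping.lookup k) (Poly_Mapping.lookup m)" for K
  proof (induction K rule: finite_ne_induct)
    case (insert x F)
    then obtain m where m: "m \<in> F" "\<forall>k\<in>F. k \<noteq> m \<longrightarrow> lex_less vs (Poly_Mapping.lookup k) (Poly_Mapping.lookup m)" by auto
    have "x \<noteq> m" using insert m by auto
    have "\<not> (\<forall>v\<in>set vs. Poly_Mapping.lookup x v = Poly_Mapping.lookup m v)"
    proof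
      assume eq: "\<forall>v\<in>set vs. Poly_Mapping.lookup x v = Poly_Mapping.lookup m v"
      have "Poly_Mapping.keys x \<subseteq> set vs" "Poly_Mapping.keys m \<subseteq> set vs"
        using p(1) insert.prems m(1) by (auto simp: polys_def)
      then have "Poly_Mapping.lookup x v = Poly_Mapping.lookup m v" for v
        using eq by (cases "v \<in> set vs") (simp_all add: lookup_eq_0_outside)
      then show False using \<open>x \<noteq> m\<close> by (simp add: poly_mapping_eqI)
    qed
    then consider "lex_less vs (Poly_Mapping.lookup x) (Poly_Mapping.lookup m)"
      | "lex_less vs (Poly_Mapping.lookup m) (Poly_Mapping.lookup x)" using lex_less_total by blast
    then show ?case
    proof cases
      case 1
      then show ?thesis using m by (intro bexI[of _ m]) auto
    next
      case 2
      then have "\<forall>k\<in>insert x F. k \<noteq> x \<longrightarrow> lex_less vs (Poly_Mapping.lookup k) (Poly_Mapping.lookup x)"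
      proof (intro ballI impI)
        fix k assume k: "k \<in> insert x F" "k \<noteq> x"
        show "lex_less vs (Poly_Mapping.lookup k) (Poly_Mapping.lookup x)"
        proof (cases "k = m")
          case False
          then have "lex_less vs (Poly_Mapping.lookup k) (Poly_Mapping.lookup m)" using m(2) k by auto
          then show ?thesis using 2 by (rule lex_less_trans)
        qed (use 2 in simp)
      qed
      then show ?thesis by blast
    qed
  qed simp
  have "Poly_Mapping.keys p \<noteq> {}" using p(2) by simp
  from main[OF finite_keys this subset_refl] show ?thesis unfolding lead_def by (elim bexE) (intro exI conjI)
qed

text \<open>Groebner basis argument: by Dickson's lemma every leading exponent of \<open>J\<close>
  dominates one of finitely many, and subtracting multiples of the corresponding elements lowers the
  leading exponent, which cannot go on forever.\<close>

theorem noetherian_polynomial_ring: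
  fixes K :: "'k::field itself"
  assumes V: "finite V"
  shows "noetherian_ring (polynomial_ring K V)"
proof -
  interpret cring "polynomial_ring K V" by (rule cring_polynomial_ring)
  obtain vs where vs: "set vs = V" using finite_list[OF V] by blast
  show ?thesis
  proof (rule noetherian_ringI)
    fix J assume J: "ideal J (polynomial_ring K V)"
    note J' = ideal_polynomial_ringD[OF J]
    define D where "D = {Poly_Mapping.lookup m | m. \<exists>p\<in>J. lead vs p m}"
    obtain B where B: "B \<subseteq> D" "finite B" "\<forall>m\<in>D. \<exists>b\<in>B. \<forall>v\<in>V. b v \<le> m v"
      using dickson_basis[OF V] by blast
    have "\<forall>b\<in>B. \<exists>p. p \<in> J \<and> (\<exists>m. b = Poly_Mapping.lookup m \<and> lead vs p m)"
      using B(1) by (auto simp: D_def)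
    then obtain P where P: "\<And>b. b \<in> B \<Longrightarrow> P b \<in> J \<and> (\<exists>m. b = Poly_Mapping.lookup m \<and> lead vs (P b) m)"
      by metis
    have PJ: "P ` B \<subseteq> J" using P by blast
    then have PV: "P ` B \<subseteq> carrier (polynomial_ring K V)" using J'(1) by auto
    note A' = ideal_polynomial_ringD[OF genideal_ideal[OF PV]]
    let ?A = "Idl\<^bsub>polynomial_ring K V\<^esub> (P ` B)"
    \<comment> \<open>The zero polynomial has no leading exponent, so m is tied to f only when f is
      nonzero.\<close>
    have main: "f \<in> ?A" if "f \<in> J" "f \<noteq> 0 \<Longrightarrow> lead vs f m" for f m
      using that
    proof (induction "Poly_Mapping.lookup m" arbitrary: f m rule: wf_induct_rule[OF wf_lex_less[of vs]])
      case (1 m f)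
      show ?case
      proof (cases "f = 0")
        case True
        then show ?thesis using A'(2) by simp
      next
        case False
        then have lm: "lead vs f m" using 1 by blast
        then have "Poly_Mapping.lookup m \<in> D" using 1 by (auto simp: D_def)
        then obtain b where b: "b \<in> B" "\<forall>v\<in>V. b v \<le> Poly_Mapping.lookup m v" using B(3) by blast
        then obtain mb where mb: "b = Poly_Mapping.lookup mb" "lead vs (P b) mb" using P by blast
        have PbJ: "P b \<in> J" using P b by blast
        have keysV: "Poly_Mapping.keys k \<subseteq> V" if "p \<in> J" "k \<in> Poly_Mapping.keys p" for p k
          using that J'(1) by (auto simp: polys_def)
        have kmb: "Poly_Mapping.keys mb \<subseteq> V" using keysV[OF PbJ] mb(2) by (simp add: lead_def)
        have "Poly_Mapping.lookup mb v \<le> Poly_Mapping.lookup m v" for v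
          using b(2) mb(1) lookup_eq_0_outside[OF kmb] by (cases "v \<in> V") auto
        then have madd: "(m - mb) + mb = m" using add_diff_exp[of mb m] by (simp add: add.commute)
        \<comment> \<open>Makes the leading term of the shifted multiple of \<open>P b\<close> agree
          with that of f.\<close>
        define c where "c = Poly_Mapping.lookup f m / Poly_Mapping.lookup (P b) mb"
        define q where "q = Poly_Mapping.single (m - mb) c * P b"
        have nz: "Poly_Mapping.lookup (P b) mb \<noteq> 0" using mb(2) by (simp add: lead_def in_keys_iff)
        have "Poly_Mapping.keys (m - mb) \<subseteq> Poly_Mapping.keys m"
        proof
          fix v assume "v \<in> Poly_Mapping.keys (m - mb)"
          then show "v \<in> Poly_Mapping.keys m" unfolding in_keys_iff lookup_minus by simp
        qed
        then have sp: "Poly_Mapping.single (m - mb) c \<in> polys V"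
          using keysV[OF 1(2)] lm by (intro polys_single) (auto simp: lead_def)
        have qJ: "q \<in> J" unfolding q_def using PbJ sp by (rule J'(4))
        have fqJ: "f - q \<in> J"
          using J'(3)[OF 1(2) J'(4)[OF qJ, of "- 1"]] by simp
        have "Poly_Mapping.lookup q m = Poly_Mapping.lookup f m"
          using lookup_single_mult[of "m - mb" c "P b" mb] nz unfolding madd by (simp add: q_def c_def)
        then have mk: "m \<notin> Poly_Mapping.keys (f - q)" by (simp add: in_keys_iff lookup_minus)
        have small: "lex_less vs (Poly_Mapping.lookup k) (Poly_Mapping.lookup m)" if k: "k \<in> Poly_Mapping.keys (f - q)" for k
        proof -
          have "k \<noteq> m" using k mk by blast
          have "Poly_Mapping.lookup f k \<noteq> 0 \<or> Poly_Mapping.lookup q k \<noteq> 0"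
            using k unfolding in_keys_iff lookup_minus by auto
          then consider "k \<in> Poly_Mapping.keys f" | "k \<in> Poly_Mapping.keys q"
            unfolding in_keys_iff by blast
          then show ?thesis
          proof cases
            case 1
            then show ?thesis using lm \<open>k \<noteq> m\<close> by (simp add: lead_def)
          next
            case 2
            then obtain k' where k': "k' \<in> Poly_Mapping.keys (P b)" "k = (m - mb) + k'"
              using keys_single_mult[of "m - mb" c "P b"] unfolding q_def by blast
            then have "k' \<noteq> mb" using \<open>k \<noteq> m\<close> madd by auto
            then have "lex_less vs (Poly_Mapping.lookup k') (Poly_Mapping.lookup mb)"
              using mb(2) k' by (simp add: lead_def)
            then have "lex_less vs (\<lambda>v. Poly_Mapping.lookup (m - mb) v + Poly_Mapping.lookup k' v)
              (\<lambda>v. Poly_Mapping.lookup (m - mb) v + Poly_Mapping.lookup mb v)" by (rule lex_less_add)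
            moreover have "(\<lambda>v. Poly_Mapping.lookup (m - mb) v + Poly_Mapping.lookup k' v) = Poly_Mapping.lookup k"
              by (simp add: k'(2) lookup_add fun_eq_iff)
            moreover have "(\<lambda>v. Poly_Mapping.lookup (m - mb) v + Poly_Mapping.lookup mb v) = Poly_Mapping.lookup m"
              by (simp only: lookup_add[symmetric] madd)
            ultimately show ?thesis by simp
          qed
        qed
        have "f - q \<in> ?A"
        proof (cases "f - q = 0")
          case True
          then show ?thesis using A'(2) by simp
        next
          case ne: False
          have "f - q \<in> polys (set vs)" using fqJ J'(1) vs by blast
          then obtain k where k: "lead vs (f - q) k" using ex_lead ne by blast
          then have "(Poly_Mapping.lookup k, Poly_Mapping.lookup m) \<in> {(a, b). lex_less vs a b}"
            using small by (simp add: lead_def)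
          then show ?thesis using 1(1)[of k "f - q"] fqJ k by blast
        qed
        moreover have "q \<in> ?A"
          unfolding q_def using genideal_self[OF PV] b(1) sp by (intro A'(4)) auto
        ultimately have "(f - q) + q \<in> ?A" by (rule A'(3))
        then show ?thesis by simp
      qed
    qed
    have "J \<subseteq> ?A"
    proof
      fix f assume f: "f \<in> J"
      have "\<exists>m. f \<noteq> 0 \<longrightarrow> lead vs f m" using f J'(1) ex_lead[of f vs] vs by blast
      then show "f \<in> ?A" using main f by blast
    qed
    moreover have "?A \<subseteq> J" by (rule genideal_minimal[OF J PJ])
    ultimately have "J = ?A" by blast
    then show "\<exists>A\<subseteq>carrier (polynomial_ring K V). finite A \<and> J = Idl\<^bsub>polynomial_ring K V\<^esub> A"
      using PV B(2) by blast
  qed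
qed

section \<open>Linear dependence over the coefficient field\<close>

abbreviation kspan :: "('v, 'k::field) mpoly set \<Rightarrow> ('v, 'k) mpoly set" where
  "kspan \<equiv> Modules.module.span (\<lambda>(c::'k) p. coeff_poly c * p)"

lemma vector_space_mpoly: "vector_space (\<lambda>(c::'k::field) (p :: ('v, 'k) mpoly). coeff_poly c * p)"
proof
  fix a b :: 'k and x y :: "('v, 'k) mpoly"
  have "coeff_poly (a + b) = (coeff_poly a + coeff_poly b :: ('v, 'k) mpoly)" by (rule single_add)
  then show "coeff_poly (a + b) * x = coeff_poly a * x + coeff_poly b * x" by (simp add: distrib_right)
  have "coeff_poly (a * b) = (coeff_poly a * coeff_poly b :: ('v, 'k) mpoly)" by (simp add: mult_single)
  then show "coeff_poly a * (coeff_poly b * x) = coeff_poly (a * b) * x" by (simp add: mult.assoc)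
qed (simp_all add: distrib_left)

lemma module_mpoly: "Modules.module (\<lambda>(c::'k::field) (p :: ('v, 'k) mpoly). coeff_poly c * p)"
  using vector_space_mpoly by (simp only: module_iff_vector_space)

lemmas kspan_base = Modules.module.span_base[OF module_mpoly]
  and kspan_0 = Modules.module.span_zero[OF module_mpoly]
  and kspan_add = Modules.module.span_add[OF module_mpoly]
  and kspan_scale = Modules.module.span_scale[OF module_mpoly]
  and kspan_sum = Modules.module.span_sum[OF module_mpoly]
  and kspan_induct = Modules.module.span_induct_alt[OF module_mpoly, consumes 1, case_names base step]

text \<open>Formulated for families, because a repetition \<open>y i = y j\<close> is also a
  relation and would be lost in the set of values; there the coefficients 1 and -1 do.\<close>

lemma kspan_family_dependent:
  fixes y :: "'i \<Rightarrow> ('v, 'k::field) mpoly"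
  assumes I: "finite I" and T: "finite T" and card: "card T < card I"
    and y: "\<And>i. i \<in> I \<Longrightarrow> y i \<in> kspan T"
  shows "\<exists>c. (\<exists>i\<in>I. c i \<noteq> 0) \<and> (\<Sum>i\<in>I. coeff_poly (c i) * y i) = 0"
proof (cases "inj_on y I")
  case True
  have "card (y ` I) = card I" using True by (rule card_image)
  then have "Modules.module.dependent (\<lambda>(c::'k) p. coeff_poly c * p) (y ` I)"
    using vector_space.independent_span_bound[OF vector_space_mpoly T, of "y ` I"] y card by fastforce
  then obtain u where u: "\<exists>v\<in>y ` I. u v \<noteq> 0" "(\<Sum>v\<in>y ` I. coeff_poly (u v) * v) = 0"
    using Modules.module.dependent_finite[OF module_mpoly, of "y ` I"] I by auto
  have "(\<Sum>i\<in>I. coeff_poly (u (y i)) * y i) = 0" using u(2) True by (simp add: sum.reindex)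
  then show ?thesis using u(1) by (intro exI[of _ "\<lambda>i. u (y i)"]) auto
next
  case False
  then obtain i j where ij: "i \<in> I" "j \<in> I" "i \<noteq> j" "y i = y j" by (auto simp: inj_on_def)
  define c :: "'i \<Rightarrow> 'k" where "c k = (if k = i then 1 else if k = j then - 1 else 0)" for k
  have "(\<Sum>k\<in>I. coeff_poly (c k) * y k) = (\<Sum>k\<in>{i, j}. coeff_poly (c k) * y k)"
    using I ij by (intro sum.mono_neutral_right) (auto simp: c_def)
  also have "\<dots> = 0" using ij by (simp add: c_def single_uminus)
  finally show ?thesis using ij by (intro exI[of _ c]) (auto simp: c_def)
qed

section \<open>Zariski's lemma\<close>

text \<open>Power products of a list of polynomials. Lists allow repeated elements and let the later
  inductions treat one element at a time.\<close>

fun mono_list :: "('v, 'k::comm_ring_1) mpoly list \<Rightarrow> nat list \<Rightarrow> ('v, 'k) mpoly" where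
  "mono_list (x # xs) (k # ks) = x ^ k * mono_list xs ks"
| "mono_list _ _ = 1"

text \<open>
  Elements of the residue field are represented by polynomials, and a subring of the residue field
  by its preimage, which contains \<open>M\<close>.
\<close>
locale residue_field =
  fixes M :: "('v, 'k::field) mpoly set"
  assumes M_0: "0 \<in> M" and M_add: "\<And>p q. p \<in> M \<Longrightarrow> q \<in> M \<Longrightarrow> p + q \<in> M"
    and M_mult: "\<And>p q. p \<in> M \<Longrightarrow> q * p \<in> M"
    and M_proper: "1 \<notin> M" and M_inverse: "\<And>p. p \<notin> M \<Longrightarrow> \<exists>q. p * q - 1 \<in> M"
begin

lemma M_uminus: "p \<in> M \<Longrightarrow> - p \<in> M"
  using M_mult[of p "- 1"] by simp

lemma M_diff: "p \<in> M \<Longrightarrow> q \<in> M \<Longrightarrow> p - q \<in> M"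
  using M_add[of p "- q"] M_uminus by simp

lemma M_mult': "p \<in> M \<Longrightarrow> p * q \<in> M"
  using M_mult[of p q] by (simp add: mult.commute)

definition subalgebra :: "('v, 'k) mpoly set \<Rightarrow> bool" where
  "subalgebra B \<longleftrightarrow> M \<subseteq> B \<and> (\<forall>c. coeff_poly c \<in> B) \<and> (\<forall>p\<in>B. \<forall>q\<in>B. p + q \<in> B \<and> p * q \<in> B)"

lemma subalgebraD:
  assumes "subalgebra B"
  shows "p \<in> M \<Longrightarrow> p \<in> B" "coeff_poly c \<in> B" "p \<in> B \<Longrightarrow> q \<in> B \<Longrightarrow> p + q \<in> B"
    "p \<in> B \<Longrightarrow> q \<in> B \<Longrightarrow> p * q \<in> B" "0 \<in> B" "1 \<in> B"
    "p \<in> B \<Longrightarrow> - p \<in> B" "p \<in> B \<Longrightarrow> q \<in> B \<Longrightarrow> p - q \<in> B"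
proof -
  show M: "p \<in> M \<Longrightarrow> p \<in> B" and c: "coeff_poly c \<in> B" and add: "p \<in> B \<Longrightarrow> q \<in> B \<Longrightarrow> p + q \<in> B"
    and mult: "p \<in> B \<Longrightarrow> q \<in> B \<Longrightarrow> p * q \<in> B" for p q c
    using assms by (auto simp: subalgebra_def)
  show "0 \<in> B" using M M_0 .
  show "1 \<in> B" using c[of 1] by simp
  show um: "- p \<in> B" if "p \<in> B" for p using mult[OF c[of "- 1"] that] by (simp add: single_uminus)
  show "p \<in> B \<Longrightarrow> q \<in> B \<Longrightarrow> p - q \<in> B" using add[of p "- q"] um by simp
qed

lemma subalgebra_power: "subalgebra B \<Longrightarrow> p \<in> B \<Longrightarrow> p ^ n \<in> B"
  by (induction n) (auto intro: subalgebraD)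

inductive_set alg :: "('v, 'k) mpoly set \<Rightarrow> ('v, 'k) mpoly set" for A where
  M: "p \<in> M \<Longrightarrow> p \<in> alg A"
| coeff: "coeff_poly c \<in> alg A"
| gen: "p \<in> A \<Longrightarrow> p \<in> alg A"
| add: "p \<in> alg A \<Longrightarrow> q \<in> alg A \<Longrightarrow> p + q \<in> alg A"
| mult: "p \<in> alg A \<Longrightarrow> q \<in> alg A \<Longrightarrow> p * q \<in> alg A"

lemma subalgebra_alg: "subalgebra (alg A)"
  unfolding subalgebra_def by (auto intro: alg.intros)

lemma alg_minimal: "subalgebra B \<Longrightarrow> A \<subseteq> B \<Longrightarrow> alg A \<subseteq> B"
proof
  fix p assume B: "subalgebra B" "A \<subseteq> B" and p: "p \<in> alg A"
  from p show "p \<in> B"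
    by (induction rule: alg.induct) (use B subalgebraD[OF B(1)] in auto)
qed

text \<open>The \<open>B\<close>-module spanned by the powers of t below \<open>D\<close>. Scalars
  are absorbed in the coefficient b as soon as \<open>B\<close> is a subalgebra, see
  \<open>pspan_scale\<close>.\<close>

inductive_set pspan :: "('v, 'k) mpoly set \<Rightarrow> ('v, 'k) mpoly \<Rightarrow> nat \<Rightarrow> ('v, 'k) mpoly set" for B t D where
  zero: "0 \<in> pspan B t D"
| base: "b \<in> B \<Longrightarrow> j < D \<Longrightarrow> b * t ^ j \<in> pspan B t D"
| add: "p \<in> pspan B t D \<Longrightarrow> q \<in> pspan B t D \<Longrightarrow> p + q \<in> pspan B t D"

lemma pspan_mono: "p \<in> pspan B t D \<Longrightarrow> D \<le> D' \<Longrightarrow> p \<in> pspan B t D'"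
  by (induction rule: pspan.induct) (auto intro: pspan.intros)

lemma pspan_B: "subalgebra B \<Longrightarrow> b \<in> B \<Longrightarrow> 0 < D \<Longrightarrow> b \<in> pspan B t D"
  using pspan.base[of b B 0 D t] by simp

lemma pspan_power: "subalgebra B \<Longrightarrow> j < D \<Longrightarrow> t ^ j \<in> pspan B t D"
  using pspan.base[of 1 B j D t] subalgebraD(6)[of B] by simp

text \<open>Degrees at most \<open>D - 1\<close> and \<open>D' - 1\<close> add up to at most
  \<open>D + D' - 2\<close>, so \<open>E\<close> may be as small as
  \<open>D + D' - 1\<close>.\<close>

lemma pspan_mult:
  assumes B: "subalgebra B" and p: "p \<in> pspan B t D" and q: "q \<in> pspan B t D'" and E: "D + D' \<le> Suc E"
  shows "p * q \<in> pspan B t E"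
  using p
proof (induction rule: pspan.induct)
  case (base b j)
  note b = base
  from q show ?case
  proof (induction rule: pspan.induct)
    case (base c i)
    have "(b * c) * t ^ (j + i) \<in> pspan B t E"
      using b base E subalgebraD(4)[OF B] by (intro pspan.base) auto
    then show ?case by (simp add: power_add ac_simps)
  qed (auto intro: pspan.intros simp: distrib_left)
qed (auto intro: pspan.intros simp: distrib_right)

lemma pspan_scale:
  assumes "subalgebra B" "b \<in> B" "p \<in> pspan B t D"
  shows "b * p \<in> pspan B t D"
  using pspan_mult[OF assms(1) pspan_B[OF assms(1,2), of 1] assms(3), of D] by simp

lemma pspan_uminus:
  assumes "subalgebra B" "p \<in> pspan B t D"
  shows "- p \<in> pspan B t D"
  using pspan_scale[OF assms(1) _ assms(2), of "- 1"] subalgebraD[OF assms(1)] by simp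

lemma pspan_diff:
  assumes "subalgebra B" "p \<in> pspan B t D" "q \<in> pspan B t D"
  shows "p - q \<in> pspan B t D"
  using pspan.add[OF assms(2) pspan_uminus[OF assms(1,3)]] by simp

lemma pspan_sum: "(\<And>i. i \<in> I \<Longrightarrow> f i \<in> pspan B t D) \<Longrightarrow> sum f I \<in> pspan B t D"
  by (induction I rule: infinite_finite_induct) (auto intro: pspan.intros)

lemma pspan_Suc_cases:
  assumes "subalgebra B" "p \<in> pspan B t (Suc r)"
  shows "\<exists>z\<in>pspan B t r. \<exists>b\<in>B. p = z + b * t ^ r"
  using assms(2)
proof (induction rule: pspan.induct)
  case zero
  then show ?case using pspan.zero subalgebraD(5)[OF assms(1)] by (intro bexI[of _ 0]) auto
next
  case (base b j)
  show ?case
  proof (cases "j = r")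
    case True
    then show ?thesis using base pspan.zero by (intro bexI[of _ 0] bexI[of _ b]) auto
  next
    case False
    then have "b * t ^ j \<in> pspan B t r" using base by (intro pspan.base) auto
    then show ?thesis using subalgebraD(5)[OF assms(1)] by (intro bexI[of _ "b * t ^ j"] bexI[of _ 0]) auto
  qed
next
  case (add p q)
  then obtain z b z' b' where *: "z \<in> pspan B t r" "b \<in> B" "p = z + b * t ^ r"
    "z' \<in> pspan B t r" "b' \<in> B" "q = z' + b' * t ^ r" by (elim bexE) (rule that)
  have "p + q = (z + z') + (b + b') * t ^ r" using * by (simp add: algebra_simps)
  then show ?case using * pspan.add subalgebraD(3)[OF assms(1)] by blast
qed

text \<open>
  If \<open>p \<in> B\<close> were a nonunit of \<open>B\<close> but a unit of a finite extension \<open>N = \<Sum> B t\<^sup>j\<close>, then \<open>p N = N\<close>;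
  eliminating the generators one at a time, some \<open>u \<in> 1 + p B\<close> annihilates \<open>N\<close>, as in Nakayama's lemma.
\<close>
lemma unit_in_subalgebra:
  assumes B: "subalgebra B" and p: "p \<in> B"
    and q: "q \<in> pspan B t D" and pq: "p * q - 1 \<in> M"
    and closed: "\<And>x y. x \<in> pspan B t D \<Longrightarrow> y \<in> pspan B t D \<Longrightarrow> x * y \<in> pspan B t D" and D: "0 < D"
  shows "\<exists>b\<in>B. p * b - 1 \<in> M"
proof -
  note B' = subalgebraD[OF B]
  \<comment> \<open>Downward induction on the number r of generators still needed: multiplication by
    some element of 1 + p \<open>B\<close> moves x into the span of the first r powers of t, modulo
    \<open>M\<close>.\<close>
  have "\<forall>x\<in>pspan B t D. \<exists>b\<in>B. \<exists>y\<in>pspan B t r. (1 + p * b) * x - y \<in> M" if "r \<le> D" for r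
    using that
  proof (induction r rule: inc_induct)
    case base
    show ?case
    proof
      fix x assume "x \<in> pspan B t D"
      then show "\<exists>b\<in>B. \<exists>y\<in>pspan B t D. (1 + p * b) * x - y \<in> M"
        using B'(5) M_0 by (intro bexI[of _ 0] bexI[of _ x]) auto
    qed
  next
    case (step r)
    have tr: "t ^ r \<in> pspan B t D" using pspan_power[OF B] step by simp
    then have "q * t ^ r \<in> pspan B t D" using q closed by blast
    then obtain b0 y0 where b0: "b0 \<in> B" "y0 \<in> pspan B t (Suc r)" "(1 + p * b0) * (q * t ^ r) - y0 \<in> M"
      using step.IH by blast
    obtain z0 c0 where z0: "z0 \<in> pspan B t r" "c0 \<in> B" "y0 = z0 + c0 * t ^ r"
      using pspan_Suc_cases[OF B b0(2)] by blast
    \<comment> \<open>Since p q = 1 modulo \<open>M\<close>, p times the expression for q t^r is one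
      for t^r. Collecting the terms in t^r leaves u t^r = p z0, so multiplication by u eliminates
      t^r from any combination.\<close>
    define u where "u = 1 + p * (b0 - c0)"
    have "u * t ^ r - p * z0 =
      p * ((1 + p * b0) * (q * t ^ r) - y0) - ((1 + p * b0) * t ^ r) * (p * q - 1)"
      unfolding u_def z0(3) by (simp add: algebra_simps)
    also have "\<dots> \<in> M" using M_diff M_mult b0(3) pq by blast
    finally have u: "u * t ^ r - p * z0 \<in> M" .
    show ?case
    proof
      fix x assume "x \<in> pspan B t D"
      then obtain b y where b: "b \<in> B" "y \<in> pspan B t (Suc r)" "(1 + p * b) * x - y \<in> M"
        using step.IH by blast
      obtain z c where z: "z \<in> pspan B t r" "c \<in> B" "y = z + c * t ^ r"
        using pspan_Suc_cases[OF B b(2)] by blast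
      \<comment> \<open>The new multiplier is the product u (1 + p b), written as an element of 1 +
        p \<open>B\<close>.\<close>
      have "(1 + p * (b + (b0 - c0) * (1 + p * b))) * x - (u * z + (c * p) * z0) =
        u * ((1 + p * b) * x - y) + c * (u * t ^ r - p * z0)"
        unfolding u_def z(3) by (simp add: algebra_simps)
      also have "\<dots> \<in> M" using M_add M_mult b(3) u by blast
      finally have "(1 + p * (b + (b0 - c0) * (1 + p * b))) * x - (u * z + (c * p) * z0) \<in> M" .
      moreover have "b + (b0 - c0) * (1 + p * b) \<in> B"
        using b b0 z0 p by (intro B'(3,4,8,6)) auto
      moreover have "u \<in> B" unfolding u_def using b0 z0 p by (intro B'(3,4,8,6)) auto
      then have "u * z + (c * p) * z0 \<in> pspan B t r"
        using z z0 p by (intro pspan.add pspan_scale[OF B] B'(4)) auto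
      ultimately show "\<exists>b\<in>B. \<exists>y\<in>pspan B t r. (1 + p * b) * x - y \<in> M" by blast
    qed
  qed
  \<comment> \<open>With x = 1 and no generators left, 1 + p b itself lies in \<open>M\<close>, so
    -b inverts p.\<close>
  from this[of 0] have "\<exists>b\<in>B. \<exists>y\<in>pspan B t 0. (1 + p * b) * 1 - y \<in> M"
    using pspan_B[OF B B'(6) D, of t] by blast
  then obtain b y where b: "b \<in> B" "y \<in> pspan B t 0" "(1 + p * b) * 1 - y \<in> M" by blast
  have "y = 0" using b(2) by (induction rule: pspan.induct) auto
  then have "- ((1 + p * b) * 1 - y) \<in> M" using b(3) M_uminus by blast
  moreover have "- ((1 + p * b) * 1 - y) = p * (- b) - 1" using \<open>y = 0\<close> by simp
  ultimately show ?thesis using B'(7)[OF b(1)] by metis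
qed

definition monic_over :: "('v, 'k) mpoly set \<Rightarrow> ('v, 'k) mpoly \<Rightarrow> nat \<Rightarrow> ('v, 'k) mpoly \<Rightarrow> bool" where
  "monic_over B t D p \<longleftrightarrow> p - t ^ D \<in> pspan B t D"

lemma monic_over_mult:
  assumes B: "subalgebra B" and p: "monic_over B t D p" and q: "monic_over B t D' q"
  shows "monic_over B t (D + D') (p * q)"
proof -
  have "p * q - t ^ (D + D') = (p - t ^ D) * (q - t ^ D') + ((p - t ^ D) * t ^ D' + (q - t ^ D') * t ^ D)"
    by (simp add: algebra_simps power_add)
  also have "\<dots> \<in> pspan B t (D + D')"
  proof (intro pspan.add)
    show "(p - t ^ D) * (q - t ^ D') \<in> pspan B t (D + D')"
      using p q by (intro pspan_mult[OF B, of _ _ D _ D']) (auto simp: monic_over_def)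
    show "(p - t ^ D) * t ^ D' \<in> pspan B t (D + D')"
      using p by (intro pspan_mult[OF B, of _ _ D _ "Suc D'"] pspan_power[OF B]) (auto simp: monic_over_def)
    show "(q - t ^ D') * t ^ D \<in> pspan B t (D + D')"
      using q by (intro pspan_mult[OF B, of _ _ D' _ "Suc D"] pspan_power[OF B]) (auto simp: monic_over_def)
  qed
  finally show ?thesis by (simp add: monic_over_def)
qed

lemma monic_over_power:
  assumes B: "subalgebra B" and p: "monic_over B t D p"
  shows "monic_over B t (D * n) (p ^ n)"
proof (induction n)
  case 0
  then show ?case by (simp add: monic_over_def pspan.zero)
next
  case (Suc n)
  then show ?case using monic_over_mult[OF B p Suc] by simp
qed

section \<open>Noether's substitution\<close>

fun digits_val :: "nat \<Rightarrow> nat list \<Rightarrow> nat" where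
  "digits_val e [] = 0"
| "digits_val e (k # ks) = k + e * digits_val e ks"

text \<open>Counting positions from 0, the element at position i loses t to the power w e^i. Over an
  algebra containing the shifted elements, the original one is thus monic in t of that
  degree.\<close>

fun shift_list :: "('v, 'k) mpoly \<Rightarrow> nat \<Rightarrow> nat \<Rightarrow> ('v, 'k) mpoly list \<Rightarrow> ('v, 'k) mpoly list" where
  "shift_list t e w [] = []"
| "shift_list t e w (x # xs) = (x - t ^ w) # shift_list t e (w * e) xs"

lemma length_shift_list [simp]: "length (shift_list t e w xs) = length xs"
  by (induction xs arbitrary: w) auto

lemma digits_val_inj:
  "length ks = length ls \<Longrightarrow> \<forall>k\<in>set ks. k < e \<Longrightarrow> \<forall>l\<in>set ls. l < e \<Longrightarrow>
    digits_val e ks = digits_val e ls \<Longrightarrow> ks = ls"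
proof (induction ks ls rule: list_induct2)
  case (Cons k ks l ls)
  have "(k + e * digits_val e ks) mod e = (l + e * digits_val e ls) mod e" using Cons.prems(3) by simp
  then have "k = l" using Cons.prems(1,2) by simp
  moreover have "e * digits_val e ks = e * digits_val e ls" using Cons.prems(3) \<open>k = l\<close> by simp
  moreover have "e > 0" using Cons.prems(1) by auto
  ultimately show ?case using Cons by simp
qed simp

text \<open>The first element is t^w plus an element of \<open>B\<close>, hence monic of degree w,
  and the weights of the following ones grow by the factor e. Degrees add, so the total is w times
  the exponent list read as a number in base e, lowest digit first.\<close>

lemma monic_over_mono_list:
  assumes B: "subalgebra B" and "set (shift_list t e w xs) \<subseteq> B" "length ks = length xs" "0 < w" "0 < e"
  shows "monic_over B t (w * digits_val e ks) (mono_list xs ks)"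
  using assms(2-4)
proof (induction xs ks arbitrary: w rule: mono_list.induct)
  case (1 x xs k ks)
  have "x - t ^ w \<in> pspan B t w" using 1 by (intro pspan_B[OF B]) auto
  then have "monic_over B t w x" by (simp add: monic_over_def)
  then have "monic_over B t (w * k) (x ^ k)" by (rule monic_over_power[OF B])
  moreover have "monic_over B t ((w * e) * digits_val e ks) (mono_list xs ks)"
    using 1 assms(5) by (intro 1(1)) auto
  ultimately have "monic_over B t (w * k + (w * e) * digits_val e ks) (x ^ k * mono_list xs ks)"
    by (rule monic_over_mult[OF B])
  then show ?case by (simp add: algebra_simps)
qed (auto simp: monic_over_def pspan.zero)

lemma mono_list_mult:
  "length ks = length xs \<Longrightarrow> length ls = length xs \<Longrightarrow>
    \<exists>ms. length ms = length xs \<and> mono_list xs ks * mono_list xs ls = mono_list xs ms"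
proof (induction xs arbitrary: ks ls)
  case (Cons x xs)
  then obtain k ks' l ls' where kl: "ks = k # ks'" "ls = l # ls'" by (metis length_Suc_conv)
  then obtain ms where ms: "length ms = length xs" "mono_list xs ks' * mono_list xs ls' = mono_list xs ms"
    using Cons by auto
  have "mono_list (x # xs) ks * mono_list (x # xs) ls = x ^ (k + l) * (mono_list xs ks' * mono_list xs ls')"
    by (simp add: kl power_add ac_simps)
  then have "mono_list (x # xs) ks * mono_list (x # xs) ls = mono_list (x # xs) ((k + l) # ms)"
    by (simp add: ms)
  then show ?case using ms(1) by (intro exI[of _ "(k + l) # ms"]) simp
qed simp

lemma mono_list_1: "mono_list xs (replicate (length xs) 0) = 1"
  by (induction xs) auto

lemma mono_list_gen: "x \<in> set xs \<Longrightarrow> \<exists>ks. length ks = length xs \<and> mono_list xs ks = x"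
proof (induction xs)
  case (Cons y xs)
  show ?case
  proof (cases "x = y")
    case True
    then show ?thesis using mono_list_1[of xs] by (intro exI[of _ "1 # replicate (length xs) 0"]) simp
  next
    case False
    then obtain ks where "length ks = length xs" "mono_list xs ks = x" using Cons by auto
    then show ?thesis by (intro exI[of _ "0 # ks"]) simp
  qed
qed simp

definition monomials_of :: "('v, 'k) mpoly list \<Rightarrow> ('v, 'k) mpoly set" where
  "monomials_of xs = {mono_list xs ks | ks. length ks = length xs}"

lemma kspan_monos_mult:
  assumes "p \<in> kspan (monomials_of xs)" "q \<in> kspan (monomials_of xs)"
  shows "p * q \<in> kspan (monomials_of xs)"
  using assms(1)
proof (induction rule: kspan_induct)
  case (step c a p)
  from assms(2) have "a * q \<in> kspan (monomials_of xs)"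
  proof (induction rule: kspan_induct)
    case (step d b q)
    have "a * b \<in> monomials_of xs" using mono_list_mult \<open>a \<in> monomials_of xs\<close> step.hyps by (fastforce simp: monomials_of_def)
    then have "coeff_poly d * (a * b) + a * q \<in> kspan (monomials_of xs)"
      by (intro kspan_add[OF kspan_scale[OF kspan_base]] step.IH)
    then show ?case by (simp add: algebra_simps)
  qed (simp add: kspan_0)
  then have "coeff_poly c * (a * q) + p * q \<in> kspan (monomials_of xs)"
    using step.IH by (intro kspan_add kspan_scale)
  then show ?case by (simp add: algebra_simps)
qed (simp add: kspan_0)

lemma alg_kspan_monos:
  assumes "p \<in> alg (set xs)"
  shows "\<exists>q\<in>kspan (monomials_of xs). p - q \<in> M"
  using assms
proof (induction rule: alg.induct)
  case (M p)
  then show ?case by (intro bexI[of _ 0] kspan_0) simp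
next
  case (coeff c)
  have "1 \<in> monomials_of xs" using mono_list_1[of xs] by (auto simp: monomials_of_def intro!: exI[of _ "replicate (length xs) 0"])
  then have "coeff_poly c * 1 \<in> kspan (monomials_of xs)" by (intro kspan_scale kspan_base)
  then show ?case using M_0 by (intro bexI[of _ "coeff_poly c"]) simp_all
next
  case (gen p)
  then have "p \<in> monomials_of xs" using mono_list_gen[of p xs] by (auto simp: monomials_of_def)
  then show ?case using M_0 by (intro bexI[of _ p] kspan_base) simp_all
next
  case (add p q)
  then obtain p' q' where *: "p' \<in> kspan (monomials_of xs)" "p - p' \<in> M" "q' \<in> kspan (monomials_of xs)" "q - q' \<in> M" by blast
  have "(p + q) - (p' + q') = (p - p') + (q - q')" by simp
  also have "\<dots> \<in> M" using * by (intro M_add)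
  finally show ?case using * kspan_add by blast
next
  case (mult p q)
  then obtain p' q' where *: "p' \<in> kspan (monomials_of xs)" "p - p' \<in> M" "q' \<in> kspan (monomials_of xs)" "q - q' \<in> M" by blast
  have "p * q - p' * q' = q * (p - p') + p' * (q - q')" by (simp add: algebra_simps)
  also have "\<dots> \<in> M" using * by (intro M_add M_mult)
  finally show ?case using * kspan_monos_mult by blast
qed

lemma shift_list_mem:
  assumes "subalgebra B" "t \<in> B"
  shows "set (shift_list t e w xs) \<subseteq> B \<longleftrightarrow> set xs \<subseteq> B"
proof (induction xs arbitrary: w)
  case (Cons x xs)
  have tw: "t ^ w \<in> B" using subalgebra_power[OF assms] .
  have "x - t ^ w \<in> B \<longleftrightarrow> x \<in> B"
    using subalgebraD(3)[OF assms(1) _ tw, of "x - t ^ w"] subalgebraD(8)[OF assms(1) _ tw, of x] by auto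
  then show ?case using Cons by simp
qed simp

lemma alg_shift_list: "alg (insert t (set (shift_list t e w xs))) = alg (insert t (set xs))"
proof
  have t: "t \<in> alg (insert t A)" for A by (rule alg.gen) simp
  have "set xs \<subseteq> alg (insert t (set xs))" by (auto intro: alg.gen)
  then have "set (shift_list t e w xs) \<subseteq> alg (insert t (set xs))"
    using shift_list_mem[OF subalgebra_alg t] by blast
  then show "alg (insert t (set (shift_list t e w xs))) \<subseteq> alg (insert t (set xs))"
    using t by (intro alg_minimal[OF subalgebra_alg]) simp
  have "set (shift_list t e w xs) \<subseteq> alg (insert t (set (shift_list t e w xs)))" by (auto intro: alg.gen)
  then have "set xs \<subseteq> alg (insert t (set (shift_list t e w xs)))"
    using shift_list_mem[OF subalgebra_alg t] by blast
  then show "alg (insert t (set xs)) \<subseteq> alg (insert t (set (shift_list t e w xs)))"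
    using t by (intro alg_minimal[OF subalgebra_alg]) simp
qed

text \<open>
  Noether's substitution: with weights \<open>e\<^sup>i\<close> the monomials of an inverse of \<open>t\<close> acquire distinct
  degrees in \<open>t\<close>, so \<open>t \<cdot> t\<^sup>-\<^sup>1 = 1\<close> becomes an integral equation for \<open>t\<close>.
\<close>
lemma exists_integral_shift:
  assumes y: "y \<in> alg (set (t # xs))" and ty: "t * y - 1 \<in> M"
  shows "\<exists>zs D. length zs = length xs \<and> alg (insert t (set zs)) = alg (set (t # xs)) \<and>
    t ^ D \<in> pspan (alg (set zs)) t D"
proof -
  obtain y' where y': "y' \<in> kspan (monomials_of (t # xs))" "y - y' \<in> M" using alg_kspan_monos[OF y] by blast
  obtain S r where S: "finite S" "S \<subseteq> monomials_of (t # xs)" "y' = (\<Sum>v\<in>S. coeff_poly (r v) * v)"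
    using y'(1) unfolding Modules.module.span_explicit[OF module_mpoly] by blast
  have "\<forall>v\<in>S. \<exists>ks. length ks = length (t # xs) \<and> mono_list (t # xs) ks = v" using S(2) by (auto simp: monomials_of_def)
  then obtain ks where ks: "\<And>v. v \<in> S \<Longrightarrow> length (ks v) = length (t # xs) \<and> mono_list (t # xs) (ks v) = v" by metis
  have "finite (\<Union>v\<in>S. set (ks v))" using S(1) by simp
  then obtain e where e: "\<And>k v. v \<in> S \<Longrightarrow> k \<in> set (ks v) \<Longrightarrow> k < e"
    using finite_nat_set_iff_bounded[of "\<Union>v\<in>S. set (ks v)"] by auto
  \<comment> \<open>The element t itself has weight 1, so the weights of \<open>xs\<close> start
    with the base. All exponents lie below e; the base \<open>Suc e\<close> is positive even if e =
    0.\<close>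
  define zs where "zs = shift_list t (Suc e) (Suc e) xs"
  let ?B = "alg (set zs)"
  have B: "subalgebra ?B" by (rule subalgebra_alg)
  define deg where "deg v = digits_val (Suc e) (ks v)" for v
  have deg_inj: "inj_on deg S"
  proof (rule inj_onI)
    fix v v' assume *: "v \<in> S" "v' \<in> S" "deg v = deg v'"
    have "ks v = ks v'"
      using * ks e by (intro digits_val_inj[of _ _ "Suc e"]) (auto simp: deg_def less_Suc_eq)
    then show "v = v'" using ks * by metis
  qed
  have monic: "monic_over ?B t (Suc (deg v)) (t * v)" if v: "v \<in> S" for v
  proof -
    obtain k ls where kl: "ks v = k # ls" "length ls = length xs" using ks[OF v] by (cases "ks v") auto
    have "monic_over ?B t (Suc e * digits_val (Suc e) ls) (mono_list xs ls)"
      using kl(2) by (intro monic_over_mono_list[OF B]) (auto simp: zs_def intro: alg.gen)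
    moreover have t1: "monic_over ?B t (1 * Suc k) (t ^ Suc k)"
      by (intro monic_over_power[OF B]) (simp add: monic_over_def pspan.zero)
    ultimately have "monic_over ?B t (1 * Suc k + Suc e * digits_val (Suc e) ls) (t ^ Suc k * mono_list xs ls)"
      using monic_over_mult[OF B t1] by blast
    moreover have "t ^ Suc k * mono_list xs ls = t * v" using ks[OF v] kl by (auto simp: ac_simps)
    ultimately show ?thesis by (simp add: deg_def kl)
  qed
  have ty': "t * y' - 1 \<in> M"
    using M_diff[OF ty M_mult[OF y'(2), of t]] by (simp add: algebra_simps)
  \<comment> \<open>Only terms with nonzero coefficient count for the top degree. There is one,
    because otherwise -1 would lie in \<open>M\<close>.\<close>
  define S' where "S' = {v \<in> S. r v \<noteq> 0}"
  have y'S': "y' = (\<Sum>v\<in>S'. coeff_poly (r v) * v)"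
    unfolding S(3) S'_def using S(1) by (intro sum.mono_neutral_right) auto
  have "S' \<noteq> {}"
  proof
    assume "S' = {}"
    then have "- (t * y' - 1) = 1" using y'S' by simp
    then show False using M_uminus[OF ty'] M_proper by simp
  qed
  moreover have finS': "finite S'" using S(1) by (simp add: S'_def)
  ultimately obtain m where m: "m \<in> S'" "\<And>v. v \<in> S' \<Longrightarrow> deg v \<le> deg m"
    using Max_in[of "deg ` S'"] Max_ge[of "deg ` S'"] by (metis (no_types, lifting) empty_is_image finite_imageI imageE imageI)
  let ?D = "Suc (deg m)"
  have mS: "m \<in> S" "r m \<noteq> 0" using m(1) by (auto simp: S'_def)
  have low: "coeff_poly (r v) * (t * v) \<in> pspan ?B t ?D" if v: "v \<in> S' - {m}" for v
  proof -
    have vS: "v \<in> S" using v by (simp add: S'_def)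
    have "deg v \<noteq> deg m" using inj_onD[OF deg_inj, of v m] vS mS v by auto
    then have lt: "Suc (deg v) < ?D" using m(2)[of v] v by simp
    have "t * v - t ^ Suc (deg v) \<in> pspan ?B t (Suc (deg v))"
      using monic[OF vS] unfolding monic_over_def .
    then have "t * v - t ^ Suc (deg v) \<in> pspan ?B t ?D" using less_imp_le[OF lt] by (rule pspan_mono)
    then have "(t * v - t ^ Suc (deg v)) + t ^ Suc (deg v) \<in> pspan ?B t ?D"
      using pspan_power[OF B lt] by (rule pspan.add)
    then have "t * v \<in> pspan ?B t ?D" by (simp only: diff_add_cancel)
    then show ?thesis by (rule pspan_scale[OF B subalgebraD(2)[OF B]])
  qed
  \<comment> \<open>The degrees are distinct, so exactly one term reaches degree \<open>?D\<close>;
    the relation is solved for its leading power of t.\<close>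
  have "t * y' = coeff_poly (r m) * (t * m) + (\<Sum>v\<in>S' - {m}. coeff_poly (r v) * (t * v))"
    unfolding y'S' sum_distrib_left using finS' m(1) by (subst sum.remove[of _ m]) (auto simp: ac_simps)
  then have "coeff_poly (r m) * t ^ ?D =
    (1 + (t * y' - 1)) - (\<Sum>v\<in>S' - {m}. coeff_poly (r v) * (t * v)) - coeff_poly (r m) * (t * m - t ^ ?D)"
    by (simp add: algebra_simps)
  also have "\<dots> \<in> pspan ?B t ?D"
  proof (intro pspan_diff[OF B])
    show "1 + (t * y' - 1) \<in> pspan ?B t ?D"
      using subalgebraD(6)[OF B] subalgebraD(1)[OF B ty'] by (intro pspan.add pspan_B[OF B]) auto
    show "(\<Sum>v\<in>S' - {m}. coeff_poly (r v) * (t * v)) \<in> pspan ?B t ?D"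
      using low by (rule pspan_sum)
    show "coeff_poly (r m) * (t * m - t ^ ?D) \<in> pspan ?B t ?D"
      using monic[OF mS(1)] by (intro pspan_scale[OF B] subalgebraD(2)[OF B]) (simp add: monic_over_def)
  qed
  finally have "coeff_poly (inverse (r m)) * (coeff_poly (r m) * t ^ ?D) \<in> pspan ?B t ?D"
    by (rule pspan_scale[OF B subalgebraD(2)[OF B]])
  moreover have "coeff_poly (inverse (r m)) * (coeff_poly (r m) * t ^ ?D) = t ^ ?D"
    using mS(2) by (simp add: mult.assoc[symmetric] mult_single)
  ultimately have "t ^ ?D \<in> pspan ?B t ?D" by simp
  moreover have "length zs = length xs" by (simp add: zs_def)
  moreover have "alg (insert t (set zs)) = alg (set (t # xs))" by (simp add: zs_def alg_shift_list)
  ultimately show ?thesis by blast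
qed

text \<open>The integral equation for t reduces all higher powers, so the span is closed under
  products and swallows the algebra generated by t and \<open>A\<close>. For D = 0 the span would be
  zero and the equation would read 1 = 0, against \<open>M_proper\<close>.\<close>

lemma alg_eq_pspan:
  assumes B: "subalgebra B" and A: "A \<subseteq> B" and D: "t ^ D \<in> pspan B t D"
  shows "alg (insert t A) \<subseteq> pspan B t D"
    and "\<And>x y. x \<in> pspan B t D \<Longrightarrow> y \<in> pspan B t D \<Longrightarrow> x * y \<in> pspan B t D"
    and "0 < D"
proof -
  show D0: "0 < D"
  proof (rule ccontr)
    assume "\<not> 0 < D"
    then have "1 \<in> pspan B t 0" using D by simp
    moreover have "p = 0" if "p \<in> pspan B t 0" for p using that by (induction rule: pspan.induct) auto
    ultimately show False using M_0 M_proper by metis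
  qed
  have red: "x \<in> pspan B t D" if "x \<in> pspan B t (D + n)" for x n
    using that
  proof (induction n arbitrary: x)
    case (Suc n)
    then obtain z b where z: "z \<in> pspan B t (D + n)" "b \<in> B" "x = z + b * t ^ (D + n)"
      using pspan_Suc_cases[OF B, of x t "D + n"] by auto
    have "t ^ D * t ^ n \<in> pspan B t (D + n)"
      by (rule pspan_mult[OF B D pspan_power[OF B, of n "Suc n"]]) auto
    then have "b * t ^ (D + n) \<in> pspan B t (D + n)" using pspan_scale[OF B z(2)] by (simp add: power_add)
    then have "x \<in> pspan B t (D + n)" unfolding z(3) using z(1) by (intro pspan.add)
    then show ?case by (rule Suc.IH)
  qed simp
  show mult: "x * y \<in> pspan B t D" if "x \<in> pspan B t D" "y \<in> pspan B t D" for x y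
    using red[of "x * y" D] pspan_mult[OF B that, of "D + D"] by simp
  show "alg (insert t A) \<subseteq> pspan B t D"
  proof
    fix p assume "p \<in> alg (insert t A)"
    then show "p \<in> pspan B t D"
    proof (induction rule: alg.induct)
      case (gen p)
      have "t \<in> pspan B t D"
        using red[of t 1] pspan_power[OF B, of 1 "D + 1" t] D0 by simp
      then show ?case using gen A pspan_B[OF B _ D0] by auto
    qed (auto intro: mult pspan.add pspan_B[OF B _ D0] subalgebraD[OF B])
  qed
qed

text \<open>Induction on the number of generators. If the algebra on \<open>xs\<close> is a field
  modulo \<open>M\<close>, one generator t is integral over an algebra with one generator fewer.
  That algebra is a field by \<open>unit_in_subalgebra\<close>, hence finite over \<open>K\<close>,
  and the powers of t below D enlarge its finite spanning set to one for the whole.\<close>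

lemma zariski_lemma_list:
  assumes "\<forall>p\<in>alg (set xs). p \<notin> M \<longrightarrow> (\<exists>q\<in>alg (set xs). p * q - 1 \<in> M)"
  shows "\<exists>T. finite T \<and> (\<forall>p\<in>alg (set xs). \<exists>q\<in>kspan T. p - q \<in> M)"
  using assms
proof (induction "length xs" arbitrary: xs)
  case 0
  have "monomials_of xs = {1}" using 0 by (auto simp: monomials_of_def)
  then show ?case using alg_kspan_monos[of _ xs] by (intro exI[of _ "{1}"]) auto
next
  case (Suc n)
  then obtain t ys where xs: "xs = t # ys" by (cases xs) auto
  have "\<exists>zs D. length zs = length ys \<and> alg (insert t (set zs)) = alg (set xs) \<and> t ^ D \<in> pspan (alg (set zs)) t D"
  proof (cases "t \<in> M")
    case True
    \<comment> \<open>Here t vanishes in the residue field and has no inverse to substitute into,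
      but it already belongs to the algebra of the remaining generators.\<close>
    then have "t ^ 1 \<in> pspan (alg (set ys)) t 1"
      by (intro pspan_B[OF subalgebra_alg]) (auto intro: alg.M)
    then show ?thesis using xs by (intro exI[of _ ys] exI[of _ "1::nat"]) simp
  next
    case False
    have "t \<in> alg (set xs)" using xs by (intro alg.gen) simp
    then obtain y where "y \<in> alg (set xs)" "t * y - 1 \<in> M" using Suc.prems False by blast
    then show ?thesis using exists_integral_shift[of y t ys] xs by simp
  qed
  then obtain zs D where zs: "length zs = length ys" "alg (insert t (set zs)) = alg (set xs)"
    "t ^ D \<in> pspan (alg (set zs)) t D" by (elim exE conjE) (rule that)
  let ?B = "alg (set zs)"
  have B: "subalgebra ?B" by (rule subalgebra_alg)
  have "set zs \<subseteq> ?B" by (auto intro: alg.gen)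
  note L = alg_eq_pspan[OF B this zs(3), unfolded zs(2)]
  have BL: "?B \<subseteq> alg (set xs)" unfolding zs(2)[symmetric] by (intro alg_minimal[OF subalgebra_alg]) (auto intro: alg.gen)
  have "\<forall>p\<in>?B. p \<notin> M \<longrightarrow> (\<exists>q\<in>?B. p * q - 1 \<in> M)"
  proof (intro ballI impI)
    fix p assume p: "p \<in> ?B" "p \<notin> M"
    then obtain q where "q \<in> alg (set xs)" "p * q - 1 \<in> M" using Suc.prems BL by blast
    then show "\<exists>q\<in>?B. p * q - 1 \<in> M" using unit_in_subalgebra[OF B p(1) _ _ L(2,3)] L(1) by blast
  qed
  moreover have "n = length zs" using Suc.hyps(2) xs zs(1) by simp
  ultimately obtain T where T: "finite T" "\<forall>p\<in>?B. \<exists>q\<in>kspan T. p - q \<in> M" using Suc.hyps(1)[of zs] by blast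
  define T' where "T' = (\<lambda>(s, j). s * t ^ j) ` (T \<times> {..<D})"
  have "\<exists>q\<in>kspan T'. p - q \<in> M" if "p \<in> pspan ?B t D" for p
    using that
  proof (induction rule: pspan.induct)
    case zero
    show ?case using M_0 by (intro bexI[of _ 0] kspan_0) simp
  next
    case (base b j)
    then obtain q where q: "q \<in> kspan T" "b - q \<in> M" using T(2) by blast
    have "q * t ^ j \<in> kspan T'"
      using q(1)
    proof (induction rule: kspan_induct)
      case (step c a p)
      have "a * t ^ j \<in> T'" using step.hyps base.hyps by (auto simp: T'_def)
      then have "coeff_poly c * (a * t ^ j) + p * t ^ j \<in> kspan T'"
        by (intro kspan_add[OF kspan_scale[OF kspan_base]] step.IH)
      then show ?case by (simp add: algebra_simps)
    qed (simp add: kspan_0)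
    moreover have "b * t ^ j - q * t ^ j \<in> M"
      using M_mult'[OF q(2), of "t ^ j"] by (simp add: algebra_simps)
    ultimately show ?case by blast
  next
    case (add p q)
    then obtain p' q' where *: "p' \<in> kspan T'" "p - p' \<in> M" "q' \<in> kspan T'" "q - q' \<in> M" by blast
    have "(p + q) - (p' + q') = (p - p') + (q - q')" by simp
    also have "\<dots> \<in> M" using * by (intro M_add)
    finally show ?case using * kspan_add by blast
  qed
  then have "\<forall>p\<in>alg (set xs). \<exists>q\<in>kspan T'. p - q \<in> M" using L(1) by blast
  moreover have "finite T'" using T(1) by (simp add: T'_def)
  ultimately show ?case by blast
qed

text \<open>The residue field is spanned by a finite set \<open>T\<close>, so the powers of z up to
  \<open>card T\<close> are dependent, and the relation is divided by its last nonzero coefficient.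
  The condition \<open>out\<close> makes finitely many variables generate the residue field even if
  the type has infinitely many.\<close>

theorem zariski_lemma:
  assumes V: "finite V" and out: "\<And>v. v \<notin> V \<Longrightarrow> Var v \<in> M"
  shows "\<exists>e c. z ^ e + (\<Sum>b<e. coeff_poly (c b) * z ^ b) \<in> M"
proof -
  obtain vs where vs: "set vs = V" using finite_list[OF V] by blast
  have all: "p \<in> alg (set (map Var vs))" for p
  proof (induction p rule: poly_induct)
    case zero
    show ?case using M_0 by (rule alg.M)
  next
    case (single m c)
    have v: "Var v \<in> alg (set (map Var vs))" for v
      using out[of v] vs by (cases "v \<in> V") (auto intro: alg.M alg.gen)
    have "(\<Prod>v\<in>A. Var v ^ Poly_Mapping.lookup m v) \<in> alg (set (map Var vs))" for A
    proof (induction A rule: infinite_finite_induct)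
      case (insert x F)
      then show ?case using subalgebra_power[OF subalgebra_alg v] by (simp add: alg.mult)
    qed (simp_all add: subalgebraD(6)[OF subalgebra_alg])
    then have "mon m \<in> alg (set (map Var vs))" by (simp add: mon_eq_prod)
    then have "coeff_poly c * mon m \<in> alg (set (map Var vs))" by (intro alg.mult alg.coeff)
    then show ?case by (simp add: mult_single)
  qed (rule alg.add)
  obtain T where T: "finite T" "\<And>p. \<exists>q\<in>kspan T. p - q \<in> M"
    using zariski_lemma_list[of "map Var vs"] M_inverse all by blast
  have "\<exists>q. q \<in> kspan T \<and> z ^ j - q \<in> M" for j :: nat using T(2)[of "z ^ j"] by (elim bexE) (intro exI conjI)
  then have "\<forall>j :: nat. \<exists>q. q \<in> kspan T \<and> z ^ j - q \<in> M" by (rule allI)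
  from choice[OF this] obtain y where y: "\<forall>j. y j \<in> kspan T \<and> z ^ j - y j \<in> M" by (elim exE) (rule that)
  have "\<exists>c. (\<exists>i\<in>{..card T}. c i \<noteq> 0) \<and> (\<Sum>i\<in>{..card T}. coeff_poly (c i) * y i) = 0"
    using y by (intro kspan_family_dependent[OF _ T(1)]) auto
  then obtain c where c: "\<exists>i\<in>{..card T}. c i \<noteq> 0" "(\<Sum>i\<in>{..card T}. coeff_poly (c i) * y i) = 0" by blast
  have "(\<Sum>i\<in>A. coeff_poly (c i) * (z ^ i - y i)) \<in> M" for A
    by (induction A rule: infinite_finite_induct) (use M_0 y in \<open>auto intro!: M_add M_mult\<close>)
  from this[of "{..card T}"] have rel: "(\<Sum>i\<in>{..card T}. coeff_poly (c i) * z ^ i) \<in> M"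
    using c(2) by (simp add: right_diff_distrib sum_subtractf)
  define e where "e = Max {i. i \<le> card T \<and> c i \<noteq> 0}"
  have fin: "finite {i. i \<le> card T \<and> c i \<noteq> 0}" by simp
  have "{i. i \<le> card T \<and> c i \<noteq> 0} \<noteq> {}" using c(1) by auto
  from Max_in[OF fin this] have e: "e \<le> card T" "c e \<noteq> 0" unfolding e_def by simp_all
  have top: "c i = 0" if "i \<le> card T" "e < i" for i
  proof (rule ccontr)
    assume "c i \<noteq> 0"
    then have "i \<le> e" unfolding e_def using that by (intro Max_ge) auto
    then show False using that by simp
  qed
  have "(\<Sum>i\<in>{..card T}. coeff_poly (c i) * z ^ i) = (\<Sum>i\<le>e. coeff_poly (c i) * z ^ i)"
    using top e(1) by (intro sum.mono_neutral_right) (auto simp: not_le)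
  then have "coeff_poly (inverse (c e)) * (\<Sum>i\<le>e. coeff_poly (c i) * z ^ i) \<in> M"
    using rel by (intro M_mult) simp
  also have "coeff_poly (inverse (c e)) * (\<Sum>i\<le>e. coeff_poly (c i) * z ^ i) =
    (\<Sum>i\<le>e. coeff_poly (inverse (c e) * c i) * z ^ i)"
    unfolding sum_distrib_left by (intro sum.cong refl) (simp add: mult.assoc[symmetric] mult_single)
  also have "\<dots> = z ^ e + (\<Sum>i<e. coeff_poly (inverse (c e) * c i) * z ^ i)"
    using e(2) by (simp add: lessThan_Suc_atMost[symmetric])
  finally show ?thesis by (intro exI[of _ e] exI[of _ "\<lambda>i. inverse (c e) * c i"])
qed

end

section \<open>The dimension of a monomial quotient\<close>

text \<open>The inclusions are weak; strictness enters through the elements chosen in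
  \<open>no_relation\<close>, one for each step of the chain.\<close>

locale prime_chain =
  fixes P :: "nat \<Rightarrow> ('v, 'k::field) mpoly set" and N :: nat
  assumes P_add: "\<And>i p q. i \<le> N \<Longrightarrow> p \<in> P i \<Longrightarrow> q \<in> P i \<Longrightarrow> p + q \<in> P i"
    and P_mult: "\<And>i p q. i \<le> N \<Longrightarrow> p \<in> P i \<Longrightarrow> q * p \<in> P i"
    and P_one: "\<And>i. i \<le> N \<Longrightarrow> 1 \<notin> P i"
    and P_prime: "\<And>i p q. i \<le> N \<Longrightarrow> p * q \<in> P i \<Longrightarrow> p \<in> P i \<or> q \<in> P i"
    and P_0: "\<And>i. i \<le> N \<Longrightarrow> 0 \<in> P i"
    and P_chain: "\<And>i. i < N \<Longrightarrow> P i \<subseteq> P (Suc i)"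
begin

lemma P_sum: "i \<le> N \<Longrightarrow> (\<And>a. a \<in> A \<Longrightarrow> f a \<in> P i) \<Longrightarrow> sum f A \<in> P i"
  by (induction A rule: infinite_finite_induct) (auto intro: P_0 P_add)

lemma P_diff: "i \<le> N \<Longrightarrow> p \<in> P i \<Longrightarrow> q \<in> P i \<Longrightarrow> p - q \<in> P i"
  using P_add[of i p "(- 1) * q"] P_mult[of i q "- 1"] by simp

lemma P_power: "i \<le> N \<Longrightarrow> p ^ n \<in> P i \<Longrightarrow> p \<in> P i"
  by (induction n) (auto simp: P_one dest: P_prime)

text \<open>
  Among the terms of a polynomial relation, those with the lowest exponent of the first
  element form a relation of the remaining elements one step higher up in the chain.
\<close>
lemma no_relation:
  assumes "i + length fs = N" "\<And>j. j < length fs \<Longrightarrow> fs ! j \<in> P (Suc (i + j)) \<and> fs ! j \<notin> P (i + j)"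
    and "finite A" "A \<noteq> {}" "\<And>a. a \<in> A \<Longrightarrow> length a = length fs" "\<And>a. a \<in> A \<Longrightarrow> c a \<noteq> 0"
  shows "(\<Sum>a\<in>A. coeff_poly (c a) * mono_list fs a) \<notin> P i"
  using assms
proof (induction fs arbitrary: i A c)
  case Nil
  then have "A = {[]}" by auto
  then have "(\<Sum>a\<in>A. coeff_poly (c a) * mono_list [] a) = (coeff_poly (c []) :: ('v, 'k) mpoly)" by simp
  moreover have "coeff_poly (c []) \<notin> P i"
  proof
    assume "coeff_poly (c []) \<in> P i"
    then have "coeff_poly (inverse (c [])) * coeff_poly (c []) \<in> P i" using Nil by (intro P_mult) auto
    moreover have "c [] \<noteq> 0" using Nil.prems(6) \<open>A = {[]}\<close> by simp
    ultimately show False using P_one[of i] Nil.prems(1) by (simp add: mult_single)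
  qed
  ultimately show ?case by simp
next
  case (Cons f fs)
  have iN: "i \<le> N" "Suc i \<le> N" "i < N" using Cons.prems(1) by auto
  have f: "f \<in> P (Suc i)" "f \<notin> P i" using Cons.prems(2)[of 0] by auto
  define h where "h = Min (hd ` A)"
  have h: "h \<in> hd ` A" "\<And>a. a \<in> A \<Longrightarrow> h \<le> hd a"
    using Cons.prems(3,4) by (auto simp: h_def)
  define A0 where "A0 = {a \<in> A. hd a = h}"
  have split: "a = hd a # tl a \<and> length (tl a) = length fs" if "a \<in> A" for a
    using Cons.prems(5)[OF that] by (cases a) auto
  have pl: "mono_list (f # fs) a = f ^ h * (f ^ (hd a - h) * mono_list fs (tl a))" if "a \<in> A" for a
  proof -
    have "mono_list (f # fs) a = f ^ hd a * mono_list fs (tl a)"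
      using split[OF that] by (metis mono_list.simps(1))
    also have "f ^ hd a = f ^ h * f ^ (hd a - h)" using h(2)[OF that] by (simp flip: power_add)
    finally show ?thesis by (simp add: mult.assoc)
  qed
  let ?S = "\<Sum>a\<in>A. coeff_poly (c a) * (f ^ (hd a - h) * mono_list fs (tl a))"
  show ?case
  proof
    assume "(\<Sum>a\<in>A. coeff_poly (c a) * mono_list (f # fs) a) \<in> P i"
    moreover have "(\<Sum>a\<in>A. coeff_poly (c a) * mono_list (f # fs) a) = f ^ h * ?S"
      unfolding sum_distrib_left by (intro sum.cong refl) (simp add: pl ac_simps)
    \<comment> \<open>The common factor f^h can be cancelled because \<open>P i\<close> is prime and
      f lies outside it.\<close>
    ultimately have "?S \<in> P i" using P_prime[OF iN(1), of "f ^ h" ?S] P_power[OF iN(1), of f h] f(2) by auto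
    then have S: "?S \<in> P (Suc i)" using P_chain[OF iN(3)] by blast
    have eqS: "?S = (\<Sum>a\<in>A0. coeff_poly (c a) * (f ^ (hd a - h) * mono_list fs (tl a))) +
      (\<Sum>a\<in>A - A0. coeff_poly (c a) * (f ^ (hd a - h) * mono_list fs (tl a)))"
      using Cons.prems(3) by (intro sum.subset_diff[THEN trans, OF _ _ add.commute]) (auto simp: A0_def)
    have "(\<Sum>a\<in>A - A0. coeff_poly (c a) * (f ^ (hd a - h) * mono_list fs (tl a))) \<in> P (Suc i)"
    proof (rule P_sum[OF iN(2)])
      fix a assume a: "a \<in> A - A0"
      then have "hd a - h = Suc (hd a - h - 1)" using h(2)[of a] by (auto simp: A0_def)
      then have "f ^ (hd a - h) = f ^ (hd a - h - 1) * f" by (metis power_Suc2)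
      then have "coeff_poly (c a) * (f ^ (hd a - h) * mono_list fs (tl a)) =
        (coeff_poly (c a) * f ^ (hd a - h - 1) * mono_list fs (tl a)) * f" by (simp add: ac_simps)
      also have "\<dots> \<in> P (Suc i)" using f(1) by (rule P_mult[OF iN(2)])
      finally show "coeff_poly (c a) * (f ^ (hd a - h) * mono_list fs (tl a)) \<in> P (Suc i)" .
    qed
    from P_diff[OF iN(2) S this] have "(\<Sum>a\<in>A0. coeff_poly (c a) * (f ^ (hd a - h) * mono_list fs (tl a))) \<in> P (Suc i)"
      unfolding eqS by (simp only: add_diff_cancel_right')
    moreover have "(\<Sum>a\<in>A0. coeff_poly (c a) * (f ^ (hd a - h) * mono_list fs (tl a))) =
      (\<Sum>a\<in>A0. coeff_poly (c (h # tl a)) * mono_list fs (tl a))"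
    proof (rule sum.cong)
      fix a assume a: "a \<in> A0"
      then have "h # tl a = a" using split[of a] by (auto simp: A0_def)
      then show "coeff_poly (c a) * (f ^ (hd a - h) * mono_list fs (tl a)) = coeff_poly (c (h # tl a)) * mono_list fs (tl a)"
        using a by (simp add: A0_def)
    qed simp
    moreover have "inj_on tl A0"
      using split by (intro inj_onI) (metis (mono_tags, lifting) A0_def mem_Collect_eq)
    ultimately have "(\<Sum>b\<in>tl ` A0. coeff_poly (c (h # b)) * mono_list fs b) \<in> P (Suc i)"
      by (simp add: sum.reindex)
    moreover have "(\<Sum>b\<in>tl ` A0. coeff_poly (c (h # b)) * mono_list fs b) \<notin> P (Suc i)"
    proof (rule Cons.IH)
      show "Suc i + length fs = N" using Cons.prems(1) by simp
      show "fs ! j \<in> P (Suc (Suc i + j)) \<and> fs ! j \<notin> P (Suc i + j)" if "j < length fs" for j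
        using Cons.prems(2)[of "Suc j"] that by simp
      show "finite (tl ` A0)" using Cons.prems(3) by (simp add: A0_def)
      show "tl ` A0 \<noteq> {}" using h(1) by (auto simp: A0_def)
      show "length b = length fs" if "b \<in> tl ` A0" for b using that split by (auto simp: A0_def)
      show "c (h # b) \<noteq> 0" if b: "b \<in> tl ` A0" for b
      proof -
        obtain a where a: "a \<in> A" "hd a = h" "b = tl a" using b by (auto simp: A0_def)
        then have "h # b = a" using split[of a] by simp
        then show ?thesis using Cons.prems(6) a(1) by simp
      qed
    qed
    ultimately show False by blast
  qed
qed

end

section \<open>Counting the monomials outside the ideal\<close>

definition exp_le :: "nat \<Rightarrow> ('v, 'k::comm_ring_1) mpoly \<Rightarrow> bool" where
  "exp_le D p \<longleftrightarrow> (\<forall>m\<in>Poly_Mapping.keys p. \<forall>v. Poly_Mapping.lookup m v \<le> D)"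

lemma exp_le_mult:
  assumes "exp_le D p" "exp_le D' q"
  shows "exp_le (D + D') (p * q)"
  unfolding exp_le_def
proof (intro ballI allI)
  fix m v assume "m \<in> Poly_Mapping.keys (p * q)"
  then obtain a b where ab: "m = a + b" "a \<in> Poly_Mapping.keys p" "b \<in> Poly_Mapping.keys q"
    using keys_mult[of p q] by blast
  then have "Poly_Mapping.lookup a v \<le> D" "Poly_Mapping.lookup b v \<le> D'" using assms by (auto simp: exp_le_def)
  then show "Poly_Mapping.lookup m v \<le> D + D'" by (simp add: ab(1) lookup_add)
qed

lemma exp_le_1: "exp_le D 1"
  by (auto simp: exp_le_def lookup_one split: if_splits)

lemma exp_le_power: "exp_le D p \<Longrightarrow> exp_le (n * D) (p ^ n)"
proof (induction n)
  case (Suc n)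
  then show ?case using exp_le_mult[of D p "n * D" "p ^ n"] by simp
qed (simp add: exp_le_1)

lemma exp_le_mono: "exp_le D p \<Longrightarrow> D \<le> D' \<Longrightarrow> exp_le D' p"
  by (meson exp_le_def order_trans)

lemma ex_exp_le: "\<exists>D. exp_le D (p :: ('v, 'k::comm_ring_1) mpoly)"
proof -
  let ?X = "\<Union>m\<in>Poly_Mapping.keys p. Poly_Mapping.lookup m ` Poly_Mapping.keys m"
  have fin: "finite ?X" by simp
  have "exp_le (Max (insert 0 ?X)) p"
    unfolding exp_le_def
  proof (intro ballI allI)
    fix m v assume m: "m \<in> Poly_Mapping.keys p"
    have "Poly_Mapping.lookup m v \<in> insert 0 ?X"
    proof (cases "v \<in> Poly_Mapping.keys m")
      case False
      then show ?thesis by (simp add: in_keys_iff)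
    qed (use m in blast)
    then show "Poly_Mapping.lookup m v \<le> Max (insert 0 ?X)" using fin by (intro Max_ge) auto
  qed
  then show ?thesis by blast
qed

text \<open>Bounding every exponent separately, instead of the total degree, makes the exponent
  vectors a box, which is counted as a set of functions.\<close>

lemma card_bounded_exps:
  assumes V: "finite V"
  shows "finite {m :: 'v \<Rightarrow>\<^sub>0 nat. Poly_Mapping.keys m \<subseteq> V \<and> (\<forall>v. Poly_Mapping.lookup m v \<le> D)}"
    and "card {m :: 'v \<Rightarrow>\<^sub>0 nat. Poly_Mapping.keys m \<subseteq> V \<and> (\<forall>v. Poly_Mapping.lookup m v \<le> D)} \<le> Suc D ^ card V"
proof -
  let ?S = "{m :: 'v \<Rightarrow>\<^sub>0 nat. Poly_Mapping.keys m \<subseteq> V \<and> (\<forall>v. Poly_Mapping.lookup m v \<le> D)}"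
  let ?F = "V \<rightarrow>\<^sub>E {..D}"
  have inj: "inj_on (\<lambda>m. restrict (Poly_Mapping.lookup m) V) ?S"
  proof (rule inj_onI)
    fix a b assume ab: "a \<in> ?S" "b \<in> ?S" "restrict (Poly_Mapping.lookup a) V = restrict (Poly_Mapping.lookup b) V"
    show "a = b"
    proof (rule poly_mapping_eqI)
      fix v show "Poly_Mapping.lookup a v = Poly_Mapping.lookup b v"
      proof (cases "v \<in> V")
        case True
        then show ?thesis using fun_cong[OF ab(3), of v] by simp
      next
        case False
        then show ?thesis using ab(1,2) lookup_eq_0_outside[of a V v] lookup_eq_0_outside[of b V v] by simp
      qed
    qed
  qed
  have sub: "(\<lambda>m. restrict (Poly_Mapping.lookup m) V) ` ?S \<subseteq> ?F" by auto
  have fin: "finite ?F" using V by (intro finite_PiE) auto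
  show "finite ?S" using inj_on_finite[OF inj sub fin] .
  have "card ?S \<le> card ?F" by (rule card_inj_on_le[OF inj sub fin])
  then show "card ?S \<le> Suc D ^ card V" using V by (simp add: card_PiE)
qed

text \<open>
  The monomials outside the ideal with exponents at most \<open>D\<close> number \<open>O(D\<^sup>N)\<close>, while there are
  \<open>(D + 1)\<^sup>N\<^sup>+\<^sup>1\<close> power products of \<open>N + 1\<close> given elements with exponents at most \<open>D\<close>.
\<close>
lemma algebraic_dependence:
  fixes fs :: "('v, 'k::field) mpoly list"
  assumes V: "finite V" and E: "\<And>e. e \<in> E \<Longrightarrow> e \<subseteq> V"
    and faces: "\<And>s. s \<subseteq> V \<Longrightarrow> (\<forall>e\<in>E. \<not> e \<subseteq> s) \<Longrightarrow> card s \<le> N"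
    and fs: "set fs \<subseteq> polys V" "length fs = Suc N"
  shows "\<exists>A c. finite A \<and> A \<noteq> {} \<and> (\<forall>a\<in>A. length a = length fs \<and> c a \<noteq> 0) \<and>
    (\<Sum>a\<in>A. coeff_poly (c a) * mono_list fs a) \<in> ideal_span (edge_monomial ` E)"
proof -
  have "\<forall>f. \<exists>D. exp_le D (f :: ('v, 'k) mpoly)" using ex_exp_le by blast
  from choice[OF this] obtain d where d: "\<forall>f :: ('v, 'k) mpoly. exp_le (d f) f" by blast
  define b where "b = Max (insert 0 (d ` set fs))"
  have b: "exp_le b f" if "f \<in> set fs" for f
  proof (rule exp_le_mono)
    show "exp_le (d f) f" using d by blast
    show "d f \<le> b" unfolding b_def using that by (intro Max_ge) auto
  qed
  have pl_poly: "mono_list gs a \<in> polys V \<and> exp_le (length gs * (D * b)) (mono_list gs a)"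
    if "set gs \<subseteq> set fs" "length a = length gs" "\<forall>k\<in>set a. k \<le> D" for gs a D
    using that
  proof (induction gs arbitrary: a)
    case (Cons g gs)
    then obtain k ks where a: "a = k # ks" "length ks = length gs" by (cases a) auto
    have IH: "mono_list gs ks \<in> polys V \<and> exp_le (length gs * (D * b)) (mono_list gs ks)" using Cons a by simp
    have "exp_le (k * b) (g ^ k)" using b Cons.prems by (intro exp_le_power) auto
    then have "exp_le (D * b) (g ^ k)" by (rule exp_le_mono) (use Cons.prems a in auto)
    then have "exp_le (D * b + length gs * (D * b)) (g ^ k * mono_list gs ks)" using IH by (intro exp_le_mult) auto
    moreover have "g ^ k * mono_list gs ks \<in> polys V" using IH Cons.prems fs(1) by auto
    ultimately show ?case by (simp add: a)
  qed (simp add: exp_le_1)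
  \<comment> \<open>Chosen so that \<open>Suc ?E\<close> is at most \<open>Suc D * q\<close>, where
    \<open>?E\<close> bounds the exponents in the power products of \<open>fs\<close> whose own
    exponents are at most \<open>D\<close>.\<close>
  define q where "q = Suc (Suc N * b)"
  \<comment> \<open>With this value the bound 2^|V| ((D + 1) q)^N for the monomials equals D (D +
    1)^N, which is less than the number (D + 1)^(N + 1) of power products.\<close>
  define D where "D = 2 ^ card V * q ^ N"
  define I where "I = {a :: nat list. set a \<subseteq> {..D} \<and> length a = Suc N}"
  have cardI: "finite I" "card I = Suc D ^ Suc N"
    using finite_lists_length_eq[of "{..D}" "Suc N"] card_lists_length_eq[of "{..D}" "Suc N"] by (simp_all add: I_def)
  let ?E = "Suc N * (D * b)"
  define Mo where "Mo s = {m :: 'v \<Rightarrow>\<^sub>0 nat. Poly_Mapping.keys m \<subseteq> s \<and> (\<forall>v. Poly_Mapping.lookup m v \<le> ?E)}" for s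
  define S where "S = {s. s \<subseteq> V \<and> (\<forall>e\<in>E. \<not> e \<subseteq> s)}"
  define T where "T = (mon ` (\<Union>s\<in>S. Mo s) :: ('v, 'k) mpoly set)"
  have SV: "S \<subseteq> Pow V" by (auto simp: S_def)
  then have finS: "finite S" using V by (meson finite_Pow_iff finite_subset)
  have Mo: "finite (Mo s)" "card (Mo s) \<le> Suc ?E ^ N" if s: "s \<in> S" for s
  proof -
    have "finite s" using s SV V finite_subset by (meson PowD subsetD)
    from card_bounded_exps[OF this, of ?E] have *: "finite (Mo s)" "card (Mo s) \<le> Suc ?E ^ card s"
      by (simp_all add: Mo_def)
    have "card s \<le> N" using faces s by (simp add: S_def)
    then have "Suc ?E ^ card s \<le> Suc ?E ^ N" by (intro power_increasing) auto
    then show "finite (Mo s)" "card (Mo s) \<le> Suc ?E ^ N" using * by auto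
  qed
  have finT: "finite T" using finS Mo by (simp add: T_def)
  have "card T \<le> card (\<Union>s\<in>S. Mo s)" unfolding T_def using finS Mo by (intro card_image_le) auto
  also have "\<dots> \<le> (\<Sum>s\<in>S. card (Mo s))" using finS by (rule card_UN_le)
  also have "\<dots> \<le> (\<Sum>s\<in>S. Suc ?E ^ N)" using Mo by (intro sum_mono)
  also have "\<dots> = card S * Suc ?E ^ N" by simp
  also have "\<dots> \<le> 2 ^ card V * (Suc D * q) ^ N"
  proof (intro mult_mono power_mono)
    show "card S \<le> 2 ^ card V" using card_mono[OF _ SV] V by (simp add: card_Pow)
    show "Suc ?E \<le> Suc D * q" by (simp add: q_def algebra_simps)
  qed auto
  also have "\<dots> = D * Suc D ^ N"
    unfolding power_mult_distrib by (simp add: D_def mult.assoc mult.commute)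
  also have "\<dots> < Suc D ^ Suc N" by simp
  finally have card: "card T < card I" using cardI(2) by simp
  \<comment> \<open>Deletes the monomials that lie in the ideal. It is linear and changes a
    polynomial only modulo the ideal, so a linear relation among the images is a relation of the
    power products modulo the ideal.\<close>
  define \<pi> :: "('v, 'k) mpoly \<Rightarrow> ('v, 'k) mpoly" where
    "\<pi> = lin (\<lambda>m. if \<exists>e\<in>E. e \<subseteq> Poly_Mapping.keys m then 0 else mon m)"
  have pi_in: "\<pi> p \<in> kspan T" if "p \<in> polys V" "exp_le ?E p" for p
    unfolding \<pi>_def lin_def
  proof (intro kspan_sum kspan_scale)
    fix m assume m: "m \<in> Poly_Mapping.keys p"
    show "(if \<exists>e\<in>E. e \<subseteq> Poly_Mapping.keys m then 0 else mon m) \<in> kspan T"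
    proof (cases "\<exists>e\<in>E. e \<subseteq> Poly_Mapping.keys m")
      case False
      have "Poly_Mapping.keys m \<in> S" using False that(1) m by (auto simp: S_def polys_def)
      moreover have "m \<in> Mo (Poly_Mapping.keys m)" using that(2) m by (simp add: Mo_def exp_le_def)
      ultimately have "mon m \<in> T" unfolding T_def by blast
      then show ?thesis using False by (simp add: kspan_base)
    qed (simp add: kspan_0)
  qed
  have pi_diff: "p - \<pi> p \<in> ideal_span (edge_monomial ` E)" for p
  proof (induction p rule: poly_induct)
    case zero
    show ?case by (simp add: \<pi>_def ideal_span_0)
  next
    case (single m c)
    show ?case
    proof (cases "\<exists>e\<in>E. e \<subseteq> Poly_Mapping.keys m")
      case True
      have "(Poly_Mapping.single m c :: ('v, 'k) mpoly) \<in> ideal_span (edge_monomial ` E)"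
        using True E V by (subst mem_monomial_ideal_iff) (auto intro: finite_subset)
      then show ?thesis using True by (simp add: \<pi>_def lin_single)
    next
      case False
      then show ?thesis by (simp add: \<pi>_def lin_single mult_single ideal_span_0)
    qed
  next
    case (add p q)
    have "(p + q) - \<pi> (p + q) = (p - \<pi> p) + (q - \<pi> q)" by (simp add: \<pi>_def lin_add)
    then show ?case using add ideal_span_add by metis
  qed
  have "\<exists>c. (\<exists>a\<in>I. c a \<noteq> 0) \<and> (\<Sum>a\<in>I. coeff_poly (c a) * \<pi> (mono_list fs a)) = 0"
  proof (rule kspan_family_dependent[OF cardI(1) finT card])
    fix a assume "a \<in> I"
    then have "mono_list fs a \<in> polys V \<and> exp_le (length fs * (D * b)) (mono_list fs a)"
      using fs(2) by (intro pl_poly) (auto simp: I_def)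
    then show "\<pi> (mono_list fs a) \<in> kspan T" using fs(2) by (intro pi_in) auto
  qed
  then obtain c where c: "\<exists>a\<in>I. c a \<noteq> 0" "(\<Sum>a\<in>I. coeff_poly (c a) * \<pi> (mono_list fs a)) = 0" by blast
  define A where "A = {a \<in> I. c a \<noteq> 0}"
  have "(\<Sum>a\<in>I. coeff_poly (c a) * mono_list fs a) = (\<Sum>a\<in>I. coeff_poly (c a) * (mono_list fs a - \<pi> (mono_list fs a)))"
    using c(2) by (simp add: right_diff_distrib sum_subtractf)
  also have "\<dots> \<in> ideal_span (edge_monomial ` E)"
    by (intro ideal_span_sum ideal_span_mult pi_diff)
  also have "(\<Sum>a\<in>I. coeff_poly (c a) * mono_list fs a) = (\<Sum>a\<in>A. coeff_poly (c a) * mono_list fs a)"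
    unfolding A_def using cardI(1) by (intro sum.mono_neutral_right) auto
  finally have "(\<Sum>a\<in>A. coeff_poly (c a) * mono_list fs a) \<in> ideal_span (edge_monomial ` E)" .
  moreover have "finite A" "A \<noteq> {}" using cardI(1) c(1) by (auto simp: A_def)
  moreover have "\<forall>a\<in>A. length a = length fs \<and> c a \<noteq> 0" using fs(2) by (auto simp: A_def I_def)
  ultimately show ?thesis by (intro exI[of _ A] exI[of _ c]) simp
qed

text \<open>Prime ideals of \<open>K[V]\<close> are extended to the ring of all polynomials along \<open>restrict_vars\<close>.\<close>
theorem krull_dim_edge_ring:
  fixes K :: "'k::field itself"
  assumes V: "finite V" and E: "\<And>e. e \<in> E \<Longrightarrow> e \<subseteq> V"
    and faces: "\<And>s. s \<subseteq> V \<Longrightarrow> (\<forall>e\<in>E. \<not> e \<subseteq> s) \<Longrightarrow> card s \<le> N"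
  shows "krull_dim (polynomial_ring K V Quot edge_ideal K V E) \<le> enat N"
  unfolding krull_dim_def
proof (rule SUP_least, clarify)
  let ?R = "polynomial_ring K V" and ?I = "edge_ideal K V E"
  interpret R: cring ?R by (rule cring_polynomial_ring)
  have EV: "(edge_monomial ` E :: ('a, 'k) mpoly set) \<subseteq> polys V" using E polys_edge_monomial by blast
  then have I: "ideal ?I ?R" unfolding edge_ideal_def by (intro R.genideal_ideal) simp
  have I_eq: "?I = ideal_span (edge_monomial ` E) \<inter> polys V"
    unfolding edge_ideal_def by (rule Idl_polynomial_ring[OF EV])
  fix n P assume P: "\<forall>i\<le>n. primeideal (P i) (?R Quot ?I)" "\<forall>i<n. P i \<subset> P (Suc i)"
  show "enat n \<le> enat N"
  proof (rule ccontr)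
    assume "\<not> enat n \<le> enat N"
    then have n: "N < n" by simp
    define Q where "Q i = {r \<in> carrier ?R. ?I +>\<^bsub>?R\<^esub> r \<in> P i}" for i
    define Q' where "Q' i = {p :: ('a, 'k) mpoly. restrict_vars V p \<in> Q i}" for i
    have Qprime: "primeideal (Q i) ?R" if "i \<le> n" for i
      unfolding Q_def using P(1) that by (intro R.primeideal_coset_preimage[OF I]) simp
    have Qideal: "ideal (Q i) ?R" if "i \<le> n" for i using Qprime[OF that] by (rule primeideal.axioms(1))
    note Qid = ideal_polynomial_ringD[OF Qideal]
    have PQ: "ideal (P i) (?R Quot ?I)" if "i \<le> n" for i
      using P(1) that by (simp add: primeideal.axioms(1))
    have IQ: "?I \<subseteq> Q i" if "i \<le> n" for i
      unfolding Q_def by (rule R.ideal_subset_coset_preimage[OF I PQ[OF that]])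
    interpret prime_chain Q' n
    proof
      fix i p q assume i: "i \<le> n"
      show "p + q \<in> Q' i" if "p \<in> Q' i" "q \<in> Q' i"
        using that Qid(3)[OF i] by (simp add: Q'_def restrict_simps)
      show "q * p \<in> Q' i" if "p \<in> Q' i"
        using that Qid(4)[OF i] by (simp add: Q'_def restrict_simps)
      have "1 \<notin> Q i"
        using primeideal.I_notcarr[OF Qprime[OF i]] ideal.one_imp_carrier[OF Qideal[OF i]] by auto
      then show "1 \<notin> Q' i" by (simp add: Q'_def)
      show "p \<in> Q' i \<or> q \<in> Q' i" if "p * q \<in> Q' i"
        using that primeideal.I_prime[OF Qprime[OF i], of "restrict_vars V p" "restrict_vars V q"]
        by (simp add: Q'_def restrict_simps)
      show "0 \<in> Q' i" using Qid(2)[OF i] by (simp add: Q'_def)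
    next
      fix i assume "i < n"
      then have "P i \<subset> P (Suc i)" using P(2) by blast
      then show "Q' i \<subseteq> Q' (Suc i)" by (auto simp: Q'_def Q_def)
    qed
    have "\<exists>f. f \<in> Q (Suc i) \<and> f \<notin> Q i" if i: "i < n" for i
    proof -
      obtain x where x: "x \<in> P (Suc i)" "x \<notin> P i" using P(2) i by blast
      have "P (Suc i) \<subseteq> carrier (?R Quot ?I)"
        using i by (intro cring.ideal_closedD(1)[OF ideal.quotient_is_cring[OF I R.is_cring] PQ]) simp
      then have "x \<in> carrier (?R Quot ?I)" using x(1) by blast
      then obtain r where "r \<in> carrier ?R" "x = ?I +>\<^bsub>?R\<^esub> r" unfolding coset_carrier by blast
      then show ?thesis using x by (auto simp: Q_def)
    qed
    then have "\<forall>i. \<exists>f. i < n \<longrightarrow> f \<in> Q (Suc i) \<and> f \<notin> Q i" by blast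
    from choice[OF this] obtain f where f: "\<forall>i. i < n \<longrightarrow> f i \<in> Q (Suc i) \<and> f i \<notin> Q i" by blast
    have fV: "f i \<in> polys V" if "i < n" for i using f that Qid(1)[of "Suc i"] by auto
    \<comment> \<open>Only the top N + 1 steps of the chain are used, because
      \<open>no_relation\<close> runs up to its last prime.\<close>
    define j0 where "j0 = n - Suc N"
    define fs where "fs = map (\<lambda>j. f (j0 + j)) [0..<Suc N]"
    have fsV: "set fs \<subseteq> polys V" using fV n by (auto simp: fs_def j0_def)
    have fsN: "length fs = Suc N" by (simp add: fs_def)
    have "\<exists>A c. finite A \<and> A \<noteq> {} \<and> (\<forall>a\<in>A. length a = length fs \<and> c a \<noteq> 0) \<and>
      (\<Sum>a\<in>A. coeff_poly (c a) * mono_list fs a) \<in> ideal_span (edge_monomial ` E)"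
      by (rule algebraic_dependence[OF V E faces fsV fsN])
    then obtain A c where A: "finite A" "A \<noteq> {}" "\<forall>a\<in>A. length a = length fs \<and> c a \<noteq> 0"
      "(\<Sum>a\<in>A. coeff_poly (c a) * mono_list fs a) \<in> ideal_span (edge_monomial ` E)"
      by (elim exE conjE) (rule that)
    have "(\<Sum>a\<in>A. coeff_poly (c a) * mono_list fs a) \<notin> Q' j0"
    proof (rule no_relation[OF _ _ A(1,2)])
      show "j0 + length fs = n" using n by (simp add: fs_def j0_def)
      show "fs ! j \<in> Q' (Suc (j0 + j)) \<and> fs ! j \<notin> Q' (j0 + j)" if j: "j < length fs" for j
      proof -
        have lt: "j0 + j < n" using j n by (simp add: fs_def j0_def)
        have "fs ! j = f (j0 + j)" using j by (simp add: fs_def del: upt_Suc)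
        then show ?thesis using f fV[OF lt] lt by (simp add: Q'_def restrict_vars_id)
      qed
    qed (use A(3) in auto)
    moreover have "p \<in> Q' j0" if p: "p \<in> ideal_span (edge_monomial ` E)" for p
      using p
    proof (induction rule: ideal_span_induct)
      case base
      show ?case by (rule P_0) (simp add: j0_def)
    next
      case (step c a p)
      have "a \<in> ?I" using step.hyps EV unfolding I_eq by (auto intro: ideal_span_base)
      then have "a \<in> Q j0" using IQ[of j0] by (auto simp: j0_def)
      moreover have "a \<in> polys V" using EV step.hyps by blast
      ultimately have "a \<in> Q' j0" by (simp add: Q'_def restrict_vars_id)
      then show ?case using step.IH by (intro P_add P_mult) (simp_all add: j0_def)
    qed
    ultimately show False using A(4) by blast
  qed
qed

section \<open>Whiskered clutters and the max-flow min-cut property\<close>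

text \<open>\<open>U\<close> is the vertex set of the given clutter and \<open>W v\<close> the
  whisker hanging at v. The whisker may be the singleton of v, which is the case d = 1.\<close>

locale whiskered =
  fixes U :: "'v set" and E :: "'v set set" and W :: "'v \<Rightarrow> 'v set"
  assumes finite_U: "finite U"
    and edge_subset: "\<And>e. e \<in> E \<Longrightarrow> e \<subseteq> U"
    and edge_nonempty: "\<And>e. e \<in> E \<Longrightarrow> e \<noteq> {}"
    and finite_W: "\<And>v. v \<in> U \<Longrightarrow> finite (W v)"
    and W_Int_U: "\<And>v. v \<in> U \<Longrightarrow> W v \<inter> U = {v}"
    and W_disjoint: "\<And>u v. u \<in> U \<Longrightarrow> v \<in> U \<Longrightarrow> u \<noteq> v \<Longrightarrow> W u \<inter> W v = {}"
begin

definition V where "V = (\<Union>v\<in>U. W v)"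
definition E' where "E' = E \<union> W ` U"

lemma self_in_W: "v \<in> U \<Longrightarrow> v \<in> W v"
  using W_Int_U by auto

lemma U_subset_V: "U \<subseteq> V"
  using self_in_W by (auto simp: V_def)

lemma finite_V: "finite V"
  using finite_U finite_W by (auto simp: V_def)

lemma finite_E: "finite E"
  using edge_subset finite_U by (meson Pow_iff finite_Pow_iff finite_subset subsetI)

lemma finite_E': "finite E'"
  using finite_E finite_U by (simp add: E'_def)

lemma inj_on_W: "inj_on W U"
  by (rule inj_onI) (metis W_Int_U Int_absorb W_disjoint insert_not_empty self_in_W empty_iff)

lemma E'_subset: "e \<in> E' \<Longrightarrow> e \<subseteq> V"
  using edge_subset U_subset_V by (auto simp: E'_def V_def)

lemma W_subset_U: "v \<in> U \<Longrightarrow> W v \<subseteq> U \<Longrightarrow> W v = {v}"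
  using W_Int_U by blast

lemma sum_V: "(\<Sum>v\<in>V. f v) = (\<Sum>v\<in>U. \<Sum>u\<in>W v. f u)"
  unfolding V_def using finite_U finite_W W_disjoint by (intro sum.UNION_disjoint) auto

text \<open>A singleton whisker may itself be an edge in \<open>E\<close>; the first sum leaves such
  edges out, so that none is counted twice.\<close>

lemma sum_E': "(\<Sum>e\<in>E'. f e) = (\<Sum>e\<in>E - W ` U. f e) + (\<Sum>v\<in>U. f (W v))"
proof -
  have "E' = (E - W ` U) \<union> W ` U" "(E - W ` U) \<inter> W ` U = {}" by (auto simp: E'_def)
  then have "(\<Sum>e\<in>E'. f e) = (\<Sum>e\<in>E - W ` U. f e) + (\<Sum>e\<in>W ` U. f e)"
    using finite_E finite_U by (metis finite_Diff finite_imageI sum.union_disjoint)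
  then show ?thesis using inj_on_W by (simp add: sum.reindex)
qed

end

lemma sum_incidence:
  "finite V \<Longrightarrow> e \<subseteq> V \<Longrightarrow> (\<Sum>v\<in>V. f v * incidence v e) = (\<Sum>v\<in>e. f v)"
  by (rule sum.mono_neutral_cong_right) (auto simp: incidence_def)

lemma sum_incidence':
  "finite E \<Longrightarrow> (\<Sum>e\<in>E. incidence v e * f e) = (\<Sum>e | e \<in> E \<and> v \<in> e. f e)"
  by (rule sum.mono_neutral_cong_right) (auto simp: incidence_def)

lemma primal_feasible_iff:
  assumes "finite V" "\<And>e. e \<in> E \<Longrightarrow> e \<subseteq> V"
  shows "primal_feasible V E t \<longleftrightarrow> (\<forall>v\<in>V. t v \<ge> 0) \<and> (\<forall>e\<in>E. (\<Sum>v\<in>e. t v) \<ge> 1)"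
  using assms by (simp add: primal_feasible_def sum_incidence)

lemma dual_feasible_iff:
  assumes "finite E"
  shows "dual_feasible V E w u \<longleftrightarrow> (\<forall>e\<in>E. u e \<ge> 0) \<and> (\<forall>v\<in>V. (\<Sum>e | e \<in> E \<and> v \<in> e. u e) \<le> w v)"
  using assms by (simp add: dual_feasible_def sum_incidence')

text \<open>One vertex at a time, the edges through it are scaled by a common factor.\<close>
lemma reduce_load:
  fixes u :: "'v set \<Rightarrow> real"
  assumes "finite S" "finite E" "\<And>e. e \<in> E \<Longrightarrow> u e \<ge> 0" "\<And>v. v \<in> S \<Longrightarrow> \<delta> v \<ge> 0"
  shows "\<exists>u'. (\<forall>e\<in>E. 0 \<le> u' e \<and> u' e \<le> u e) \<and>
    (\<forall>v\<in>S. (\<Sum>e | e \<in> E \<and> v \<in> e. u' e) \<le> max 0 ((\<Sum>e | e \<in> E \<and> v \<in> e. u e) - \<delta> v)) \<and>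
    (\<Sum>e\<in>E. u e) - (\<Sum>e\<in>E. u' e) \<le> (\<Sum>v\<in>S. \<delta> v)"
  using assms(1,4)
proof (induction S rule: finite_induct)
  case empty
  then show ?case using assms by (intro exI[of _ u]) auto
next
  case (insert v S)
  then obtain u1 where u1: "\<forall>e\<in>E. 0 \<le> u1 e \<and> u1 e \<le> u e"
    "\<forall>v\<in>S. (\<Sum>e | e \<in> E \<and> v \<in> e. u1 e) \<le> max 0 ((\<Sum>e | e \<in> E \<and> v \<in> e. u e) - \<delta> v)"
    "(\<Sum>e\<in>E. u e) - (\<Sum>e\<in>E. u1 e) \<le> (\<Sum>v\<in>S. \<delta> v)" by auto
  define L where "L = (\<Sum>e | e \<in> E \<and> v \<in> e. u1 e)"
  have L0: "L \<ge> 0" unfolding L_def using u1(1) by (auto intro: sum_nonneg)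
  have dv: "\<delta> v \<ge> 0" using insert by auto
  \<comment> \<open>Scales the load L at v to max 0 (L - \<delta> v). If L = 0, division by zero
    gives t = 1, and there is nothing to scale.\<close>
  define t where "t = max 0 (1 - \<delta> v / L)"
  have t: "0 \<le> t" "t \<le> 1" using L0 dv by (auto simp: t_def)
  define u2 where "u2 e = (if v \<in> e then t * u1 e else u1 e)" for e
  have le: "0 \<le> u2 e \<and> u2 e \<le> u1 e" if "e \<in> E" for e
    using u1(1) t that by (auto simp: u2_def mult_left_le_one_le)
  have mono: "(\<Sum>e | e \<in> E \<and> w \<in> e. u2 e) \<le> (\<Sum>e | e \<in> E \<and> w \<in> e. u1 e)" for w
    using le by (auto intro: sum_mono)
  have Lu: "L \<le> (\<Sum>e | e \<in> E \<and> v \<in> e. u e)" unfolding L_def using u1(1) by (auto intro: sum_mono)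
  have "(\<Sum>e | e \<in> E \<and> v \<in> e. u2 e) = t * L"
    by (auto simp: u2_def L_def sum_distrib_left intro!: sum.cong)
  moreover have tL: "t * L = max 0 (L - \<delta> v) \<or> L = 0"
    using L0 by (auto simp: t_def max_def field_simps)
  ultimately have new: "(\<Sum>e | e \<in> E \<and> v \<in> e. u2 e) \<le> max 0 ((\<Sum>e | e \<in> E \<and> v \<in> e. u e) - \<delta> v)"
    using Lu by auto
  have "(\<Sum>e\<in>E. u1 e) - (\<Sum>e\<in>E. u2 e) = (\<Sum>e\<in>E. u1 e - u2 e)" by (simp add: sum_subtractf)
  also have "\<dots> = (\<Sum>e | e \<in> E \<and> v \<in> e. u1 e - t * u1 e)"
    by (rule sum.mono_neutral_cong_right) (use assms(2) in \<open>auto simp: u2_def\<close>)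
  also have "\<dots> = L - t * L" by (simp add: L_def sum_subtractf sum_distrib_left)
  also have "\<dots> \<le> \<delta> v" using tL dv by auto
  finally have "(\<Sum>e\<in>E. u1 e) - (\<Sum>e\<in>E. u2 e) \<le> \<delta> v" .
  then have "(\<Sum>e\<in>E. u e) - (\<Sum>e\<in>E. u2 e) \<le> (\<Sum>v\<in>insert v S. \<delta> v)"
    using u1(3) insert by simp
  moreover have "\<forall>e\<in>E. 0 \<le> u2 e \<and> u2 e \<le> u e" using le u1(1) by force
  moreover have "\<forall>w\<in>insert v S. (\<Sum>e | e \<in> E \<and> w \<in> e. u2 e) \<le> max 0 ((\<Sum>e | e \<in> E \<and> w \<in> e. u e) - \<delta> w)"
    using new u1(2) mono by (auto intro: order_trans)
  ultimately show ?case by blast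
qed

section \<open>Optimal solutions for the whiskered clutter\<close>

context whiskered
begin

definition whisker_weight :: "('v \<Rightarrow> nat) \<Rightarrow> 'v \<Rightarrow> nat" where
  "whisker_weight w v = Min (w ` W v)"

definition residual_weight :: "('v \<Rightarrow> nat) \<Rightarrow> 'v \<Rightarrow> nat" where
  "residual_weight w v = w v - whisker_weight w v"

lemma whisker_weight_le: "v \<in> U \<Longrightarrow> u \<in> W v \<Longrightarrow> whisker_weight w v \<le> w u"
  using finite_W by (simp add: whisker_weight_def)

lemma whisker_weight_attained: "v \<in> U \<Longrightarrow> \<exists>u\<in>W v. w u = whisker_weight w v"
  using Min_in[of "w ` W v"] finite_W[of v] self_in_W[of v]
  by (metis empty_is_image equals0D finite_imageI image_iff whisker_weight_def)

lemma residual_weight_real: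
  "v \<in> U \<Longrightarrow> real (residual_weight w v) = real (w v) - real (whisker_weight w v)"
  using whisker_weight_le[of v v w] self_in_W by (simp add: residual_weight_def of_nat_diff)

text \<open>Lower every weight on the whisker at v to the minimum, except for the residual weight
  kept at v. The minimum is then paid in full, because the whisker constraint forces total value at
  least 1.\<close>

lemma primal_lower_bound:
  assumes t: "primal_feasible V E' t"
  shows "(\<Sum>v\<in>V. real (w v) * t v) \<ge>
    (\<Sum>v\<in>U. real (whisker_weight w v)) + (\<Sum>v\<in>U. real (residual_weight w v) * t v)"
proof -
  have t: "\<forall>v\<in>V. t v \<ge> 0" "\<forall>e\<in>E'. (\<Sum>v\<in>e. t v) \<ge> 1"
    using t primal_feasible_iff[OF finite_V E'_subset] by auto
  have "real (whisker_weight w v) + real (residual_weight w v) * t v \<le> (\<Sum>u\<in>W v. real (w u) * t u)"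
    if v: "v \<in> U" for v
  proof -
    have tW: "\<forall>u\<in>W v. t u \<ge> 0" "(\<Sum>u\<in>W v. t u) \<ge> 1" using t v by (auto simp: V_def E'_def)
    have "real (residual_weight w v) * t v + real (whisker_weight w v) * 1 \<le>
        real (residual_weight w v) * t v + real (whisker_weight w v) * (\<Sum>u\<in>W v. t u)"
      using tW by (intro add_left_mono mult_left_mono) auto
    also have "\<dots> = real (w v) * t v + real (whisker_weight w v) * ((\<Sum>u\<in>W v. t u) - t v)"
      unfolding residual_weight_real[OF v, of w] by (simp add: algebra_simps)
    also have "real (whisker_weight w v) * ((\<Sum>u\<in>W v. t u) - t v) =
       (\<Sum>u\<in>W v - {v}. real (whisker_weight w v) * t u)"
      using v finite_W self_in_W by (simp add: sum_distrib_left sum_diff1 right_diff_distrib)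
    also have "real (w v) * t v + \<dots> \<le> real (w v) * t v + (\<Sum>u\<in>W v - {v}. real (w u) * t u)"
      using whisker_weight_le[OF v, of _ w] tW by (intro add_left_mono sum_mono mult_right_mono) auto
    also have "\<dots> = (\<Sum>u\<in>W v. real (w u) * t u)"
      using v by (intro sum.remove[symmetric]) (auto simp: finite_W self_in_W)
    finally show ?thesis by simp
  qed
  then have "(\<Sum>v\<in>U. real (whisker_weight w v) + real (residual_weight w v) * t v) \<le>
      (\<Sum>v\<in>U. \<Sum>u\<in>W v. real (w u) * t u)" by (rule sum_mono)
  then show ?thesis by (simp add: sum_V sum.distrib)
qed

lemma primal_feasible_restrict:
  assumes "primal_feasible V E' t"
  shows "primal_feasible U E t"
proof -
  have "\<forall>v\<in>V. t v \<ge> 0" "\<forall>e\<in>E'. (\<Sum>v\<in>e. t v) \<ge> 1"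
    using assms primal_feasible_iff[OF finite_V E'_subset] by auto
  then show ?thesis using primal_feasible_iff[OF finite_U edge_subset] U_subset_V by (auto simp: E'_def)
qed

text \<open>An integral optimum t for the residual weights is turned into a 0/1 solution with one
  vertex per whisker: v itself where t v > 0, otherwise a lightest vertex. By integrality a positive
  t v is at least 1, so the cost is at most the sum of the minimal weights plus the residual
  optimum, and \<open>primal_lower_bound\<close> applies.\<close>

lemma primal_optimal_extend:
  assumes t: "primal_optimal U E (\<lambda>v. real (residual_weight w v)) t" and int: "\<forall>v\<in>U. t v \<in> \<int>"
  shows "\<exists>t. primal_optimal V E' (\<lambda>v. real (w v)) t \<and> (\<forall>v\<in>V. t v \<in> \<int>)"
proof -
  let ?m = "whisker_weight w" and ?r = "residual_weight w"
  have feas: "\<forall>v\<in>U. t v \<ge> 0" "\<forall>e\<in>E. (\<Sum>v\<in>e. t v) \<ge> 1"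
    using t primal_feasible_iff[OF finite_U edge_subset] by (auto simp: primal_optimal_def)
  have "\<forall>v\<in>U. \<exists>u\<in>W v. (if t v > 0 then u = v else w u = ?m v)"
    using whisker_weight_attained[of _ w] self_in_W by auto
  then obtain c where c: "\<And>v. v \<in> U \<Longrightarrow> c v \<in> W v"
    "\<And>v. v \<in> U \<Longrightarrow> t v > 0 \<Longrightarrow> c v = v" "\<And>v. v \<in> U \<Longrightarrow> \<not> t v > 0 \<Longrightarrow> w (c v) = ?m v"
    by (metis (full_types))
  define s :: "'v \<Rightarrow> real" where "s u = (if u \<in> c ` U then 1 else 0)" for u
  have sW: "s u = (if u = c v then 1 else 0)" if "v \<in> U" "u \<in> W v" for u v
    using that c(1) W_disjoint unfolding s_def by (metis (no_types, lifting) disjoint_iff imageE imageI)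
  have ge1: "t v \<ge> 1" if "v \<in> U" "t v > 0" for v
    using that int by (metis Ints_nonzero_abs_ge1 abs_of_pos less_irrefl)
  have "primal_feasible V E' s"
  proof (subst primal_feasible_iff[OF finite_V E'_subset], assumption, intro conjI ballI)
    show "s v \<ge> 0" for v by (simp add: s_def)
    fix e assume "e \<in> E'"
    then have "\<exists>v\<in>e. s v = 1"
    proof (unfold E'_def, elim UnE)
      assume e: "e \<in> E"
      then have "\<exists>v\<in>e. t v > 0"
        using feas(2) by (metis linorder_not_le not_one_le_zero order_trans sum_nonpos)
      then obtain v where "v \<in> e" "t v > 0" by auto
      moreover from this e have "v \<in> U" using edge_subset by auto
      ultimately show ?thesis using c(2) by (metis image_eqI s_def)
    next
      assume "e \<in> W ` U"
      then show ?thesis using c(1) by (auto simp: s_def)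
    qed
    then obtain v where v: "v \<in> e" "s v = 1" by auto
    have "finite e" using \<open>e \<in> E'\<close> E'_subset finite_V finite_subset by blast
    then have "s v \<le> (\<Sum>v\<in>e. s v)" using v by (intro member_le_sum) (auto simp: s_def)
    then show "1 \<le> (\<Sum>v\<in>e. s v)" using v by simp
  qed
  moreover have "(\<Sum>v\<in>V. real (w v) * s v) \<le> (\<Sum>v\<in>V. real (w v) * t' v)"
    if t': "primal_feasible V E' t'" for t'
  proof -
    have "(\<Sum>u\<in>W v. real (w u) * s u) \<le> real (?m v) + real (?r v) * t v" if v: "v \<in> U" for v
    proof -
      have "(\<Sum>u\<in>W v. real (w u) * s u) = (\<Sum>u\<in>W v. if u = c v then real (w u) else 0)"
        using sW[OF v] by (intro sum.cong) auto
      also have "\<dots> = real (w (c v))" using c(1)[OF v] finite_W[OF v] by simp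
      also have "\<dots> \<le> real (?m v) + real (?r v) * t v"
      proof (cases "t v > 0")
        case True
        then have "real (?r v) * 1 \<le> real (?r v) * t v" using ge1[OF v] by (intro mult_left_mono) auto
        then show ?thesis using True c(2)[OF v] residual_weight_real[OF v, of w] by simp
      next
        case False then show ?thesis using c(3)[OF v] feas(1) v by simp
      qed
      finally show ?thesis .
    qed
    then have "(\<Sum>v\<in>V. real (w v) * s v) \<le> (\<Sum>v\<in>U. real (?m v) + real (?r v) * t v)"
      unfolding sum_V by (rule sum_mono)
    also have "\<dots> \<le> (\<Sum>v\<in>U. real (?m v)) + (\<Sum>v\<in>U. real (?r v) * t' v)"
      using t primal_feasible_restrict[OF t'] by (simp add: sum.distrib primal_optimal_def)
    also have "\<dots> \<le> (\<Sum>v\<in>V. real (w v) * t' v)" by (rule primal_lower_bound[OF t'])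
    finally show ?thesis .
  qed
  ultimately have "primal_optimal V E' (\<lambda>v. real (w v)) s" by (simp add: primal_optimal_def)
  moreover have "\<forall>v\<in>V. s v \<in> \<int>" by (simp add: s_def)
  ultimately show ?thesis by blast
qed

lemma load_E':
  assumes "v \<in> U" "u \<in> W v"
  shows "(\<Sum>e | e \<in> E' \<and> u \<in> e. f e) = (\<Sum>e | e \<in> E - W ` U \<and> u \<in> e. f e) + f (W v)"
proof -
  have "{e \<in> E'. u \<in> e} = insert (W v) {e \<in> E - W ` U. u \<in> e}"
    using assms W_disjoint by (auto simp: E'_def)
  then show ?thesis using finite_E assms by (simp add: add.commute)
qed

lemma load_E_outside:
  assumes "v \<in> U" "u \<in> W v" "u \<noteq> v"
  shows "{e \<in> E - W ` U. u \<in> e} = {}"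
  using assms edge_subset W_Int_U by blast

text \<open>Each whisker receives its minimal weight, the other edges keep the optimum for the
  residual weights. For optimality, a competitor that uses less of a whisker gains at most that
  amount on the edges, by \<open>reduce_load\<close>.\<close>

lemma dual_optimal_extend:
  assumes u: "dual_optimal U E (\<lambda>v. real (residual_weight w v)) u" and int: "\<forall>e\<in>E. u e \<in> \<int>"
  shows "\<exists>u. dual_optimal V E' (\<lambda>v. real (w v)) u \<and> (\<forall>e\<in>E'. u e \<in> \<int>)"
proof -
  let ?m = "whisker_weight w" and ?r = "residual_weight w" and ?E = "E - W ` U"
  have finE: "finite ?E" using finite_E by simp
  have feas: "\<forall>e\<in>E. u e \<ge> 0" "\<forall>v\<in>U. (\<Sum>e | e \<in> E \<and> v \<in> e. u e) \<le> real (?r v)"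
    using u dual_feasible_iff[OF finite_E] by (auto simp: dual_optimal_def)
  \<comment> \<open>A whisker that is also an edge is a singleton. Its minimal weight is the whole
    weight of v, so u has no room on it, and overwriting its value in \<open>s\<close> loses
    nothing.\<close>
  have u0: "u (W v) = 0" if v: "v \<in> U" "W v \<in> E" for v
  proof -
    have Wv: "W v = {v}" using W_subset_U v edge_subset by blast
    then have "?r v = 0" by (simp add: residual_weight_def whisker_weight_def)
    moreover have "u (W v) \<le> (\<Sum>e | e \<in> E \<and> v \<in> e. u e)"
      using finite_E feas v Wv by (intro member_le_sum) auto
    ultimately show ?thesis using feas v by force
  qed
  have sumE: "(\<Sum>e\<in>E. u e) = (\<Sum>e\<in>?E. u e)"
    using finite_E u0 by (intro sum.mono_neutral_right) auto
  define s where "s e = (if e \<in> W ` U then real (?m (THE v. v \<in> U \<and> W v = e)) else u e)" for e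
  have sW: "s (W v) = real (?m v)" if "v \<in> U" for v
  proof -
    have "(THE v'. v' \<in> U \<and> W v' = W v) = v" using that inj_on_W by (auto simp: inj_on_def)
    then show ?thesis using that by (simp add: s_def)
  qed
  have sE: "(\<Sum>e | e \<in> ?E \<and> P e. s e) = (\<Sum>e | e \<in> ?E \<and> P e. u e)" for P
    by (intro sum.cong) (auto simp: s_def)
  have "dual_feasible V E' (\<lambda>v. real (w v)) s"
    unfolding dual_feasible_iff[OF finite_E']
  proof (intro conjI ballI)
    show "s e \<ge> 0" if "e \<in> E'" for e using that feas by (auto simp: s_def E'_def)
    fix a assume "a \<in> V"
    then obtain v where v: "v \<in> U" "a \<in> W v" by (auto simp: V_def)
    have "(\<Sum>e | e \<in> E' \<and> a \<in> e. s e) = (\<Sum>e | e \<in> ?E \<and> a \<in> e. u e) + real (?m v)"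
      using load_E'[OF v, of s] sE[of "\<lambda>e. a \<in> e"] sW[OF v(1)] by metis
    also have "\<dots> \<le> real (w a)"
    proof (cases "a = v")
      case True
      have "(\<Sum>e | e \<in> ?E \<and> a \<in> e. u e) \<le> (\<Sum>e | e \<in> E \<and> a \<in> e. u e)"
        using finite_E feas by (intro sum_mono2) auto
      also have "\<dots> \<le> real (?r v)" using feas True v by simp
      finally show ?thesis using True residual_weight_real[OF v(1), of w] by simp
    next
      case False
      then show ?thesis unfolding load_E_outside[OF v False] using whisker_weight_le[OF v, of w] by simp
    qed
    finally show "(\<Sum>e | e \<in> E' \<and> a \<in> e. s e) \<le> real (w a)" .
  qed
  moreover have "(\<Sum>e\<in>E'. u' e) \<le> (\<Sum>e\<in>E'. s e)"
    if u': "dual_feasible V E' (\<lambda>v. real (w v)) u'" for u'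
  proof -
    have f': "\<forall>e\<in>E'. u' e \<ge> 0" "\<forall>v\<in>V. (\<Sum>e | e \<in> E' \<and> v \<in> e. u' e) \<le> w v"
      using u' dual_feasible_iff[OF finite_E'] by auto
    have load: "(\<Sum>e | e \<in> ?E \<and> a \<in> e. u' e) + u' (W v) \<le> w a" if "v \<in> U" "a \<in> W v" for v a
    proof -
      have "a \<in> V" using that by (auto simp: V_def)
      then have "(\<Sum>e | e \<in> E' \<and> a \<in> e. u' e) \<le> w a" using f'(2) by blast
      then show ?thesis using load_E'[OF that, of u'] by linarith
    qed
    have le_m: "u' (W v) \<le> ?m v" if v: "v \<in> U" for v
    proof -
      obtain a where a: "a \<in> W v" "w a = ?m v" using whisker_weight_attained v by blast
      have "0 \<le> (\<Sum>e | e \<in> ?E \<and> a \<in> e. u' e)" using f' by (intro sum_nonneg) (auto simp: E'_def)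
      then show ?thesis using load[OF v a(1)] a by simp
    qed
    define \<delta> where "\<delta> v = ?m v - u' (W v)" for v
    define a where "a e = (if e \<in> W ` U then 0 else u' e)" for e
    have a0: "a e \<ge> 0" if "e \<in> E" for e using f' that by (auto simp: a_def E'_def)
    have "\<exists>b. (\<forall>e\<in>E. 0 \<le> b e \<and> b e \<le> a e) \<and>
      (\<forall>v\<in>U. (\<Sum>e | e \<in> E \<and> v \<in> e. b e) \<le> max 0 ((\<Sum>e | e \<in> E \<and> v \<in> e. a e) - \<delta> v)) \<and>
      (\<Sum>e\<in>E. a e) - (\<Sum>e\<in>E. b e) \<le> (\<Sum>v\<in>U. \<delta> v)"
      using finite_U finite_E le_m a0 by (intro reduce_load) (auto simp: \<delta>_def)
    then obtain b where b: "\<forall>e\<in>E. 0 \<le> b e \<and> b e \<le> a e"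
      "\<forall>v\<in>U. (\<Sum>e | e \<in> E \<and> v \<in> e. b e) \<le> max 0 ((\<Sum>e | e \<in> E \<and> v \<in> e. a e) - \<delta> v)"
      "(\<Sum>e\<in>E. a e) - (\<Sum>e\<in>E. b e) \<le> (\<Sum>v\<in>U. \<delta> v)" by blast
    have aE: "(\<Sum>e | e \<in> E \<and> P e. a e) = (\<Sum>e | e \<in> ?E \<and> P e. u' e)" for P
      using finite_E by (intro sum.mono_neutral_cong_right) (auto simp: a_def)
    have "dual_feasible U E (\<lambda>v. real (?r v)) b"
      unfolding dual_feasible_iff[OF finite_E]
    proof (intro conjI ballI)
      show "0 \<le> b e" if "e \<in> E" for e using b that by auto
      fix v assume v: "v \<in> U"
      have "(\<Sum>e | e \<in> E \<and> v \<in> e. a e) - \<delta> v \<le> real (?r v)"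
        using load[OF v self_in_W[OF v]] residual_weight_real[OF v, of w] aE by (simp add: \<delta>_def)
      then show "(\<Sum>e | e \<in> E \<and> v \<in> e. b e) \<le> real (?r v)" using b(2) v by force
    qed
    then have "(\<Sum>e\<in>E. b e) \<le> (\<Sum>e\<in>?E. u e)" using u sumE by (simp add: dual_optimal_def)
    moreover have "(\<Sum>e\<in>E. a e) = (\<Sum>e\<in>?E. u' e)" using aE[of "\<lambda>_. True"] by (simp del: Diff_iff)
    moreover have "(\<Sum>v\<in>U. \<delta> v) = (\<Sum>v\<in>U. real (?m v)) - (\<Sum>v\<in>U. u' (W v))"
      by (simp add: \<delta>_def sum_subtractf)
    ultimately have "(\<Sum>e\<in>?E. u' e) + (\<Sum>v\<in>U. u' (W v)) \<le> (\<Sum>e\<in>?E. u e) + (\<Sum>v\<in>U. real (?m v))"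
      using b(3) by linarith
    then show ?thesis using sE[of "\<lambda>_. True"] sW by (simp add: sum_E' del: Diff_iff)
  qed
  ultimately have "dual_optimal V E' (\<lambda>v. real (w v)) s" by (simp add: dual_optimal_def)
  moreover have "\<forall>e\<in>E'. s e \<in> \<int>" using int by (auto simp: s_def E'_def)
  ultimately show ?thesis by blast
qed

theorem max_flow_min_cut_whiskered:
  assumes "max_flow_min_cut U E"
  shows "max_flow_min_cut V E'"
  unfolding max_flow_min_cut_def
  using assms primal_optimal_extend dual_optimal_extend unfolding max_flow_min_cut_def by metis

end

section \<open>Minors and the packing property\<close>

lemma vertex_cover_matching_le:
  assumes "finite V" "vertex_cover V E T" "M \<subseteq> E" "disjoint M"
  shows "finite M \<and> card M \<le> card T"
proof -
  have T: "finite T" using assms finite_subset by (auto simp: vertex_cover_def)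
  have "\<forall>e\<in>M. \<exists>v. v \<in> T \<inter> e" using assms by (auto simp: vertex_cover_def)
  then obtain c where c: "\<And>e. e \<in> M \<Longrightarrow> c e \<in> T \<inter> e" by metis
  have "inj_on c M"
    using c disjointD[OF assms(4)] by (intro inj_onI) (metis IntD2 IntI empty_iff)
  moreover have "c ` M \<subseteq> T" using c by auto
  ultimately show ?thesis using T by (meson card_inj_on_le inj_on_finite)
qed

text \<open>No matching is larger than a cover, so one pair with \<open>card T\<close> at most
  \<open>card M\<close> certifies equality. Nonempty edges guarantee that a cover exists.\<close>

lemma koenig_property_iff:
  assumes V: "finite V" and E: "\<forall>e\<in>E. e \<subseteq> V \<and> e \<noteq> {}"
  shows "koenig_property V E \<longleftrightarrow>
    (\<exists>T M. vertex_cover V E T \<and> M \<subseteq> E \<and> disjoint M \<and> card T \<le> card M)"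
proof -
  let ?C = "card ` {T. vertex_cover V E T}" and ?M = "card ` {M. M \<subseteq> E \<and> disjoint M}"
  have finE: "finite E" using V E by (meson Pow_iff finite_Pow_iff finite_subset subsetI)
  have "vertex_cover V E V" using E by (auto simp: vertex_cover_def Int_absorb1)
  moreover have "{T. vertex_cover V E T} \<subseteq> Pow V" by (auto simp: vertex_cover_def)
  ultimately have C: "finite ?C" "?C \<noteq> {}"
    using finite_subset[of "{T. vertex_cover V E T}" "Pow V"] V by blast+
  have "{} \<subseteq> E \<and> disjoint {}" by simp
  moreover have "{M. M \<subseteq> E \<and> disjoint M} \<subseteq> Pow E" by auto
  ultimately have M: "finite ?M" "?M \<noteq> {}"
    using finE finite_subset[of "{M. M \<subseteq> E \<and> disjoint M}" "Pow E"] by blast+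
  obtain T where T: "vertex_cover V E T" "card T = covering_number V E"
    using Min_in[OF C] by (auto simp: covering_number_def)
  obtain N where N: "N \<subseteq> E" "disjoint N" "card N = matching_number E"
    using Max_in[OF M] by (auto simp: matching_number_def)
  have le: "matching_number E \<le> covering_number V E"
    using vertex_cover_matching_le[OF V T(1) N(1,2)] T N by simp
  show ?thesis
  proof
    assume "koenig_property V E"
    then show "\<exists>T M. vertex_cover V E T \<and> M \<subseteq> E \<and> disjoint M \<and> card T \<le> card M"
      using T N by (metis koenig_property_def order_refl)
  next
    assume "\<exists>T M. vertex_cover V E T \<and> M \<subseteq> E \<and> disjoint M \<and> card T \<le> card M"
    then obtain T' M' where "vertex_cover V E T'" "M' \<subseteq> E" "disjoint M'" "card T' \<le> card M'" by blast
    moreover from this have "covering_number V E \<le> card T'" "card M' \<le> matching_number E"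
      using C M by (auto simp: covering_number_def matching_number_def)
    ultimately show "koenig_property V E" using le by (simp add: koenig_property_def)
  qed
qed

text \<open>For square-free monomials: every generator from \<open>F\<close> is divisible by one
  from \<open>E\<close>, which is containment of the generated ideals.\<close>

definition refines :: "'v set set \<Rightarrow> 'v set set \<Rightarrow> bool" where
  "refines F E \<longleftrightarrow> (\<forall>f\<in>F. \<exists>e\<in>E. e \<subseteq> f)"

text \<open>A cover of one family covers every family refining it, and a matching shrinks edge by
  edge into the family it refines. The property can therefore be tested on the unreduced generators
  of a minor.\<close>

lemma koenig_property_refines:
  assumes V: "finite V" and E: "\<forall>e\<in>E. e \<subseteq> V \<and> e \<noteq> {}" and F: "\<forall>e\<in>F. e \<subseteq> V \<and> e \<noteq> {}"
    and EF: "refines E F" and FE: "refines F E" and koenig: "koenig_property V E"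
  shows "koenig_property V F"
proof -
  obtain T M where T: "vertex_cover V E T" and M: "M \<subseteq> E" "disjoint M" "card T \<le> card M"
    using koenig unfolding koenig_property_iff[OF V E] by (elim exE conjE) (rule that)
  have TF: "vertex_cover V F T"
    unfolding vertex_cover_def
  proof
    show "T \<subseteq> V" using T by (simp add: vertex_cover_def)
    show "\<forall>f\<in>F. T \<inter> f \<noteq> {}"
    proof
      fix f assume "f \<in> F"
      then obtain e where e: "e \<in> E" "e \<subseteq> f" using FE by (auto simp: refines_def)
      then have "T \<inter> e \<noteq> {}" using T by (simp add: vertex_cover_def)
      then show "T \<inter> f \<noteq> {}" using e(2) by blast
    qed
  qed
  have "\<forall>e\<in>M. \<exists>f. f \<in> F \<and> f \<subseteq> e" using EF M(1) unfolding refines_def by blast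
  then obtain c where c: "\<And>e. e \<in> M \<Longrightarrow> c e \<in> F \<and> c e \<subseteq> e" by metis
  have disj: "c e \<inter> c e' = {}" if "e \<in> M" "e' \<in> M" "e \<noteq> e'" for e e'
    using disjointD[OF M(2) that] c[OF that(1)] c[OF that(2)] by blast
  have "inj_on c M"
  proof (rule inj_onI, rule ccontr)
    fix e e' assume "e \<in> M" "e' \<in> M" "c e = c e'" "e \<noteq> e'"
    moreover from this have "c e \<noteq> {}" using c[of e] F by blast
    ultimately show False using disj[of e e'] by simp
  qed
  then have "card (c ` M) = card M" by (rule card_image)
  moreover have "disjoint (c ` M)" using disj by (intro disjointI) blast
  moreover have "c ` M \<subseteq> F" using c by auto
  moreover have "card T \<le> card (c ` M)" using calculation(1) M(3) by simp
  ultimately show ?thesis unfolding koenig_property_iff[OF V F] using TF by (intro exI conjI)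
qed

text \<open>The supports of the substituted generators that do not vanish. Redundant ones are kept;
  the passage to minimal generators is left to \<open>refines\<close>.\<close>

definition minor_family :: "'v set set \<Rightarrow> 'v set \<Rightarrow> 'v set \<Rightarrow> 'v set set" where
  "minor_family E X0 X1 = {e - X1 | e. e \<in> E \<and> e \<inter> X0 = {}}"

lemma subst_edge_monomial:
  assumes "finite e" "X0 \<inter> X1 = {}"
  shows "poly_subst (\<lambda>v. if v \<in> X0 then 0 else if v \<in> X1 then 1 else Var v) (edge_monomial e) =
    (if e \<inter> X0 = {} then edge_monomial (e - X1) else 0)"
proof -
  let ?f = "\<lambda>v. if v \<in> X0 then 0 else if v \<in> X1 then 1 else Var v"
  have "poly_subst ?f (edge_monomial e) = (\<Prod>v\<in>e. ?f v)"
    by (simp add: edge_monomial_def subst_prod)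
  also have "\<dots> = (if e \<inter> X0 = {} then edge_monomial (e - X1) else 0)"
  proof (cases "e \<inter> X0 = {}")
    case True
    then have "(\<Prod>v\<in>e. ?f v) = (\<Prod>v\<in>e - X1. Var v)"
      using assms(1) by (intro prod.mono_neutral_cong_right) auto
    then show ?thesis using True by (simp add: edge_monomial_def)
  next
    case False
    then obtain v where v: "v \<in> e" "v \<in> X0" by blast
    then have "(\<Prod>v\<in>e. ?f v) = ?f v * (\<Prod>v\<in>e - {v}. ?f v)" using assms(1) by (intro prod.remove)
    then show ?thesis using False v by simp
  qed
  finally show ?thesis .
qed

lemma minor_ideal_eq:
  fixes K :: "'k::field itself"
  assumes "finite V" "\<And>e. e \<in> E \<Longrightarrow> e \<subseteq> V" "X0 \<inter> X1 = {}"
  shows "minor_ideal K V E X0 X1 =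
    ideal_span (edge_monomial ` minor_family E X0 X1) \<inter> polys (V - (X0 \<union> X1))"
proof -
  let ?f = "\<lambda>v. if v \<in> X0 then 0 else if v \<in> X1 then 1 else Var v :: ('a, 'k) mpoly"
  let ?G = "poly_subst ?f ` edge_monomial ` E" and ?F = "edge_monomial ` minor_family E X0 X1"
  have eq: "poly_subst ?f (edge_monomial e) = (if e \<inter> X0 = {} then edge_monomial (e - X1) else 0)"
    if "e \<in> E" for e
    using subst_edge_monomial[of e X0 X1] assms that finite_subset by blast
  have "?G \<subseteq> polys (V - (X0 \<union> X1))"
  proof clarify
    fix e assume e: "e \<in> E"
    show "poly_subst ?f (edge_monomial e) \<in> polys (V - (X0 \<union> X1))"
      unfolding eq[OF e] using assms(2)[OF e] by (auto intro!: polys_edge_monomial)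
  qed
  then have "minor_ideal K V E X0 X1 = ideal_span ?G \<inter> polys (V - (X0 \<union> X1))"
    unfolding minor_ideal_def by (rule Idl_polynomial_ring)
  moreover have "ideal_span ?G = ideal_span ?F"
  proof
    have "?G \<subseteq> ideal_span ?F"
    proof clarify
      fix e assume e: "e \<in> E"
      show "poly_subst ?f (edge_monomial e) \<in> ideal_span ?F"
        unfolding eq[OF e] using e by (auto simp: minor_family_def intro!: ideal_span_base ideal_span_0)
    qed
    then show "ideal_span ?G \<subseteq> ideal_span ?F"
      by (rule Modules.module.span_minimal[OF module_times _ Modules.module.subspace_span[OF module_times]])
    have "?F \<subseteq> ?G"
    proof clarify
      fix f assume "f \<in> minor_family E X0 X1"
      then obtain e where e: "e \<in> E" "e \<inter> X0 = {}" "f = e - X1" by (auto simp: minor_family_def)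
      then have "edge_monomial f = poly_subst ?f (edge_monomial e)" using eq by simp
      then show "edge_monomial f \<in> ?G" using e(1) by blast
    qed
    then show "ideal_span ?F \<subseteq> ideal_span ?G" by (rule ideal_span_mono)
  qed
  ultimately show ?thesis by simp
qed

lemma edge_monomial_mem_iff:
  assumes "\<And>e. e \<in> E \<Longrightarrow> finite e" "finite f"
  shows "(edge_monomial f :: ('v, 'k::field) mpoly) \<in> ideal_span (edge_monomial ` E) \<longleftrightarrow> (\<exists>e\<in>E. e \<subseteq> f)"
proof -
  have "(edge_monomial f :: ('v, 'k) mpoly) \<in> ideal_span (edge_monomial ` E) \<longleftrightarrow>
    (\<forall>m\<in>Poly_Mapping.keys (edge_monomial f :: ('v, 'k) mpoly). \<exists>e\<in>E. e \<subseteq> Poly_Mapping.keys m)"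
    by (rule mem_monomial_ideal_iff) (use assms(1) in blast)
  then show ?thesis by (simp add: edge_monomial_mon keys_charexp[OF assms(2)])
qed

lemma refines_iff_ideal:
  assumes V: "finite V" and E: "\<forall>e\<in>E. e \<subseteq> V" and F: "\<forall>f\<in>F. f \<subseteq> V"
  shows "(ideal_span (edge_monomial ` F) \<inter> polys V \<subseteq> (ideal_span (edge_monomial ` E) \<inter> polys V :: ('v, 'k::field) mpoly set))
    \<longleftrightarrow> refines F E"
proof -
  have fin: "finite e" if "e \<in> E \<or> e \<in> F" for e using that E F by (auto intro: finite_subset[OF _ V])
  show ?thesis
  proof
    assume *: "ideal_span (edge_monomial ` F) \<inter> polys V \<subseteq> (ideal_span (edge_monomial ` E) \<inter> polys V :: ('v, 'k) mpoly set)"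
    show "refines F E"
      unfolding refines_def
    proof
      fix f assume f: "f \<in> F"
      have "(edge_monomial f :: ('v, 'k) mpoly) \<in> ideal_span (edge_monomial ` F)"
        using f by (intro ideal_span_base imageI)
      moreover have "(edge_monomial f :: ('v, 'k) mpoly) \<in> polys V" using F f polys_edge_monomial by blast
      ultimately have "(edge_monomial f :: ('v, 'k) mpoly) \<in> ideal_span (edge_monomial ` E)" using * by blast
      then show "\<exists>e\<in>E. e \<subseteq> f" by (subst (asm) edge_monomial_mem_iff) (simp_all add: fin f)
    qed
  next
    assume r: "refines F E"
    have "edge_monomial ` F \<subseteq> (ideal_span (edge_monomial ` E) :: ('v, 'k) mpoly set)"
    proof clarify
      fix f assume f: "f \<in> F"
      show "(edge_monomial f :: ('v, 'k) mpoly) \<in> ideal_span (edge_monomial ` E)"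
        using r f by (subst edge_monomial_mem_iff) (simp_all add: fin refines_def)
    qed
    then have "ideal_span (edge_monomial ` F) \<subseteq> (ideal_span (edge_monomial ` E) :: ('v, 'k) mpoly set)"
      by (rule Modules.module.span_minimal[OF module_times _ Modules.module.subspace_span[OF module_times]])
    then show "ideal_span (edge_monomial ` F) \<inter> polys V \<subseteq> (ideal_span (edge_monomial ` E) \<inter> polys V :: ('v, 'k) mpoly set)"
      by (rule Int_mono) simp
  qed
qed

text \<open>Reduces minors to set combinatorics: the substituted ideal is proper exactly when no
  support became empty, and equality of ideals is refinement both ways.\<close>

lemma is_minor_iff:
  fixes K :: "'k::field itself"
  assumes V: "finite V" and E: "\<forall>e\<in>E. e \<subseteq> V"
  shows "is_minor K V E V' E' \<longleftrightarrow> clutter V' E' \<and>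
    (\<exists>X0 X1. X0 \<subseteq> V \<and> X1 \<subseteq> V \<and> X0 \<inter> X1 = {} \<and> V' = V - (X0 \<union> X1) \<and>
      {} \<notin> minor_family E X0 X1 \<and> refines E' (minor_family E X0 X1) \<and> refines (minor_family E X0 X1) E')"
proof -
  have key: "(minor_ideal K V E X0 X1 \<noteq> carrier (polynomial_ring K V') \<and>
        edge_ideal K V' E' = minor_ideal K V E X0 X1) \<longleftrightarrow>
     {} \<notin> minor_family E X0 X1 \<and> refines E' (minor_family E X0 X1) \<and> refines (minor_family E X0 X1) E'"
    if cl: "clutter V' E'" and X: "X0 \<inter> X1 = {}" and V': "V' = V - (X0 \<union> X1)" for X0 X1
  proof -
    let ?F = "minor_family E X0 X1"
    have finV': "finite V'" using V V' by simp
    have F: "\<forall>f\<in>?F. f \<subseteq> V'"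
      using E V' by (auto simp: minor_family_def)
    have E': "\<forall>e\<in>E'. e \<subseteq> V'" using cl by (auto simp: clutter_def)
    have mi: "minor_ideal K V E X0 X1 = ideal_span (edge_monomial ` ?F) \<inter> polys V'"
      using minor_ideal_eq[OF V _ X, of E K] E V' by blast
    have ei: "edge_ideal K V' E' = ideal_span (edge_monomial ` E') \<inter> polys V'"
      unfolding edge_ideal_def using E' polys_edge_monomial by (intro Idl_polynomial_ring) blast
    have "minor_ideal K V E X0 X1 = carrier (polynomial_ring K V') \<longleftrightarrow> {} \<in> ?F"
    proof -
      have em: "(edge_monomial {} :: ('a, 'k) mpoly) = 1" by (simp add: edge_monomial_def)
      have "minor_ideal K V E X0 X1 = carrier (polynomial_ring K V') \<longleftrightarrow>
        (edge_monomial {} :: ('a, 'k) mpoly) \<in> ideal_span (edge_monomial ` ?F)"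
        unfolding mi polynomial_ring_simps em
        using ideal_span_mult[of "1::('a, 'k) mpoly" "edge_monomial ` ?F"] by auto
      also have "\<dots> \<longleftrightarrow> (\<exists>e\<in>?F. e \<subseteq> {})"
        using F by (intro edge_monomial_mem_iff) (auto intro: finite_subset[OF _ finV'])
      finally show ?thesis by auto
    qed
    moreover have "edge_ideal K V' E' = minor_ideal K V E X0 X1 \<longleftrightarrow> refines E' ?F \<and> refines ?F E'"
      unfolding ei mi using refines_iff_ideal[OF finV' E' F, where 'k = 'k] refines_iff_ideal[OF finV' F E', where 'k = 'k]
      by (metis (no_types, lifting) subset_antisym subset_refl)
    ultimately show ?thesis by blast
  qed
  show ?thesis
    unfolding is_minor_def
  proof (rule conj_cong[OF refl], (rule ex_cong1)+)
    fix X0 X1 assume "clutter V' E'"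
    then show "(X0 \<subseteq> V \<and> X1 \<subseteq> V \<and> X0 \<inter> X1 = {} \<and> V' = V - (X0 \<union> X1) \<and>
        minor_ideal K V E X0 X1 \<noteq> carrier (polynomial_ring K V') \<and>
        edge_ideal K V' E' = minor_ideal K V E X0 X1) =
      (X0 \<subseteq> V \<and> X1 \<subseteq> V \<and> X0 \<inter> X1 = {} \<and> V' = V - (X0 \<union> X1) \<and>
        {} \<notin> minor_family E X0 X1 \<and> refines E' (minor_family E X0 X1) \<and> refines (minor_family E X0 X1) E')"
      using key[of X0 X1] by argo
  qed
qed

lemma refines_minimal:
  assumes "finite F"
  shows "refines F {e \<in> F. \<forall>f\<in>F. f \<subseteq> e \<longrightarrow> f = e}"
  unfolding refines_def
proof
  fix f assume "f \<in> F"
  then obtain m where "m \<in> F" "m \<subseteq> f" "\<And>g. g \<in> F \<Longrightarrow> g \<subseteq> m \<Longrightarrow> m = g"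
    using finite_has_minimal2[OF assms] by metis
  then show "\<exists>e\<in>{e \<in> F. \<forall>f\<in>F. f \<subseteq> e \<longrightarrow> f = e}. e \<subseteq> f" by blast
qed

context whiskered
begin

lemma edges_subset: "\<forall>e\<in>E. e \<subseteq> U" and E'_edges_subset: "\<forall>e\<in>E'. e \<subseteq> V"
  using edge_subset E'_subset by auto

text \<open>
  A cover that meets every surviving whisker in its vertex from \<open>U\<close> leaves only a minor of the
  original clutter to be covered, and the surviving whiskers enlarge every matching of that minor.
\<close>
lemma koenig_minor_family_whiskered:
  fixes K :: "'k::field itself"
  assumes pack: "packing_property K U E"
    and X: "X0 \<inter> X1 = {}" and ne: "{} \<notin> minor_family E' X0 X1"
  shows "koenig_property (V - (X0 \<union> X1)) (minor_family E' X0 X1)"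
proof -
  let ?F = "minor_family E' X0 X1" and ?V = "V - (X0 \<union> X1)"
  define I where "I = {v \<in> U. W v \<inter> X0 = {}}"
  \<comment> \<open>The vertices not set to 1 that carry a surviving whisker. They go into the
    cover, so the edges of \<open>E\<close> through them are taken care of; putting them into
    \<open>D0\<close> deletes these edges from the minor \<open>H\<close> of the original
    clutter.\<close>
  define I0 where "I0 = I - X1"
  define D0 where "D0 = (X0 \<inter> U) \<union> I0"
  define D1 where "D1 = X1 \<inter> U"
  define H where "H = minor_family E D0 D1"
  define E2 where "E2 = {e \<in> H. \<forall>f\<in>H. f \<subseteq> e \<longrightarrow> f = e}"
  have I0: "I0 \<subseteq> U" "I0 \<inter> X0 = {}" "I0 \<inter> X1 = {}"
    using self_in_W by (auto simp: I0_def I_def)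
  have Hmem: "\<exists>e\<in>E. e \<inter> X0 = {} \<and> e \<inter> I0 = {} \<and> h = e - X1" if "h \<in> H" for h
    using that edge_subset by (fastforce simp: H_def minor_family_def D0_def D1_def)
  have HI: "e - X1 \<in> H" if "e \<in> E" "e \<inter> X0 = {}" "e \<inter> I0 = {}" for e
  proof -
    have "e - X1 = e - D1" using edge_subset[OF that(1)] by (auto simp: D1_def)
    then show ?thesis using that by (auto simp: H_def minor_family_def D0_def)
  qed
  have HF: "H \<subseteq> ?F"
    using Hmem by (force simp: minor_family_def E'_def)
  have HU: "h \<subseteq> U - (D0 \<union> D1)" if "h \<in> H" for h
    using Hmem[OF that] edge_subset by (auto simp: D0_def D1_def)
  have finH: "finite H" unfolding H_def minor_family_def using finite_E by simp
  have cl: "clutter (U - (D0 \<union> D1)) E2"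
    unfolding clutter_def using finite_U HU by (auto simp: E2_def)
  have EH: "refines E2 H" "refines H E2"
    using refines_minimal[OF finH] by (auto simp: E2_def refines_def)
  have "is_minor K U E (U - (D0 \<union> D1)) E2"
    unfolding is_minor_iff[OF finite_U edges_subset]
  proof (intro conjI exI)
    show "{} \<notin> minor_family E D0 D1" "refines E2 (minor_family E D0 D1)" "refines (minor_family E D0 D1) E2"
      using HF ne EH by (auto simp flip: H_def)
    show "D0 \<inter> D1 = {}" using I0 X by (auto simp: D0_def D1_def)
    show "U - (D0 \<union> D1) = U - (D0 \<union> D1)" ..
  qed (use cl I0 in \<open>auto simp: D0_def D1_def\<close>)
  then have k2: "koenig_property (U - (D0 \<union> D1)) E2" using pack by (simp add: packing_property_def)
  have E2: "\<forall>e\<in>E2. e \<subseteq> U - (D0 \<union> D1) \<and> e \<noteq> {}"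
    using HU HF ne by (auto simp: E2_def)
  obtain T2 M2 where T2: "vertex_cover (U - (D0 \<union> D1)) E2 T2"
      and M2: "M2 \<subseteq> E2" "disjoint M2" "card T2 \<le> card M2"
    using k2 unfolding koenig_property_iff[OF finite_Diff[OF finite_U] E2] by (elim exE conjE) (rule that)
  have WF: "W v - X1 \<in> ?F" if "v \<in> I" for v
    using that by (auto simp: minor_family_def I_def E'_def)
  \<comment> \<open>The cover takes v itself if it still exists, since it also has to meet the edges
    through v. Otherwise any remaining vertex of the whisker serves; one is left because no member
    of the family is empty.\<close>
  then have "\<forall>v\<in>I. \<exists>u. u \<in> W v - X1 \<and> (v \<notin> X1 \<longrightarrow> u = v)"
    using ne self_in_W by (metis (no_types, lifting) Diff_iff I_def ex_in_conv mem_Collect_eq)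
  then obtain c where c: "\<And>v. v \<in> I \<Longrightarrow> c v \<in> W v - X1" "\<And>v. v \<in> I \<Longrightarrow> v \<notin> X1 \<Longrightarrow> c v = v" by metis
  define T where "T = T2 \<union> c ` I"
  define M where "M = M2 \<union> (\<lambda>v. W v - X1) ` I"
  have IU: "I \<subseteq> U" by (auto simp: I_def)
  have finI: "finite I" using IU finite_U finite_subset by blast
  have T2V: "T2 \<subseteq> U - (D0 \<union> D1)" using T2 by (auto simp: vertex_cover_def)
  have "vertex_cover ?V ?F T"
    unfolding vertex_cover_def
  proof
    have "T2 \<subseteq> ?V" using T2V U_subset_V by (auto simp: D0_def D1_def)
    moreover have "c ` I \<subseteq> ?V" using c(1) IU by (fastforce simp: I_def V_def)
    ultimately show "T \<subseteq> ?V" by (simp add: T_def)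
    show "\<forall>f\<in>?F. T \<inter> f \<noteq> {}"
    proof
      fix f assume "f \<in> ?F"
      then obtain e where e: "e \<in> E'" "e \<inter> X0 = {}" "f = e - X1" by (auto simp: minor_family_def)
      consider "e \<in> E" "e \<inter> I0 = {}" | "e \<in> E" "e \<inter> I0 \<noteq> {}" | v where "v \<in> U" "e = W v"
        using e(1) by (auto simp: E'_def)
      then show "T \<inter> f \<noteq> {}"
      proof cases
        case 1
        then have "f \<in> H" using HI e by simp
        then obtain g where "g \<in> E2" "g \<subseteq> f" using EH(2) unfolding refines_def by blast
        moreover from this have "T2 \<inter> g \<noteq> {}" using T2 by (simp add: vertex_cover_def)
        ultimately show ?thesis unfolding T_def by blast
      next
        case 2
        then obtain v where "v \<in> e" "v \<in> I" "v \<notin> X1" by (auto simp: I0_def)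
        then have "v \<in> T \<inter> f" using e c(2)[of v] by (auto simp: T_def intro: image_eqI[of _ c v])
        then show ?thesis by blast
      next
        case 3
        then have "c v \<in> T \<inter> f" using e c(1)[of v] by (auto simp: T_def I_def)
        then show ?thesis by blast
      qed
    qed
  qed
  moreover have "M \<subseteq> ?F" using M2(1) HF WF by (auto simp: M_def E2_def)
  moreover have disj1: "(W u - X1) \<inter> (W v - X1) = {}" if "u \<in> I" "v \<in> I" "u \<noteq> v" for u v
    using W_disjoint[of u v] that IU by blast
  moreover have disj2: "f \<inter> (W v - X1) = {}" if f: "f \<in> M2" and v: "v \<in> I" for f v
  proof -
    have fU: "f \<subseteq> U - (D0 \<union> D1)" using E2 M2(1) f by blast
    have "f \<inter> W v \<subseteq> {v}" using fU W_Int_U v IU by blast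
    moreover have "v \<notin> f - X1" using fU v by (auto simp: D0_def I0_def)
    ultimately show ?thesis by blast
  qed
  moreover have "disjoint M"
    unfolding M_def
  proof (rule disjoint_union)
    show "disjoint ((\<lambda>v. W v - X1) ` I)" using disj1 by (intro disjointI) blast
    show "\<Union> M2 \<inter> \<Union> ((\<lambda>v. W v - X1) ` I) = {}" using disj2 by blast
  qed (rule M2)
  moreover have "card T \<le> card M"
  proof -
    have "card T \<le> card T2 + card (c ` I)" unfolding T_def by (rule card_Un_le)
    also have "\<dots> \<le> card M2 + card I" using M2(3) finI by (intro add_mono card_image_le)
    also have "card I = card ((\<lambda>v. W v - X1) ` I)"
      using disj1 WF ne by (intro card_image[symmetric] inj_onI) (metis Int_absorb)
    also have "card M2 + \<dots> = card M"
      unfolding M_def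
    proof (rule card_Un_disjoint[symmetric])
      have "M2 \<subseteq> H" using M2(1) by (auto simp: E2_def)
      then show "finite M2" using finH by (rule finite_subset)
      show "finite ((\<lambda>v. W v - X1) ` I)" using finI by simp
      show "M2 \<inter> (\<lambda>v. W v - X1) ` I = {}"
      proof (rule ccontr)
        assume "M2 \<inter> (\<lambda>v. W v - X1) ` I \<noteq> {}"
        then obtain v where "v \<in> I" "W v - X1 \<in> M2" by blast
        then show False using disj2[of "W v - X1" v] WF ne by (metis Int_absorb)
      qed
    qed
    finally show ?thesis .
  qed
  ultimately have cert: "\<exists>T M. vertex_cover ?V ?F T \<and> M \<subseteq> ?F \<and> disjoint M \<and> card T \<le> card M" by (intro exI conjI)
  have F: "\<forall>f\<in>?F. f \<subseteq> ?V \<and> f \<noteq> {}"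
  proof
    fix f assume f: "f \<in> ?F"
    obtain e where "e \<in> E'" "e \<inter> X0 = {}" "f = e - X1" using f by (auto simp: minor_family_def)
    then show "f \<subseteq> ?V \<and> f \<noteq> {}" using E'_subset[of e] ne f by blast
  qed
  show ?thesis unfolding koenig_property_iff[OF finite_Diff[OF finite_V] F] by (rule cert)
qed

theorem packing_property_whiskered:
  fixes K :: "'k::field itself"
  assumes pack: "packing_property K U E"
  shows "packing_property K V E'"
  unfolding packing_property_def
proof (intro allI impI)
  fix V1 E1 assume "is_minor K V E' V1 E1"
  then obtain X0 X1 where cl: "clutter V1 E1" and X: "X0 \<inter> X1 = {}" and V1: "V1 = V - (X0 \<union> X1)"
    and ne: "{} \<notin> minor_family E' X0 X1" and r: "refines E1 (minor_family E' X0 X1)" "refines (minor_family E' X0 X1) E1"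
    unfolding is_minor_iff[OF finite_V E'_edges_subset] by blast
  have F: "\<forall>f\<in>minor_family E' X0 X1. f \<subseteq> V1 \<and> f \<noteq> {}"
  proof
    fix f assume f: "f \<in> minor_family E' X0 X1"
    obtain e where "e \<in> E'" "e \<inter> X0 = {}" "f = e - X1" using f by (auto simp: minor_family_def)
    then show "f \<subseteq> V1 \<and> f \<noteq> {}" using E'_subset[of e] ne f V1 by blast
  qed
  have E1: "\<forall>e\<in>E1. e \<subseteq> V1 \<and> e \<noteq> {}"
    using cl r(1) ne by (auto simp: clutter_def refines_def)
  then show "koenig_property V1 E1"
    using koenig_property_refines[OF _ F E1 r(2,1) koenig_minor_family_whiskered[OF pack X ne, folded V1]] finite_V V1
    by blast
qed

end

section \<open>Division by monic polynomials\<close>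

text \<open>The quotient in division by \<open>G\<close> with respect to v, captured without
  remainders as a left inverse of multiplication that is linear over the polynomials free of
  v.\<close>

definition monic_div :: "'v \<Rightarrow> ('v, 'k::comm_ring_1) mpoly \<Rightarrow> (('v, 'k) mpoly \<Rightarrow> ('v, 'k) mpoly) \<Rightarrow> bool" where
  "monic_div v G q \<longleftrightarrow> (\<forall>f g. q (f + g) = q f + q g) \<and> (\<forall>f. q (G * f) = f) \<and>
    (\<forall>h\<in>polys (- {v}). \<forall>f. q (h * f) = h * q f)"

lemma monic_divD:
  assumes "monic_div v G q"
  shows "q (f + g) = q f + q g" "q (G * f) = f" "h \<in> polys (- {v}) \<Longrightarrow> q (h * f) = h * q f"
  using assms by (auto simp: monic_div_def)

lemma monic_div_mult: "monic_div v G q \<Longrightarrow> monic_div v H r \<Longrightarrow> monic_div v (G * H) (\<lambda>f. r (q f))"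
  by (simp add: monic_div_def mult.assoc)

lemma monic_div_prod:
  assumes "finite A" "\<And>a. a \<in> A \<Longrightarrow> \<exists>q. monic_div v (G a) q"
  shows "\<exists>q. monic_div v (\<Prod>a\<in>A. G a) q"
  using assms
proof (induction A rule: finite_induct)
  case empty
  then show ?case by (intro exI[of _ "\<lambda>f. f"]) (simp add: monic_div_def)
next
  case (insert a A)
  then obtain q r where "monic_div v (G a) q" "monic_div v (\<Prod>a\<in>A. G a) r" by blast
  then show ?case using insert monic_div_mult[of v "G a" q] by (intro exI[of _ "\<lambda>f. r (q f)"]) simp
qed

text \<open>The quotient of x^a in division by x^e plus the lower terms c b x^b: one step
  contributes x^(a - e) and leaves the powers from the lower terms to be divided.\<close>

function quot_power :: "nat \<Rightarrow> (nat \<Rightarrow> 'a::comm_ring_1) \<Rightarrow> 'a \<Rightarrow> nat \<Rightarrow> 'a" where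
  "quot_power e c x a = (if a < e then 0 else x ^ (a - e) - (\<Sum>b<e. c b * quot_power e c x (a - e + b)))"
  by pat_completeness auto
termination by (relation "measure (\<lambda>(e, c, x, a). a)") auto

declare quot_power.simps [simp del]

lemma quot_power_step: "quot_power e c x (e + a) + (\<Sum>b<e. c b * quot_power e c x (b + a)) = x ^ a"
  by (subst quot_power.simps) (simp add: add.commute)

definition drop_var :: "'v \<Rightarrow> ('v \<Rightarrow>\<^sub>0 nat) \<Rightarrow> ('v \<Rightarrow>\<^sub>0 nat)" where
  "drop_var v m = m - Poly_Mapping.single v (Poly_Mapping.lookup m v)"

lemma lookup_drop_var: "Poly_Mapping.lookup (drop_var v m) u = (if u = v then 0 else Poly_Mapping.lookup m u)"
  by (auto simp: drop_var_def lookup_minus lookup_single when_def)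

lemma drop_var_add: "drop_var v (m + m') = drop_var v m + drop_var v m'"
  by (rule poly_mapping_eqI) (simp add: lookup_drop_var lookup_add)

lemma drop_var_single: "drop_var v (Poly_Mapping.single v n) = 0"
  by (rule poly_mapping_eqI) (simp add: lookup_drop_var lookup_single when_def)

lemma drop_var_id: "Poly_Mapping.lookup m v = 0 \<Longrightarrow> drop_var v m = m"
  by (rule poly_mapping_eqI) (simp add: lookup_drop_var)

lemma drop_var_decomp: "mon m = Var v ^ Poly_Mapping.lookup m v * mon (drop_var v m)"
proof -
  have "m = Poly_Mapping.single v (Poly_Mapping.lookup m v) + drop_var v m"
    by (rule poly_mapping_eqI) (simp add: lookup_drop_var lookup_add lookup_single when_def)
  then show ?thesis by (simp add: Var_power mult_single)
qed

text \<open>Monomials are divided one at a time: the power of v through \<open>quot_power\<close>,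
  the rest as a factor. The coefficients are free of v and pass through the operator, so
  \<open>quot_power_step\<close> gives the left inverse.\<close>

lemma exists_monic_div:
  assumes c: "\<And>b. b < e \<Longrightarrow> c b \<in> polys (- {v})"
  shows "\<exists>q. monic_div v (Var v ^ e + (\<Sum>b<e. c b * Var v ^ b)) q"
proof -
  define q where "q = lin (\<lambda>m. mon (drop_var v m) * quot_power e c (Var v) (Poly_Mapping.lookup m v))"
  have q_add: "q (f + g) = q f + q g" for f g by (simp add: q_def lin_add)
  have q_single: "q (Poly_Mapping.single m d) =
      coeff_poly d * (mon (drop_var v m) * quot_power e c (Var v) (Poly_Mapping.lookup m v))" for m d
    by (simp add: q_def lin_single)
  have q_mon: "q (Poly_Mapping.single \<mu> d * f) = Poly_Mapping.single \<mu> d * q f"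
    if \<mu>: "Poly_Mapping.lookup \<mu> v = 0" for \<mu> d f
  proof (induction f rule: poly_induct)
    case (single m d')
    have "coeff_poly (d * d') * mon (\<mu> + drop_var v m) =
        Poly_Mapping.single \<mu> d * (coeff_poly d' * mon (drop_var v m))" by (simp add: mult_single)
    then show ?case
      using \<mu> by (simp add: mult_single q_single drop_var_add drop_var_id lookup_add mult.assoc[symmetric])
  next
    case zero
    then show ?case by (simp add: q_def)
  next
    case (add p q')
    then show ?case by (simp add: q_add distrib_left)
  qed
  have q_free: "q (h * f) = h * q f" if h: "h \<in> polys (- {v})" for h f
  proof -
    have "q (Poly_Mapping.single m (Poly_Mapping.lookup h m) * f) =
      Poly_Mapping.single m (Poly_Mapping.lookup h m) * q f" if m: "m \<in> Poly_Mapping.keys h" for m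
    proof (rule q_mon)
      have "Poly_Mapping.keys m \<subseteq> - {v}" using h m by (auto simp: polys_def)
      then show "Poly_Mapping.lookup m v = 0" by (rule lookup_eq_0_outside) simp
    qed
    then have "(\<Sum>m\<in>Poly_Mapping.keys h. q (Poly_Mapping.single m (Poly_Mapping.lookup h m) * f)) =
      (\<Sum>m\<in>Poly_Mapping.keys h. Poly_Mapping.single m (Poly_Mapping.lookup h m) * q f)" by (rule sum.cong[OF refl])
    then have "q ((\<Sum>m\<in>Poly_Mapping.keys h. Poly_Mapping.single m (Poly_Mapping.lookup h m)) * f) =
      (\<Sum>m\<in>Poly_Mapping.keys h. Poly_Mapping.single m (Poly_Mapping.lookup h m)) * q f"
      by (simp only: sum_distrib_right additive_sum[of q, OF q_add])
    then show ?thesis by (simp only: poly_eq_sum_singles[symmetric])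
  qed
  have q_Var: "q (Var v ^ j * Poly_Mapping.single m d) =
      coeff_poly d * (mon (drop_var v m) * quot_power e c (Var v) (j + Poly_Mapping.lookup m v))" for j m d
    by (simp add: Var_power mult_single q_single drop_var_add drop_var_single lookup_add)
  have "q ((Var v ^ e + (\<Sum>b<e. c b * Var v ^ b)) * f) = f" for f
  proof (induction f rule: poly_induct)
    case zero
    then show ?case by (simp add: q_def)
  next
    case (single m d)
    let ?m = "Poly_Mapping.single m d" and ?a = "Poly_Mapping.lookup m v"
    have "q ((Var v ^ e + (\<Sum>b<e. c b * Var v ^ b)) * ?m) =
      q (Var v ^ e * ?m) + (\<Sum>b<e. q (c b * (Var v ^ b * ?m)))"
      by (simp only: distrib_right q_add sum_distrib_right additive_sum[of q, OF q_add] mult.assoc)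
    also have "(\<Sum>b<e. q (c b * (Var v ^ b * ?m))) = (\<Sum>b<e. c b * q (Var v ^ b * ?m))"
      using c by (intro sum.cong refl q_free) simp
    also have "q (Var v ^ e * ?m) + \<dots> = (coeff_poly d * mon (drop_var v m)) *
      (quot_power e c (Var v) (e + ?a) + (\<Sum>b<e. c b * quot_power e c (Var v) (b + ?a)))"
      unfolding q_Var by (simp add: distrib_left sum_distrib_left ac_simps)
    also have "\<dots> = coeff_poly d * (Var v ^ ?a * mon (drop_var v m))"
      by (simp add: quot_power_step ac_simps)
    also have "\<dots> = ?m" by (simp add: drop_var_decomp[symmetric] mult_single)
    finally show ?case .
  next
    case (add p q')
    then show ?case by (simp add: distrib_left q_add)
  qed
  then show ?thesis using q_add q_free by (intro exI[of _ q]) (simp add: monic_div_def)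
qed

lemma exists_monic_div_linear:
  "c \<in> polys (- {v}) \<Longrightarrow> \<exists>q. monic_div v (Var v + c) q"
  using exists_monic_div[of 1 "\<lambda>_. c" v] by simp

text \<open>Meant for operators that are additive but not linear over the whole ring, such as
  \<open>Q\<close> below; hence all multiples of a generator have to be tested, not just the
  generator.\<close>

lemma additive_ideal_span:
  assumes add: "\<And>f g. T (f + g) = T f + T g" and gen: "\<And>c g. g \<in> A \<Longrightarrow> T (c * g) \<in> ideal_span B"
    and p: "p \<in> ideal_span A"
  shows "T p \<in> ideal_span B"
  using p
proof (induction rule: ideal_span_induct)
  case base
  then show ?case using additive_0[of T, OF add] by (simp add: ideal_span_0)
next
  case (step c a p)
  then show ?case using gen by (simp add: add ideal_span_add)
qed

lemma polys_mono: "A \<subseteq> B \<Longrightarrow> polys A \<subseteq> polys B"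
  by (auto simp: polys_def)

section \<open>A regular sequence\<close>

context whiskered
begin

definition owner :: "'v \<Rightarrow> 'v" where
  "owner u = (THE v. v \<in> U \<and> u \<in> W v)"

lemma owner_eq: "v \<in> U \<Longrightarrow> u \<in> W v \<Longrightarrow> owner u = v"
  unfolding owner_def using W_disjoint by (intro the_equality) auto

lemma owner: "u \<in> V \<Longrightarrow> owner u \<in> U \<and> u \<in> W (owner u)"
  using owner_eq by (auto simp: V_def)

text \<open>Coordinate change to x and z = y - x. Afterwards the variable named y outside
  \<open>U\<close> stands for the difference z.\<close>

definition shift :: "('v, 'k::comm_ring_1) mpoly \<Rightarrow> ('v, 'k) mpoly" where
  "shift = poly_subst (\<lambda>u. if u \<in> V - U then Var u + Var (owner u) else Var u)"

definition unshift :: "('v, 'k::comm_ring_1) mpoly \<Rightarrow> ('v, 'k) mpoly" where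
  "unshift = poly_subst (\<lambda>u. if u \<in> V - U then Var u - Var (owner u) else Var u)"

lemmas shift_simps = subst_simps[of "\<lambda>u. if u \<in> V - U then Var u + Var (owner u) else Var u", folded shift_def]
lemmas unshift_simps = subst_simps[of "\<lambda>u. if u \<in> V - U then Var u - Var (owner u) else Var u", folded unshift_def]

lemma shift_Var: "shift (Var u) = (if u \<in> V - U then Var u + Var (owner u) else Var u)"
  and unshift_Var: "unshift (Var u) = (if u \<in> V - U then Var u - Var (owner u) else Var u)"
  by (simp_all add: shift_def unshift_def)

lemma unshift_coeff: "unshift (coeff_poly c) = coeff_poly c"
  by (simp add: unshift_def)

lemma unshift_shift: "unshift (shift p) = p"
proof -
  have "unshift (shift p) = poly_subst (\<lambda>u. unshift (if u \<in> V - U then Var u + Var (owner u) else Var u)) p"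
    unfolding shift_def by (simp add: unshift_def subst_subst)
  also have "(\<lambda>u. unshift (if u \<in> V - U then Var u + Var (owner u) else Var u)) = Var"
    by (rule ext) (use owner in \<open>auto simp: unshift_simps unshift_Var\<close>)
  finally show ?thesis by simp
qed

lemma shift_unshift: "shift (unshift p) = p"
proof -
  have "shift (unshift p) = poly_subst (\<lambda>u. shift (if u \<in> V - U then Var u - Var (owner u) else Var u)) p"
    unfolding unshift_def by (simp add: shift_def subst_subst)
  also have "(\<lambda>u. shift (if u \<in> V - U then Var u - Var (owner u) else Var u)) = Var"
    by (rule ext) (use owner in \<open>auto simp: shift_simps shift_Var\<close>)
  finally show ?thesis by simp
qed

definition shifted_whisker :: "'v \<Rightarrow> ('v, 'k::comm_ring_1) mpoly" where
  "shifted_whisker v = Var v * (\<Prod>y\<in>W v - {v}. Var v + Var y)"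

definition shifted_gens :: "('v, 'k::comm_ring_1) mpoly set" where
  "shifted_gens = edge_monomial ` E \<union> shifted_whisker ` U"

lemma shift_edge: "e \<in> E \<Longrightarrow> shift (edge_monomial e) = edge_monomial e"
  unfolding edge_monomial_def shift_simps
  using edge_subset by (intro prod.cong refl) (auto simp: shift_Var)

lemma shift_whisker:
  assumes v: "v \<in> U"
  shows "shift (edge_monomial (W v)) = (shifted_whisker v :: ('v, 'k::comm_ring_1) mpoly)"
proof -
  have "shift (edge_monomial (W v)) = (shift (Var v) * (\<Prod>y\<in>W v - {v}. shift (Var y)) :: ('v, 'k) mpoly)"
    unfolding edge_monomial_def shift_simps
    using finite_W[OF v] self_in_W[OF v] by (rule prod.remove)
  also have "shift (Var v) = Var v" using v by (simp add: shift_Var)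
  also have "(\<Prod>y\<in>W v - {v}. shift (Var y)) = (\<Prod>y\<in>W v - {v}. Var v + Var y :: ('v, 'k) mpoly)"
  proof (rule prod.cong)
    fix y assume y: "y \<in> W v - {v}"
    then have "y \<in> V - U" using v W_Int_U[OF v] by (auto simp: V_def)
    moreover have "owner y = v" using y v by (intro owner_eq) auto
    ultimately show "shift (Var y) = (Var v + Var y :: ('v, 'k) mpoly)" by (simp add: shift_Var add.commute)
  qed simp
  finally show ?thesis by (simp add: shifted_whisker_def)
qed

lemma shift_gens: "shift ` (edge_monomial ` E') = shifted_gens"
  unfolding E'_def shifted_gens_def image_Un image_image
  using shift_edge shift_whisker by (intro arg_cong2[where f = "(\<union>)"] image_cong refl) auto

lemma shift_ideal:
  fixes p :: "('v, 'k::comm_ring_1) mpoly"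
  assumes "p \<in> ideal_span (edge_monomial ` E' \<union> A)"
  shows "shift p \<in> ideal_span (shifted_gens \<union> shift ` A)"
proof (rule additive_ideal_span[OF _ _ assms])
  fix c g :: "('v, 'k) mpoly" assume "g \<in> edge_monomial ` E' \<union> A"
  then have "shift g \<in> shifted_gens \<union> shift ` A" using shift_gens by blast
  then show "shift (c * g) \<in> ideal_span (shifted_gens \<union> shift ` A)"
    by (simp add: shift_simps ideal_span_base ideal_span_mult)
qed (simp add: shift_simps)

lemma unshift_ideal:
  fixes p :: "('v, 'k::comm_ring_1) mpoly"
  assumes "p \<in> ideal_span (shifted_gens \<union> A)"
  shows "unshift p \<in> ideal_span (edge_monomial ` E' \<union> unshift ` A)"
proof (rule additive_ideal_span[OF _ _ assms])
  fix c g :: "('v, 'k) mpoly" assume "g \<in> shifted_gens \<union> A"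
  then have "unshift g \<in> edge_monomial ` E' \<union> unshift ` A"
    using shift_gens unshift_shift by (metis (no_types, lifting) Un_iff image_iff)
  then show "unshift (c * g) \<in> ideal_span (edge_monomial ` E' \<union> unshift ` A)"
    by (simp add: unshift_simps ideal_span_base ideal_span_mult)
qed (simp add: unshift_simps)

lemma shifted_whisker_free:
  assumes "v \<in> U" "u \<notin> W v"
  shows "shifted_whisker v \<in> polys (- {u})"
  unfolding shifted_whisker_def using assms self_in_W
  by (intro polys_mult polys_prod polys_add polys_Var) auto

lemma monic_div_shifted_whisker:
  assumes v: "v \<in> U"
  shows "\<exists>q. monic_div v (shifted_whisker v :: ('v, 'k::comm_ring_1) mpoly) q"
proof -
  have "\<exists>q. monic_div v (\<Prod>y\<in>W v - {v}. Var v + Var y :: ('v, 'k) mpoly) q"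
    using finite_W[OF v] by (intro monic_div_prod exists_monic_div_linear) auto
  then obtain q where q: "monic_div v (\<Prod>y\<in>W v - {v}. Var v + Var y :: ('v, 'k) mpoly) q" ..
  have "\<exists>q. monic_div v (Var v :: ('v, 'k) mpoly) q"
    using exists_monic_div_linear[of "0 :: ('v, 'k) mpoly" v] by simp
  then obtain r where r: "monic_div v (Var v :: ('v, 'k) mpoly) r" ..
  show ?thesis
    unfolding shifted_whisker_def
    by (intro exI[of _ "\<lambda>f. q (r f)"] monic_div_mult[OF r q])
qed

text \<open>
  The quotient by the shifted ideal is a free module over the polynomials in the variables
  \<open>V - U\<close>, with normal forms obtained by dividing by the shifted whiskers. Dividing normal forms
  by a monic \<open>G\<close> in the variable \<open>y\<close> alone yields an operator that is inverse to multiplication by \<open>G\<close>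
  and linear over the other variables.
\<close>
lemma exists_quotient_operator:
  fixes G :: "('v, 'k::comm_ring_1) mpoly"
  assumes y: "y \<in> V - U" and G: "G \<in> polys {y}" "\<exists>q. monic_div y G q"
  shows "\<exists>Q. (\<forall>f g. Q (f + g) = Q f + Q g) \<and>
    (\<forall>f. \<forall>g\<in>shifted_gens. Q (f * g) \<in> ideal_span shifted_gens) \<and>
    (\<forall>f. Q (G * f) - f \<in> ideal_span shifted_gens) \<and>
    (\<forall>f. \<forall>z\<in>V - U. z \<noteq> y \<longrightarrow> (\<forall>H\<in>polys {z}. Q (H * f) = H * Q f))"
proof -
  define v where "v = owner y"
  have v: "v \<in> U" "y \<in> W v" "y \<noteq> v" using owner[of y] y by (auto simp: v_def)
  obtain q where q: "monic_div y G q" using G(2) by blast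
  obtain r where r: "monic_div v (shifted_whisker v :: ('v, 'k) mpoly) r" using monic_div_shifted_whisker[OF v(1)] by blast
  note q' = monic_divD[OF q] and r' = monic_divD[OF r]
  define F :: "('v, 'k) mpoly" where "F = shifted_whisker v"
  \<comment> \<open>Remainder modulo the one whisker that contains y. The other whiskers involve
    neither v nor y and pass through \<open>Q\<close> unchanged.\<close>
  define nf where "nf f = f - F * r f" for f
  define Q where "Q f = q (nf f)" for f
  have q_0: "q 0 = 0" using q'(1) by (rule additive_0)
  have nf_add: "nf (f + g) = nf f + nf g" for f g by (simp add: nf_def r' algebra_simps)
  have nf_free: "nf (h * f) = h * nf f" if "h \<in> polys (- {v})" for h f
    using r'(3)[OF that] by (simp add: nf_def algebra_simps)
  have Q_free: "Q (h * f) = h * Q f" if "h \<in> polys (- {v})" "h \<in> polys (- {y})" for h f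
    by (simp add: Q_def nf_free[OF that(1)] q'(3)[OF that(2)])
  have inI: "c * g \<in> ideal_span shifted_gens" "g * c \<in> ideal_span shifted_gens"
    if "g \<in> shifted_gens" for c g :: "('v, 'k) mpoly"
    using that ideal_span_mult[OF ideal_span_base[OF that], of c] by (simp_all add: mult.commute)
  have FI: "F \<in> shifted_gens" using v by (simp add: F_def shifted_gens_def)
  have key: "Q (g * f) \<in> ideal_span shifted_gens" if g: "g \<in> shifted_gens" for f g
  proof -
    consider e where "e \<in> E" "v \<notin> e" "g = edge_monomial e" | e where "e \<in> E" "v \<in> e" "g = edge_monomial e"
      | "g = F" | w where "w \<in> U" "w \<noteq> v" "g = shifted_whisker w"
      using g by (auto simp: shifted_gens_def F_def)
    then show ?thesis
    proof cases
      case 1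
      have "y \<notin> e" using edge_subset[OF 1(1)] y by blast
      then have "g \<in> polys (- {v})" "g \<in> polys (- {y})"
        unfolding 1(3) using 1(2) by (auto intro!: polys_edge_monomial)
      then have "Q (g * f) = g * Q f" by (rule Q_free)
      then show ?thesis using inI(2)[OF g] by simp
    next
      case 2
      \<comment> \<open>The critical case: the edge and F share the factor v, so the remainder of v
        f is again v times a polynomial. Together with \<open>g'\<close> the whole edge g comes out
        of \<open>nf\<close>, and it passes through q because it is free of y.\<close>
      define g' :: "('v, 'k) mpoly" where "g' = edge_monomial (e - {v})"
      have "finite e" using edge_subset[OF 2(1)] finite_U by (rule finite_subset)
      then have gg': "g = g' * Var v"
        unfolding 2(3) g'_def edge_monomial_def using 2(2) by (simp add: prod.remove mult.commute)
      have "y \<notin> e" using edge_subset[OF 2(1)] y by blast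
      then have gy: "g \<in> polys (- {y})" unfolding 2(3) by (auto intro!: polys_edge_monomial)
      have "g' \<in> polys (- {v})" unfolding g'_def by (auto intro!: polys_edge_monomial)
      then have "nf (g * f) = g' * nf (Var v * f)" using nf_free by (simp add: gg' mult.assoc)
      also have "\<dots> = g * (f - (\<Prod>y\<in>W v - {v}. Var v + Var y) * r (Var v * f))"
        by (simp add: nf_def F_def shifted_whisker_def gg' algebra_simps)
      finally have "Q (g * f) = g * q (f - (\<Prod>y\<in>W v - {v}. Var v + Var y) * r (Var v * f))"
        by (simp add: Q_def q'(3)[OF gy])
      then show ?thesis using inI(2)[OF g] by simp
    next
      case 3
      then have "nf (g * f) = 0" using r'(2)[of f] by (simp add: nf_def F_def)
      then show ?thesis by (simp add: Q_def q_0 ideal_span_0)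
    next
      case 4
      have "v \<notin> W w" "y \<notin> W w" using W_disjoint[of w v] 4 v self_in_W[OF v(1)] by auto
      then have "Q (g * f) = g * Q f"
        unfolding 4(3) using 4(1) by (intro Q_free shifted_whisker_free)
      then show ?thesis using inI(2)[OF g] by simp
    qed
  qed
  have "Q (f * g) \<in> ideal_span shifted_gens" if "g \<in> shifted_gens" for f g
    using key[OF that, of f] by (simp only: mult.commute)
  moreover have "Q (G * f) - f \<in> ideal_span shifted_gens" for f
  proof -
    have "G \<in> polys (- {v})" using G(1) polys_mono[of "{y}" "- {v}"] v(3) by auto
    \<comment> \<open>\<open>G\<close> does not involve v, so it passes through \<open>nf\<close>
      and is then cancelled by q; what remains differs from f by a multiple of F.\<close>
    then have "Q (G * f) = nf f" by (simp add: Q_def nf_free q'(2))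
    then have "Q (G * f) - f = (- r f) * F" by (simp add: nf_def)
    then show ?thesis using inI(1)[OF FI] by metis
  qed
  moreover have "Q (H * f) = H * Q f" if "z \<in> V - U" "z \<noteq> y" "H \<in> polys {z}" for H f z
  proof (rule Q_free)
    show "H \<in> polys (- {v})" using that polys_mono[of "{z}" "- {v}"] v(1) by auto
    show "H \<in> polys (- {y})" using that polys_mono[of "{z}" "- {y}"] by auto
  qed
  moreover have "Q (f + g) = Q f + Q g" for f g by (simp add: Q_def nf_add q'(1))
  ultimately show ?thesis by (intro exI[of _ Q]) simp
qed

text \<open>\<open>Z\<close> will be the set of variables of an initial segment of the sequence.
  \<open>Q\<close> commutes with the elements of that segment, because each is a polynomial in a
  single difference other than y.\<close>

lemma shifted_regular:
  fixes G :: "'v \<Rightarrow> ('v, 'k::comm_ring_1) mpoly"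
  assumes G: "\<And>z. z \<in> V - U \<Longrightarrow> G z \<in> polys {z} \<and> (\<exists>q. monic_div z (G z) q)"
    and y: "y \<in> V - U" and Z: "Z \<subseteq> V - U" "y \<notin> Z"
    and mem: "unshift (G y) * a \<in> ideal_span (edge_monomial ` E' \<union> unshift ` G ` Z)"
  shows "a \<in> ideal_span (edge_monomial ` E' \<union> unshift ` G ` Z)"
proof -
  have Gy: "G y \<in> polys {y}" "\<exists>q. monic_div y (G y) q" using G[OF y] by auto
  obtain Q where Q: "\<forall>f g. Q (f + g) = Q f + Q g"
    "\<forall>f. \<forall>g\<in>shifted_gens. Q (f * g) \<in> ideal_span shifted_gens"
    "\<forall>f. Q (G y * f) - f \<in> ideal_span shifted_gens"
    "\<forall>f. \<forall>z\<in>V - U. z \<noteq> y \<longrightarrow> (\<forall>H\<in>polys {z}. Q (H * f) = H * Q f)"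
    using exists_quotient_operator[OF y Gy] by (elim exE conjE) (rule that)
  let ?J = "ideal_span (shifted_gens \<union> G ` Z)"
  have sub: "ideal_span shifted_gens \<subseteq> ?J" by (rule ideal_span_mono) simp
  have im: "shift ` unshift ` G ` Z = G ` Z" by (simp add: image_image shift_unshift)
  have "shift (unshift (G y) * a) \<in> ?J" using shift_ideal[OF mem] by (simp only: im)
  then have "G y * shift a \<in> ?J" by (simp add: shift_simps shift_unshift)
  then have "Q (G y * shift a) \<in> ?J"
  proof (rule additive_ideal_span[rotated 2])
    show "Q (f + g) = Q f + Q g" for f g using Q(1) by blast
    fix c g assume "g \<in> shifted_gens \<union> G ` Z"
    then show "Q (c * g) \<in> ?J"
    proof
      assume "g \<in> shifted_gens"
      then show ?thesis using Q(2) sub by blast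
    next
      assume "g \<in> G ` Z"
      then obtain z where z: "z \<in> Z" "g = G z" by blast
      have zV: "z \<in> V - U" "z \<noteq> y" using z Z by auto
      have "Q (g * c) = g * Q c" using Q(4) G[OF zV(1)] zV z(2) by blast
      moreover have "Q c * g \<in> ?J" using z by (intro ideal_span_mult ideal_span_base) auto
      ultimately show ?thesis by (simp add: mult.commute)
    qed
  qed
  moreover have "Q (G y * shift a) - shift a \<in> ?J" using Q(3) sub by blast
  ultimately have "Q (G y * shift a) - (Q (G y * shift a) - shift a) \<in> ?J" by (rule ideal_span_diff)
  then have "shift a \<in> ?J" by simp
  then have "unshift (shift a) \<in> ideal_span (edge_monomial ` E' \<union> unshift ` G ` Z)" by (rule unshift_ideal)
  then show ?thesis by (simp only: unshift_shift)
qed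

lemma card_face_le:
  assumes s: "s \<subseteq> V" "\<forall>e\<in>E'. \<not> e \<subseteq> s"
  shows "card s \<le> card (V - U)"
proof -
  have "\<forall>v\<in>U. \<exists>u. u \<in> W v - s" using s(2) by (auto simp: E'_def)
  from bchoice[OF this] obtain c where c: "\<forall>v\<in>U. c v \<in> W v - s" by blast
  have "inj_on c U"
  proof (rule inj_onI, rule ccontr)
    fix u v assume "u \<in> U" "v \<in> U" "c u = c v" "u \<noteq> v"
    then show False using W_disjoint[of u v] c by (metis DiffD1 disjoint_iff)
  qed
  then have "card (c ` U) = card U" by (rule card_image)
  moreover have "c ` U \<subseteq> V" using c by (auto simp: V_def)
  moreover have "s \<subseteq> V - c ` U" using s(1) c by auto
  ultimately show ?thesis
    using finite_V finite_U U_subset_V card_mono[of "V - c ` U" s]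
    by (simp add: card_Diff_subset finite_subset)
qed

lemma exists_regular_sequence:
  fixes K :: "'k::field itself"
  assumes M: "maximalideal M (polynomial_ring K V Quot edge_ideal K V E')"
  shows "\<exists>fs. regular_sequence (polynomial_ring K V Quot edge_ideal K V E') fs \<and> set fs \<subseteq> M \<and>
    length fs = card (V - U)"
proof -
  let ?R = "polynomial_ring K V" and ?I = "edge_ideal K V E'"
  let ?Q = "?R Quot ?I"
  interpret R: cring ?R by (rule cring_polynomial_ring)
  have EV: "(edge_monomial ` E' :: ('v, 'k) mpoly set) \<subseteq> polys V" using E'_subset polys_edge_monomial by blast
  have I: "ideal ?I ?R" unfolding edge_ideal_def using EV by (intro R.genideal_ideal) simp
  interpret h: ring_hom_cring ?R ?Q "(+>\<^bsub>?R\<^esub>) ?I" by (rule R.coset_hom[OF I])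
  interpret M: maximalideal M ?Q by (rule M)
  define M0 where "M0 = {r \<in> carrier ?R. ?I +>\<^bsub>?R\<^esub> r \<in> M}"
  have M0: "ideal M0 ?R" unfolding M0_def by (rule R.ideal_coset_preimage[OF I M.is_ideal])
  note M0' = ideal_polynomial_ringD[OF M0]
  have IM0: "?I \<subseteq> M0"
    unfolding M0_def by (rule R.ideal_subset_coset_preimage[OF I M.is_ideal])
  have one: "1 \<notin> M0"
  proof
    assume "1 \<in> M0"
    then have "?I +>\<^bsub>?R\<^esub> \<one>\<^bsub>?R\<^esub> \<in> M" by (simp add: M0_def)
    then have "\<one>\<^bsub>?Q\<^esub> \<in> M" by (simp only: h.hom_one)
    then show False using M.I_notcarr M.one_imp_carrier by blast
  qed
  \<comment> \<open>The preimage of \<open>M\<close> in the ring of all variables. Killing the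
    variables outside \<open>V\<close> first leaves the residue field unchanged and supplies the
    condition \<open>out\<close> of \<open>zariski_lemma\<close>.\<close>
  interpret residue_field "{p. restrict_vars V p \<in> M0}"
  proof
    show "0 \<in> {p. restrict_vars V p \<in> M0}" using M0'(2) by simp
    show "p + q \<in> {p. restrict_vars V p \<in> M0}"
      if "p \<in> {p. restrict_vars V p \<in> M0}" "q \<in> {p. restrict_vars V p \<in> M0}" for p q
      using that M0'(3) by (simp add: restrict_simps)
    show "q * p \<in> {p. restrict_vars V p \<in> M0}" if "p \<in> {p. restrict_vars V p \<in> M0}" for p q
      using that M0'(4) by (simp add: restrict_simps)
    show "1 \<notin> {p. restrict_vars V p \<in> M0}" using one by simp
    fix p assume "p \<notin> {p. restrict_vars V p \<in> M0}"
    then have p: "restrict_vars V p \<notin> M0" by simp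
    let ?p = "restrict_vars V p"
    let ?x = "?I +>\<^bsub>?R\<^esub> ?p"
    have x: "?x \<in> carrier ?Q" "?x \<notin> M" using p by (auto simp: M0_def coset_carrier)
    let ?N = "{m \<oplus>\<^bsub>?Q\<^esub> r \<otimes>\<^bsub>?Q\<^esub> ?x | m r. m \<in> M \<and> r \<in> carrier ?Q}"
    note N = h.S.ideal_add_principal[OF M.is_ideal x(1)]
    have "?N = carrier ?Q"
      using M.I_maximal[OF N(1,2) h.S.ideal_closedD(1)[OF N(1)]] N(3) x(2) by blast
    then have "\<one>\<^bsub>?Q\<^esub> \<in> ?N" by simp
    then obtain m r where mr: "m \<in> M" "r \<in> carrier ?Q" "\<one>\<^bsub>?Q\<^esub> = m \<oplus>\<^bsub>?Q\<^esub> r \<otimes>\<^bsub>?Q\<^esub> ?x" by blast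
    have "m \<in> carrier ?Q" using mr(1) h.S.ideal_closedD(1)[OF M.is_ideal] by blast
    then obtain m0 where m0: "m0 \<in> carrier ?R" "m = ?I +>\<^bsub>?R\<^esub> m0" unfolding coset_carrier by blast
    obtain q where q: "q \<in> carrier ?R" "r = ?I +>\<^bsub>?R\<^esub> q" using mr(2) unfolding coset_carrier by blast
    have "?I +>\<^bsub>?R\<^esub> \<one>\<^bsub>?R\<^esub> = ?I +>\<^bsub>?R\<^esub> (m0 \<oplus>\<^bsub>?R\<^esub> q \<otimes>\<^bsub>?R\<^esub> ?p)"
      using mr(3) m0 q h.hom_one h.hom_add h.hom_mult
      by (metis R.m_closed polynomial_ring_simps(1) restrict_vars_polys)
    moreover have qp: "m0 \<oplus>\<^bsub>?R\<^esub> q \<otimes>\<^bsub>?R\<^esub> ?p \<in> carrier ?R" using m0 q by simp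
    ultimately have "\<one>\<^bsub>?R\<^esub> \<ominus>\<^bsub>?R\<^esub> (m0 \<oplus>\<^bsub>?R\<^esub> q \<otimes>\<^bsub>?R\<^esub> ?p) \<in> ?I"
      using R.coset_eq_iff[OF I R.one_closed qp] by blast
    moreover have "\<one>\<^bsub>?R\<^esub> \<ominus>\<^bsub>?R\<^esub> (m0 \<oplus>\<^bsub>?R\<^esub> q \<otimes>\<^bsub>?R\<^esub> ?p) = 1 - (m0 + q * ?p)"
    proof -
      have "\<ominus>\<^bsub>?R\<^esub> b = - b" if "b \<in> polys V" for b
        using that by (intro R.minus_equality) auto
      then show ?thesis using m0 q by (simp add: a_minus_def)
    qed
    ultimately have "1 - (m0 + q * ?p) \<in> M0" using IM0 by auto
    moreover have "m0 \<in> M0" using m0 mr(1) by (simp add: M0_def)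
    ultimately have "(- 1) * ((1 - (m0 + q * ?p)) + m0) \<in> M0" by (intro M0'(3,4)) auto
    moreover have "(- 1) * ((1 - (m0 + q * ?p)) + m0) = ?p * q - 1" by (simp add: algebra_simps)
    ultimately have "?p * q - 1 \<in> M0" by (simp only:)
    moreover have "restrict_vars V (p * q - 1) = ?p * q - 1"
      using q by (simp add: restrict_simps restrict_vars_id)
    ultimately show "\<exists>q. p * q - 1 \<in> {p. restrict_vars V p \<in> M0}" by (intro exI[of _ q]) simp
  qed
  have "\<forall>y. \<exists>e c. (Var y - Var (owner y)) ^ e + (\<Sum>b<e. coeff_poly (c b) * (Var y - Var (owner y)) ^ b)
      \<in> {p. restrict_vars V p \<in> M0}"
    using M0'(2) by (intro allI zariski_lemma[OF finite_V]) (simp add: restrict_vars_def)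
  from choice[OF this] obtain e where "\<forall>y. \<exists>c. (Var y - Var (owner y)) ^ e y +
      (\<Sum>b<e y. coeff_poly (c b) * (Var y - Var (owner y)) ^ b) \<in> {p. restrict_vars V p \<in> M0}"
    by (elim exE) (rule that)
  from choice[OF this] obtain c where ec: "\<forall>y. (Var y - Var (owner y)) ^ e y +
      (\<Sum>b<e y. coeff_poly (c y b) * (Var y - Var (owner y)) ^ b) \<in> {p. restrict_vars V p \<in> M0}"
    by (elim exE) (rule that)
  \<comment> \<open>The relation with a plain variable in place of the difference.
    \<open>G y\<close> lives in the shifted coordinates, and \<open>unshift\<close> restores y minus
    its owner.\<close>
  define G :: "'v \<Rightarrow> ('v, 'k) mpoly" where "G y = Var y ^ e y + (\<Sum>b<e y. coeff_poly (c y b) * Var y ^ b)" for y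
  have G: "G y \<in> polys {y} \<and> (\<exists>q. monic_div y (G y) q)" for y
    unfolding G_def by (intro conjI exists_monic_div polys_add polys_sum polys_mult polys_power) auto
  have gV: "unshift (G y) \<in> polys V" if y: "y \<in> V - U" for y
    unfolding unshift_def
  proof (rule polys_subst)
    show "G y \<in> polys {y}" using G by blast
    show "(if u \<in> V - U then Var u - Var (owner u) else Var u) \<in> polys V" if "u \<in> {y}" for u
      using that y owner[of y] U_subset_V by auto
  qed
  have gM: "unshift (G y) \<in> M0" if y: "y \<in> V - U" for y
  proof -
    have "unshift (G y) = (Var y - Var (owner y)) ^ e y + (\<Sum>b<e y. coeff_poly (c y b) * (Var y - Var (owner y)) ^ b)"
      using y by (simp add: G_def unshift_simps unshift_Var unshift_coeff)
    then show ?thesis using ec[rule_format, of y] restrict_vars_id[OF gV[OF y]] by simp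
  qed
  obtain ys where ys: "set ys = V - U" "distinct ys" using finite_distinct_list[of "V - U"] finite_V by blast
  define fs where "fs = map (\<lambda>y. unshift (G y)) ys"
  have fsV: "set fs \<subseteq> carrier ?R" using gV ys by (auto simp: fs_def)
  have fsM: "set fs \<subseteq> M0" using gM ys by (auto simp: fs_def)
  have Idl: "Idl\<^bsub>?R\<^esub> (?I \<union> A) = ideal_span (edge_monomial ` E' \<union> A) \<inter> polys V" if A: "A \<subseteq> polys V" for A
  proof -
    have EA: "edge_monomial ` E' \<union> A \<subseteq> carrier ?R" using EV A by simp
    have IA: "?I \<union> A \<subseteq> carrier ?R" using R.ideal_closedD(1)[OF I] A by simp
    have gen: "edge_monomial ` E' \<union> A \<subseteq> Idl\<^bsub>?R\<^esub> (edge_monomial ` E' \<union> A)" by (rule R.genideal_self[OF EA])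
    have "?I \<subseteq> Idl\<^bsub>?R\<^esub> (edge_monomial ` E' \<union> A)"
      unfolding edge_ideal_def using EA by (intro R.subset_Idl_subset) auto
    then have "Idl\<^bsub>?R\<^esub> (?I \<union> A) \<subseteq> Idl\<^bsub>?R\<^esub> (edge_monomial ` E' \<union> A)"
      using gen by (intro R.genideal_minimal R.genideal_ideal EA) auto
    moreover have "edge_monomial ` E' \<subseteq> ?I" unfolding edge_ideal_def using EV by (intro R.genideal_self) simp
    then have "Idl\<^bsub>?R\<^esub> (edge_monomial ` E' \<union> A) \<subseteq> Idl\<^bsub>?R\<^esub> (?I \<union> A)"
      by (intro R.subset_Idl_subset IA) auto
    ultimately show ?thesis using Idl_polynomial_ring[of "edge_monomial ` E' \<union> A" V K] EA by auto
  qed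
  have "regular_sequence ?Q (map ((+>\<^bsub>?R\<^esub>) ?I) fs)"
  proof (rule R.regular_sequence_quotient[OF I fsV])
    fix i a assume i: "i < length fs" and a: "a \<in> carrier ?R"
      and mem: "fs ! i \<otimes>\<^bsub>?R\<^esub> a \<in> Idl\<^bsub>?R\<^esub> (?I \<union> set (take i fs))"
    have take: "set (take i fs) = unshift ` G ` set (take i ys)" by (simp add: fs_def take_map image_image)
    have tV: "set (take i fs) \<subseteq> polys V" using fsV set_take_subset[of i fs] by auto
    have "ys ! i \<in> V - U" using i ys nth_mem[of i ys] by (simp add: fs_def)
    moreover have "set (take i ys) \<subseteq> V - U" using ys set_take_subset[of i ys] by simp
    moreover have "ys ! i \<notin> set (take i ys)"
      using ys(2) i by (auto simp: fs_def in_set_conv_nth nth_eq_iff_index_eq)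
    moreover have "unshift (G (ys ! i)) * a \<in> ideal_span (edge_monomial ` E' \<union> unshift ` G ` set (take i ys))"
      using mem i unfolding Idl[OF tV] unfolding take by (simp add: fs_def)
    ultimately have "a \<in> ideal_span (edge_monomial ` E' \<union> unshift ` G ` set (take i ys))"
      using G by (intro shifted_regular[of G "ys ! i" "set (take i ys)" a]) auto
    then show "a \<in> Idl\<^bsub>?R\<^esub> (?I \<union> set (take i fs))" unfolding Idl[OF tV] unfolding take using a by simp
  next
    have "Idl\<^bsub>?R\<^esub> (?I \<union> set fs) \<subseteq> M0" using IM0 fsM by (intro R.genideal_minimal M0) auto
    then show "\<one>\<^bsub>?R\<^esub> \<notin> Idl\<^bsub>?R\<^esub> (?I \<union> set fs)" using one by auto
  qed
  moreover have "set (map ((+>\<^bsub>?R\<^esub>) ?I) fs) \<subseteq> M" using fsM by (auto simp: M0_def)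
  moreover have "length (map ((+>\<^bsub>?R\<^esub>) ?I) fs) = card (V - U)"
    using ys distinct_card[of ys] by (simp add: fs_def)
  ultimately show ?thesis by (intro exI conjI)
qed

theorem cohen_macaulay_whiskered:
  fixes K :: "'k::field itself"
  shows "cohen_macaulay (polynomial_ring K V Quot edge_ideal K V E')"
proof -
  let ?R = "polynomial_ring K V" and ?I = "edge_ideal K V E'"
  interpret R: cring ?R by (rule cring_polynomial_ring)
  have "(edge_monomial ` E' :: ('v, 'k) mpoly set) \<subseteq> polys V" using E'_subset polys_edge_monomial by blast
  then have I: "ideal ?I ?R" unfolding edge_ideal_def by (intro R.genideal_ideal) simp
  interpret Q: cring "?R Quot ?I" by (rule ideal.quotient_is_cring[OF I R.is_cring])
  show ?thesis
  proof (rule Q.cohen_macaulayI)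
    show "noetherian_ring (?R Quot ?I)"
      by (rule R.noetherian_quotient[OF I noetherian_polynomial_ring[OF finite_V]])
    show "krull_dim (?R Quot ?I) \<le> enat (card (V - U))"
      using E'_subset card_face_le by (intro krull_dim_edge_ring[OF finite_V]) blast+
  qed (rule exists_regular_sequence)
qed

end

theorem theorem3p3:
  fixes K :: "'k::field itself"
    and n d :: nat
    and x :: "nat \<Rightarrow> 'v" and y :: "nat \<Rightarrow> nat \<Rightarrow> 'v"
    and VX VY :: "'v set" and E E' :: "'v set set"
  assumes "n \<ge> 1"
    and "inj_on x {1..n}" and "VX = x ` {1..n}"
    and "clutter VX E" and "uniform d E" and "\<Union>E = VX"
    and "inj_on (\<lambda>(i, j). y i j) ({1..n} \<times> {1..d - 1})"
    and "VY = (\<lambda>(i, j). y i j) ` ({1..n} \<times> {1..d - 1})"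
    and "VX \<inter> VY = {}"
    and "E' = E \<union> (\<lambda>i. {x i} \<union> y i ` {1..d - 1}) ` {1..n}"
  shows "cohen_macaulay (polynomial_ring K (VX \<union> VY) Quot edge_ideal K (VX \<union> VY) E') \<and>
    (packing_property K VX E \<longrightarrow> packing_property K (VX \<union> VY) E') \<and>
    (max_flow_min_cut VX E \<longrightarrow> max_flow_min_cut (VX \<union> VY) E')"
proof -
  \<comment> \<open>Inverts the enumeration x, so that the whisker becomes a function of its
    vertex.\<close>
  define ix where "ix = the_inv_into {1..n} x"
  have ix: "ix (x i) = i" if "i \<in> {1..n}" for i
    unfolding ix_def using assms(2) that by (rule the_inv_into_f_f)
  define W where "W v = {v} \<union> y (ix v) ` {1..d - 1}" for v
  have Wx: "W (x i) = {x i} \<union> y i ` {1..d - 1}" if "i \<in> {1..n}" for i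
    using ix[OF that] by (simp add: W_def)
  have yVY: "y i j \<in> VY" if "i \<in> {1..n}" "j \<in> {1..d - 1}" for i j
    using that assms(8) by force
  have yVX: "y i j \<notin> VX" if "i \<in> {1..n}" "j \<in> {1..d - 1}" for i j
    using yVY[OF that] assms(9) by blast
  have yinj: "y i j \<noteq> y i' j'" if "i \<in> {1..n}" "j \<in> {1..d - 1}" "i' \<in> {1..n}" "j' \<in> {1..d - 1}" "i \<noteq> i'" for i j i' j'
    using inj_onD[OF assms(7), of "(i, j)" "(i', j')"] that by auto
  \<comment> \<open>An empty edge lies in every edge, so in a clutter it would be the only one, and
    the edges could not cover the nonempty \<open>VX\<close>.\<close>
  have e0: "e \<noteq> {}" if e: "e \<in> E" for e
  proof
    assume "e = {}"
    then have "f = {}" if "f \<in> E" for f using assms(4) e that by (auto simp: clutter_def)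
    then have "VX = {}" using assms(6) by blast
    moreover have "x 1 \<in> VX" using assms(1,3) by simp
    ultimately show False by blast
  qed
  interpret whiskered VX E W
  proof
    show "finite VX" using assms(3) by simp
    show "e \<subseteq> VX" if "e \<in> E" for e using that assms(6) by blast
    show "e \<noteq> {}" if "e \<in> E" for e using e0[OF that] .
    show "finite (W v)" for v by (simp add: W_def)
    show "W v \<inter> VX = {v}" if v: "v \<in> VX" for v
    proof -
      obtain i where i: "i \<in> {1..n}" "v = x i" using v assms(3) by blast
      then show ?thesis using Wx[OF i(1)] yVX[OF i(1)] v by auto
    qed
    fix u v assume uv: "u \<in> VX" "v \<in> VX" "u \<noteq> v"
    obtain i j where ij: "i \<in> {1..n}" "u = x i" "j \<in> {1..n}" "v = x j" using uv assms(3) by blast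
    then have "i \<noteq> j" using uv by blast
    show "W u \<inter> W v = {}"
    proof (rule ccontr)
      assume "W u \<inter> W v \<noteq> {}"
      then obtain a where a: "a \<in> W u" "a \<in> W v" by blast
      have "a = u \<or> (\<exists>k\<in>{1..d - 1}. a = y i k)" using a(1) Wx[OF ij(1)] ij(2) by blast
      moreover have "a = v \<or> (\<exists>k\<in>{1..d - 1}. a = y j k)" using a(2) Wx[OF ij(3)] ij(4) by blast
      ultimately show False
        using uv yVX[OF ij(1)] yVX[OF ij(3)] yinj[OF ij(1) _ ij(3) _ \<open>i \<noteq> j\<close>] by metis
    qed
  qed
  have "V = (\<Union>i\<in>{1..n}. W (x i))" by (subst V_def) (simp add: assms(3))
  also have "\<dots> = (\<Union>i\<in>{1..n}. {x i} \<union> y i ` {1..d - 1})" by (rule SUP_cong[OF refl Wx])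
  also have "\<dots> = VX \<union> VY" unfolding assms(3,8) by auto
  finally have V_eq: "V = VX \<union> VY" .
  have "W ` VX = (\<lambda>i. {x i} \<union> y i ` {1..d - 1}) ` {1..n}"
    unfolding assms(3) image_image by (rule image_cong[OF refl Wx])
  then have E'_eq: "whiskered.E' VX E W = E'" unfolding assms(10) E'_def by (simp only:)
  show ?thesis
    using cohen_macaulay_whiskered[of K] packing_property_whiskered[of K] max_flow_min_cut_whiskered
    unfolding V_eq E'_eq by (intro conjI impI)
qed

end
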